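(* Let $(\mathcal{H},\Lambda)$ be a Hopf Galois order setting over a field $\Bbbk$ and let $F$ be an $\mathcal{H}$-Galois $\Lambda$-order. Then: (i) $\mathrm{Dist}(\Lambda)$ is an $F^{\mathrm{op}}$-submodule of $\Lambda^\ast$. (ii) $\mathrm{Dist}(\Lambda)$ is a Harish-Chandra $F^{\mathrm{op}}$-module with respect to $\Lambda$. (iii) If $\lambda:\Lambda\to\Bbbk$ is an algebra map with kernel $\mathfrak{m}_\lambda$, then the cyclic left $F^{\mathrm{op}}$-submodule of $\mathrm{Dist}(\Lambda)$ generated by $\lambda$ has a unique simple quotient $V(\lambda)$. Moreover $V(\lambda)$ is a simple Harish-Chandra $F^{\mathrm{op}}$-module with $V(\lambda)^{\mathfrak{m}_\lambda}\neq 0$.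
   Context: Let $\Bbbk$ be an arbitrary field; all algebras are over $\Bbbk$ and $\otimes=\otimes_{\Bbbk}$. A Hopf Galois order setting (or setting) is a pair $(\mathcal{H},\Lambda)$ where $\mathcal{H}$ is a left coideal subalgebra (a subalgebra with $\Delta(\mathcal{H})\subset\tilde{\mathcal{H}}\otimes\mathcal{H}$) of a Hopf algebra $\tilde{\mathcal{H}}$ (which is part of the data) with comultiplication $\Delta(x)=x_{(1)}\otimes x_{(2)}$, counit $\varepsilon$ and invertible antipode $S$, and $\Lambda$ is a left $\tilde{\mathcal{H}}$-module algebra (action denoted $x\triangleright a$) such that (i) $\Lambda$ is a noetherian (commutative) integral domain; (ii) the action of $\tilde{\mathcal{H}}$ on $\Lambda$ extends to an action on the field of fractions $L=\mathrm{Frac}(\Lambda)$ (also denoted $\triangleright$); (iii) $\Lambda$ is faithful as a left module over the smash product $\Lambda\#\mathcal{H}$. The smash product $A\#\mathcal{H}$ (for $A=\Lambda$ or $L$) is the algebra containing $A$ and $\mathcal{H}$ as subalgebras such that $A\otimes\mathcal{H}\to A\#\mathcal{H}$, $a\otimes x\mapsto ax$, is a vector space isomorphism and $xa=(x_{(1)}\triangleright a)x_{(2)}$ for $x\in\mathcal{H}$, $a\in A$. For $X\in L\#\tilde{\mathcal{H}}$, $\hat X$ denotes the corresponding linear endomorphism of $L$, determined by $\hat f(g)=fg$ for $f,g\in L$ and $\hat x(f)=x\triangleright f$ for $x\in\tilde{\mathcal{H}}$. An $\mathcal{H}$-Galois $\Lambda$-order is a subalgebra $F\subset L\#\mathcal{H}$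 such that $\Lambda\subset F$, $LF=L\#\mathcal{H}$, and $\hat X(\Lambda)\subset\Lambda$ for all $X\in F$. Thus $\Lambda$ is a left $F$-module via $X\mapsto\hat X$, and the dual space $\Lambda^\ast=\mathrm{Hom}_{\Bbbk}(\Lambda,\Bbbk)$ is a left $F^{\mathrm{op}}$-module with $(X\xi)(a)=\xi(\hat X(a))$ for $\xi\in\Lambda^\ast$, $X\in F^{\mathrm{op}}$, $a\in\Lambda$. For a maximal ideal $\mathfrak{m}$ of $\Lambda$ of finite codimension, $\mathrm{Dist}(\Lambda,\mathfrak{m})$ is the subspace of all $\xi\in\Lambda^\ast$ with $\mathfrak{m}^n\subset\ker\xi$ for $n\gg 0$, and $\mathrm{Dist}(\Lambda)=\bigoplus_{\mathfrak{m}}\mathrm{Dist}(\Lambda,\mathfrak{m})\subset\Lambda^\ast$, the sum being over all maximal ideals of finite codimension. For a left $F^{\mathrm{op}}$-module $V$ and a maximal ideal $\mathfrak{m}$ of $\Lambda$, put $V^{\mathfrak{m}}=\{v\in V\mid \mathfrak{m}^Nv=0 \text{ for } N\gg 0\}$. $V$ is a Harish-Chandra module (with respect to $\Lambda$) if $V=\bigoplus V^{\mathfrak{m}}$, the sum being over all maximal ideals $\mathfrak{m}$ of $\Lambda$ of finite codimension. *)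

theory Defs
  imports "HOL-Algebra.Algebraic_Closure_Type" "HOL-Algebra.Ideal_Product" "HOL-Library.Poly_Mapping"
    "HOL-Computational_Algebra.Polynomial_Factorial"
begin

text \<open>
  The ground field, the ambient Hopf algebra, \<open>\<Lambda>\<close>, its field of fractions and the
  smash product of the latter with the Hopf algebra are types; scalar multiplications are explicit
  parameters. Subalgebras are sets. Modules over the opposite algebra, their submodules and
  quotients are records as in HOL-Algebra, and \<^const>\<open>ring_of_type_algebra\<close> makes the ideals,
  maximal ideals and noetherian rings of HOL-Algebra available for types.
\<close>

section \<open>Algebras and tensors\<close>

locale k_algebra = vector_space scale
  for scale :: "'k::field \<Rightarrow> 'a::ring_1 \<Rightarrow> 'a" +
  assumes scale_mult_left: "scale c (x * y) = scale c x * y"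
    and scale_mult_right: "scale c (x * y) = x * scale c y"

definition subalgebra :: "('k::field \<Rightarrow> 'a::ring_1 \<Rightarrow> 'a) \<Rightarrow> 'a set \<Rightarrow> bool" where
  "subalgebra scale B \<longleftrightarrow>
     module.subspace scale B \<and> 1 \<in> B \<and> (\<forall>x\<in>B. \<forall>y\<in>B. x * y \<in> B)"

definition algebra_hom ::
  "('k::field \<Rightarrow> 'a::ring_1 \<Rightarrow> 'a) \<Rightarrow> ('k \<Rightarrow> 'b::ring_1 \<Rightarrow> 'b) \<Rightarrow> ('a \<Rightarrow> 'b) \<Rightarrow> bool" where
  "algebra_hom s1 s2 f \<longleftrightarrow>
     Vector_Spaces.linear s1 s2 f \<and> f 1 = 1 \<and> (\<forall>x y. f (x * y) = f x * f y)"

text \<open>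
  An element of \<open>V \<otimes> W\<close> is given by a list \<open>[(v\<^sub>1, w\<^sub>1), \<dots>]\<close> standing for
  \<open>\<Sum>\<^sub>i v\<^sub>i \<otimes> w\<^sub>i\<close>. Two lists denote the same tensor iff they agree in the quotient of the
  free vector space on \<open>V \<times> W\<close> by the bilinearity relations.
\<close>

definition free_scale :: "'k::field \<Rightarrow> ('a \<Rightarrow>\<^sub>0 'k) \<Rightarrow> ('a \<Rightarrow>\<^sub>0 'k)" where
  "free_scale c = Poly_Mapping.map ((*) c)"

definition formal_sum :: "'a list \<Rightarrow> ('a \<Rightarrow>\<^sub>0 'k::field)" where
  "formal_sum ts = (\<Sum>t\<leftarrow>ts. Poly_Mapping.single t 1)"

definition tensor_relations ::
  "('k::field \<Rightarrow> 'v::ab_group_add \<Rightarrow> 'v) \<Rightarrow> ('k \<Rightarrow> 'w::ab_group_add \<Rightarrow> 'w) \<Rightarrow> ('v \<times> 'w \<Rightarrow>\<^sub>0 'k) set" where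
  "tensor_relations sV sW =
     {Poly_Mapping.single (v + v', w) 1 - Poly_Mapping.single (v, w) 1
        - Poly_Mapping.single (v', w) 1 | v v' w. True} \<union>
     {Poly_Mapping.single (v, w + w') 1 - Poly_Mapping.single (v, w) 1
        - Poly_Mapping.single (v, w') 1 | v w w'. True} \<union>
     {Poly_Mapping.single (sV c v, w) 1 - Poly_Mapping.single (v, w) c | c v w. True} \<union>
     {Poly_Mapping.single (v, sW c w) 1 - Poly_Mapping.single (v, w) c | c v w. True}"

definition tensor_eq ::
  "('k::field \<Rightarrow> 'v::ab_group_add \<Rightarrow> 'v) \<Rightarrow> ('k \<Rightarrow> 'w::ab_group_add \<Rightarrow> 'w) \<Rightarrow>
     ('v \<times> 'w) list \<Rightarrow> ('v \<times> 'w) list \<Rightarrow> bool" where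
  "tensor_eq sV sW ts us \<longleftrightarrow>
     formal_sum ts - formal_sum us \<in> module.span free_scale (tensor_relations sV sW)"

definition tensor3_relations ::
  "('k::field \<Rightarrow> 'v::ab_group_add \<Rightarrow> 'v) \<Rightarrow> ('v \<times> 'v \<times> 'v \<Rightarrow>\<^sub>0 'k) set" where
  "tensor3_relations s =
     {Poly_Mapping.single (x + x', y, z) 1 - Poly_Mapping.single (x, y, z) 1
        - Poly_Mapping.single (x', y, z) 1 | x x' y z. True} \<union>
     {Poly_Mapping.single (x, y + y', z) 1 - Poly_Mapping.single (x, y, z) 1
        - Poly_Mapping.single (x, y', z) 1 | x y y' z. True} \<union>
     {Poly_Mapping.single (x, y, z + z') 1 - Poly_Mapping.single (x, y, z) 1
        - Poly_Mapping.single (x, y, z') 1 | x y z z'. True} \<union>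
     {Poly_Mapping.single (s c x, y, z) 1 - Poly_Mapping.single (x, y, z) c | c x y z. True} \<union>
     {Poly_Mapping.single (x, s c y, z) 1 - Poly_Mapping.single (x, y, z) c | c x y z. True} \<union>
     {Poly_Mapping.single (x, y, s c z) 1 - Poly_Mapping.single (x, y, z) c | c x y z. True}"

definition tensor3_eq ::
  "('k::field \<Rightarrow> 'v::ab_group_add \<Rightarrow> 'v) \<Rightarrow> ('v \<times> 'v \<times> 'v) list \<Rightarrow> ('v \<times> 'v \<times> 'v) list \<Rightarrow> bool" where
  "tensor3_eq s ts us \<longleftrightarrow>
     formal_sum ts - formal_sum us \<in> module.span free_scale (tensor3_relations s)"

section \<open>Hopf algebras and smash products\<close>

text \<open>
  \<open>\<Delta> x\<close> is a chosen list representing the tensor \<open>x\<^sub>(\<^sub>1\<^sub>) \<otimes> x\<^sub>(\<^sub>2\<^sub>)\<close>, so the identities for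
  \<open>\<Delta>\<close> hold only up to \<^const>\<open>tensor_eq\<close>. The antipode is required to be invertible.
\<close>

locale hopf_algebra = k_algebra sH
  for sH :: "'k::field \<Rightarrow> 'h::ring_1 \<Rightarrow> 'h" +
  fixes \<Delta> :: "'h \<Rightarrow> ('h \<times> 'h) list"
    and \<epsilon> :: "'h \<Rightarrow> 'k"
    and S :: "'h \<Rightarrow> 'h"
  assumes comult_add: "tensor_eq sH sH (\<Delta> (x + y)) (\<Delta> x @ \<Delta> y)"
    and comult_scale: "tensor_eq sH sH (\<Delta> (sH c x)) [(sH c y, z). (y, z) \<leftarrow> \<Delta> x]"
    and comult_one: "tensor_eq sH sH (\<Delta> 1) [(1, 1)]"
    and comult_mult:
      "tensor_eq sH sH (\<Delta> (x * y)) [(a * c, b * d). (a, b) \<leftarrow> \<Delta> x, (c, d) \<leftarrow> \<Delta> y]"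
    and coassoc:
      "tensor3_eq sH [(a, b, z). (y, z) \<leftarrow> \<Delta> x, (a, b) \<leftarrow> \<Delta> y]
                     [(y, a, b). (y, z) \<leftarrow> \<Delta> x, (a, b) \<leftarrow> \<Delta> z]"
    and counit_hom: "algebra_hom sH (*) \<epsilon>"
    and counit_left: "(\<Sum>(y, z)\<leftarrow>\<Delta> x. sH (\<epsilon> y) z) = x"
    and counit_right: "(\<Sum>(y, z)\<leftarrow>\<Delta> x. sH (\<epsilon> z) y) = x"
    and antipode_linear: "Vector_Spaces.linear sH sH S"
    and antipode_left: "(\<Sum>(y, z)\<leftarrow>\<Delta> x. S y * z) = sH (\<epsilon> x) 1"
    and antipode_right: "(\<Sum>(y, z)\<leftarrow>\<Delta> x. y * S z) = sH (\<epsilon> x) 1"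
    and antipode_bij: "bij S"

definition left_coideal_subalgebra ::
  "('k::field \<Rightarrow> 'h::ring_1 \<Rightarrow> 'h) \<Rightarrow> ('h \<Rightarrow> ('h \<times> 'h) list) \<Rightarrow> 'h set \<Rightarrow> bool" where
  "left_coideal_subalgebra sH \<Delta> H \<longleftrightarrow> subalgebra sH H \<and>
     (\<forall>x\<in>H. \<exists>ts. set ts \<subseteq> UNIV \<times> H \<and> tensor_eq sH sH (\<Delta> x) ts)"

locale module_algebra = hopf_algebra sH \<Delta> \<epsilon> S + A: k_algebra sA
  for sH :: "'k::field \<Rightarrow> 'h::ring_1 \<Rightarrow> 'h" and \<Delta> \<epsilon> S
    and sA :: "'k \<Rightarrow> 'a::ring_1 \<Rightarrow> 'a" +
  fixes act :: "'h \<Rightarrow> 'a \<Rightarrow> 'a"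
  assumes act_linear: "Vector_Spaces.linear sA sA (act x)"
    and act_linear_left: "Vector_Spaces.linear sH sA (\<lambda>x. act x a)"
    and act_one_left: "act 1 a = a"
    and act_mult_left: "act (x * y) a = act x (act y a)"
    and act_mult: "act x (a * b) = (\<Sum>(y, z)\<leftarrow>\<Delta> x. act y a * act z b)"
    and act_one: "act x 1 = sA (\<epsilon> x) 1"

text \<open>
  \<open>'s\<close> is (a model of) the smash product of \<open>A\<close> with the Hopf algebra, with embeddings
  \<open>\<iota>A\<close> and \<open>\<iota>H\<close>. The assumptions \<open>smash_span\<close> and \<open>smash_tensor\<close> say that
  \<open>a \<otimes> x \<mapsto> a x\<close> is surjective and injective.
\<close>

locale smash_product =
  module_algebra sH \<Delta> \<epsilon> S sA act + smash: k_algebra sS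
  for sH :: "'k::field \<Rightarrow> 'h::ring_1 \<Rightarrow> 'h" and \<Delta> \<epsilon> S
    and sA :: "'k \<Rightarrow> 'a::ring_1 \<Rightarrow> 'a" and act
    and sS :: "'k \<Rightarrow> 's::ring_1 \<Rightarrow> 's" +
  fixes \<iota>A :: "'a \<Rightarrow> 's" and \<iota>H :: "'h \<Rightarrow> 's"
  assumes emb_A: "algebra_hom sA sS \<iota>A" "inj \<iota>A"
    and emb_H: "algebra_hom sH sS \<iota>H" "inj \<iota>H"
    and smash_span: "\<exists>ts. Z = (\<Sum>(a, x)\<leftarrow>ts. \<iota>A a * \<iota>H x)"
    and smash_tensor:
      "(\<Sum>(a, x)\<leftarrow>ts. \<iota>A a * \<iota>H x) = 0 \<Longrightarrow> tensor_eq sA sH ts []"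
    and smash_commute: "\<iota>H x * \<iota>A a = (\<Sum>(y, z)\<leftarrow>\<Delta> x. \<iota>A (act y a) * \<iota>H z)"

text \<open>
  For a subalgebra \<open>A'\<close> of \<open>A\<close> stable under the Hopf algebra and a left coideal subalgebra
  \<open>H\<close>, the smash product \<open>A' # H\<close> is the subspace \<open>A' H\<close> of the ambient smash
  product: \<open>A' \<otimes> H\<close> embeds into \<open>A \<otimes> \<close>(Hopf algebra), and the relation
  \<open>x a = (x\<^sub>(\<^sub>1\<^sub>) \<triangleright> a) x\<^sub>(\<^sub>2\<^sub>)\<close> is inherited.
\<close>

definition smash_sub ::
  "('a \<Rightarrow> 's::ring_1) \<Rightarrow> ('h \<Rightarrow> 's) \<Rightarrow> 'a set \<Rightarrow> 'h set \<Rightarrow> 's set" where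
  "smash_sub \<iota>A \<iota>H A' H = {\<Sum>(a, x)\<leftarrow>ts. \<iota>A a * \<iota>H x | ts. set ts \<subseteq> A' \<times> H}"

section \<open>Hopf Galois order settings and Galois orders\<close>

definition fract_scale :: "('k \<Rightarrow> 'l::idom \<Rightarrow> 'l) \<Rightarrow> 'k \<Rightarrow> 'l fract \<Rightarrow> 'l fract" where
  "fract_scale s\<Lambda> c f = to_fract (s\<Lambda> c 1) * f"

text \<open>
  The representation \<open>Z \<mapsto> hat Z\<close> of the smash product on the field of fractions. In a setting
  it exists and is unique: \<open>\<Sum>\<^sub>i f\<^sub>i x\<^sub>i\<close> has to act as \<open>g \<mapsto> \<Sum>\<^sub>i f\<^sub>i (x\<^sub>i \<triangleright> g)\<close>. Compatibility
  with scalars follows from that with \<open>\<iota>L\<close>.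
\<close>

definition smash_hat ::
  "('k::field \<Rightarrow> 'l::idom \<Rightarrow> 'l) \<Rightarrow> ('h \<Rightarrow> 'l fract \<Rightarrow> 'l fract) \<Rightarrow>
     ('l fract \<Rightarrow> 's::ring_1) \<Rightarrow> ('h \<Rightarrow> 's) \<Rightarrow> 's \<Rightarrow> 'l fract \<Rightarrow> 'l fract" where
  "smash_hat s\<Lambda> actL \<iota>L \<iota>H = (THE \<rho>.
     (\<forall>Z. Vector_Spaces.linear (fract_scale s\<Lambda>) (fract_scale s\<Lambda>) (\<rho> Z)) \<and>
     (\<forall>Z Y g. \<rho> (Z + Y) g = \<rho> Z g + \<rho> Y g) \<and>
     (\<forall>Z Y g. \<rho> (Z * Y) g = \<rho> Z (\<rho> Y g)) \<and>
     (\<forall>f g. \<rho> (\<iota>L f) g = f * g) \<and>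
     (\<forall>x g. \<rho> (\<iota>H x) g = actL x g))"

locale hopf_galois_setting =
  \<Lambda>: module_algebra sH \<Delta> \<epsilon> S s\<Lambda> act +
  smash_product sH \<Delta> \<epsilon> S "fract_scale s\<Lambda>" actL sS \<iota>L \<iota>H
  for sH :: "'k::field \<Rightarrow> 'h::ring_1 \<Rightarrow> 'h" and \<Delta> \<epsilon> S
    and H :: "'h set"
    and s\<Lambda> :: "'k \<Rightarrow> 'l::idom \<Rightarrow> 'l" and act
    and actL :: "'h \<Rightarrow> 'l fract \<Rightarrow> 'l fract"
    and sS :: "'k \<Rightarrow> 's::ring_1 \<Rightarrow> 's" and \<iota>L \<iota>H +
  assumes coideal: "left_coideal_subalgebra sH \<Delta> H"
    and noetherian: "noetherian_ring (ring_of_type_algebra :: 'l ring)"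
    and act_extends: "actL x (to_fract a) = to_fract (act x a)"
    and faithful:
      "Z \<in> smash_sub \<iota>L \<iota>H (range to_fract) H \<Longrightarrow>
       (\<And>a. smash_hat s\<Lambda> actL \<iota>L \<iota>H Z (to_fract a) = 0) \<Longrightarrow> Z = 0"

definition galois_order ::
  "('h \<Rightarrow> 'l fract \<Rightarrow> 'l fract) \<Rightarrow> 'h set \<Rightarrow> ('k::field \<Rightarrow> 'l::idom \<Rightarrow> 'l) \<Rightarrow>
     ('k \<Rightarrow> 's::ring_1 \<Rightarrow> 's) \<Rightarrow> ('l fract \<Rightarrow> 's) \<Rightarrow> ('h \<Rightarrow> 's) \<Rightarrow> 's set \<Rightarrow> bool" where
  "galois_order actL H s\<Lambda> sS \<iota>L \<iota>H F \<longleftrightarrow>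
     subalgebra sS F \<and>
     F \<subseteq> smash_sub \<iota>L \<iota>H UNIV H \<and>
     (\<forall>a. \<iota>L (to_fract a) \<in> F) \<and>
     {\<Sum>(f, Z)\<leftarrow>ts. \<iota>L f * Z | ts. set ts \<subseteq> UNIV \<times> F} = smash_sub \<iota>L \<iota>H UNIV H \<and>
     (\<forall>Z\<in>F. smash_hat s\<Lambda> actL \<iota>L \<iota>H Z ` range to_fract \<subseteq> range to_fract)"

section \<open>Modules over a (noncommutative) ring\<close>

text \<open>The locale \<^locale>\<open>Module.module\<close> of HOL-Algebra demands a commutative ring.\<close>

locale left_module = R?: ring R + M?: abelian_group M
  for R :: "('r, 'c) ring_scheme" (structure) and M :: "('r, 'v, 'e) module_scheme" (structure) +
  assumes smult_closed: "\<lbrakk>r \<in> carrier R; v \<in> carrier M\<rbrakk> \<Longrightarrow> r \<odot>\<^bsub>M\<^esub> v \<in> carrier M"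
    and smult_l_distr: "\<lbrakk>r \<in> carrier R; s \<in> carrier R; v \<in> carrier M\<rbrakk> \<Longrightarrow>
      (r \<oplus>\<^bsub>R\<^esub> s) \<odot>\<^bsub>M\<^esub> v = r \<odot>\<^bsub>M\<^esub> v \<oplus>\<^bsub>M\<^esub> s \<odot>\<^bsub>M\<^esub> v"
    and smult_r_distr: "\<lbrakk>r \<in> carrier R; v \<in> carrier M; w \<in> carrier M\<rbrakk> \<Longrightarrow>
      r \<odot>\<^bsub>M\<^esub> (v \<oplus>\<^bsub>M\<^esub> w) = r \<odot>\<^bsub>M\<^esub> v \<oplus>\<^bsub>M\<^esub> r \<odot>\<^bsub>M\<^esub> w"
    and smult_assoc: "\<lbrakk>r \<in> carrier R; s \<in> carrier R; v \<in> carrier M\<rbrakk> \<Longrightarrow>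
      (r \<otimes>\<^bsub>R\<^esub> s) \<odot>\<^bsub>M\<^esub> v = r \<odot>\<^bsub>M\<^esub> (s \<odot>\<^bsub>M\<^esub> v)"
    and smult_one: "v \<in> carrier M \<Longrightarrow> \<one>\<^bsub>R\<^esub> \<odot>\<^bsub>M\<^esub> v = v"

definition simple_module :: "('r, 'c) ring_scheme \<Rightarrow> ('r, 'v, 'e) module_scheme \<Rightarrow> bool" where
  "simple_module R M \<longleftrightarrow> left_module R M \<and> carrier M \<noteq> {\<zero>\<^bsub>M\<^esub>} \<and>
     (\<forall>N. submodule N R M \<longrightarrow> N = {\<zero>\<^bsub>M\<^esub>} \<or> N = carrier M)"

text \<open>The fields \<open>mult\<close> and \<open>one\<close> of a module record carry no information.\<close>

definition quotient_module ::
  "('r, 'v, 'e) module_scheme \<Rightarrow> 'v set \<Rightarrow> ('r, 'v set) module" where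
  "quotient_module M N =
     \<lparr>carrier = a_rcosets\<^bsub>M\<^esub> N, monoid.mult = undefined, one = undefined,
      zero = N, add = set_add M, module.smult = (\<lambda>r C. \<Union>v\<in>C. N +>\<^bsub>M\<^esub> (r \<odot>\<^bsub>M\<^esub> v))\<rparr>"

definition cyclic_submodule ::
  "('r, 'c) ring_scheme \<Rightarrow> ('r, 'v, 'e) module_scheme \<Rightarrow> 'v \<Rightarrow> 'v set" where
  "cyclic_submodule R M v = {r \<odot>\<^bsub>M\<^esub> v | r. r \<in> carrier R}"

definition internal_direct_sum ::
  "('r, 'v, 'e) module_scheme \<Rightarrow> 'i set \<Rightarrow> ('i \<Rightarrow> 'v set) \<Rightarrow> bool" where
  "internal_direct_sum M I U \<longleftrightarrow> (\<forall>i\<in>I. additive_subgroup (U i) M) \<and>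
     (\<forall>v\<in>carrier M. \<exists>!u. (\<forall>i\<in>I. u i \<in> U i) \<and> (\<forall>i. i \<notin> I \<longrightarrow> u i = \<zero>\<^bsub>M\<^esub>) \<and>
        finite {i. u i \<noteq> \<zero>\<^bsub>M\<^esub>} \<and> v = finsum M u {i. u i \<noteq> \<zero>\<^bsub>M\<^esub>})"

section \<open>Harish-Chandra modules and distributions\<close>

definition opposite_algebra :: "'s::ring_1 set \<Rightarrow> 's ring" where
  "opposite_algebra F = ring_of_type_algebra\<lparr>carrier := F, monoid.mult := (\<lambda>Z Y. Y * Z)\<rparr>"

definition ideal_power :: "'l::idom set \<Rightarrow> nat \<Rightarrow> 'l set" where
  "ideal_power \<mm> n = \<mm> [^]\<^bsub>ideals_set ring_of_type_algebra\<^esub> n"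

definition cofinite_maximal_ideals :: "('k::field \<Rightarrow> 'l::idom \<Rightarrow> 'l) \<Rightarrow> 'l set set" where
  "cofinite_maximal_ideals s\<Lambda> = {\<mm>. maximalideal \<mm> ring_of_type_algebra \<and>
     (\<exists>B. finite B \<and> (\<forall>a. \<exists>b\<in>module.span s\<Lambda> B. a - b \<in> \<mm>))}"

text \<open>In the following two definitions \<open>emb\<close> is the embedding of \<open>\<Lambda>\<close> into the acting ring.\<close>

definition weight_space ::
  "('l::idom \<Rightarrow> 'r) \<Rightarrow> ('r, 'v, 'e) module_scheme \<Rightarrow> 'l set \<Rightarrow> 'v set" where
  "weight_space emb M \<mm> = {v \<in> carrier M.
     \<exists>N\<^sub>0. \<forall>N\<ge>N\<^sub>0. \<forall>a\<in>ideal_power \<mm> N. emb a \<odot>\<^bsub>M\<^esub> v = \<zero>\<^bsub>M\<^esub>}"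

definition harish_chandra ::
  "('k::field \<Rightarrow> 'l::idom \<Rightarrow> 'l) \<Rightarrow> ('l \<Rightarrow> 'r) \<Rightarrow> ('r, 'c) ring_scheme \<Rightarrow>
     ('r, 'v, 'e) module_scheme \<Rightarrow> bool" where
  "harish_chandra s\<Lambda> emb R M \<longleftrightarrow> left_module R M \<and>
     internal_direct_sum M (cofinite_maximal_ideals s\<Lambda>) (weight_space emb M)"

definition dual_space :: "('k::field \<Rightarrow> 'l::idom \<Rightarrow> 'l) \<Rightarrow> ('l \<Rightarrow> 'k) set" where
  "dual_space s\<Lambda> = {\<xi>. Vector_Spaces.linear s\<Lambda> (*) \<xi>}"

text \<open>
  The dual space with the action \<open>(Z \<xi>)(a) = \<xi>(hat Z a)\<close>, where the image of \<open>a\<close> lies in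
  \<open>\<Lambda>\<close> for every \<open>Z\<close> in a Galois order.
\<close>

definition dual_module ::
  "('k::field \<Rightarrow> 'l::idom \<Rightarrow> 'l) \<Rightarrow> ('h \<Rightarrow> 'l fract \<Rightarrow> 'l fract) \<Rightarrow>
     ('l fract \<Rightarrow> 's::ring_1) \<Rightarrow> ('h \<Rightarrow> 's) \<Rightarrow> ('s, 'l \<Rightarrow> 'k) module" where
  "dual_module s\<Lambda> actL \<iota>L \<iota>H =
     \<lparr>carrier = dual_space s\<Lambda>, monoid.mult = undefined, one = undefined,
      zero = (\<lambda>_. 0), add = (\<lambda>\<xi> \<eta> a. \<xi> a + \<eta> a),
      module.smult = (\<lambda>Z \<xi> a. \<xi> (THE b. to_fract b = smash_hat s\<Lambda> actL \<iota>L \<iota>H Z (to_fract a)))\<rparr>"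

definition dist_at :: "('k::field \<Rightarrow> 'l::idom \<Rightarrow> 'l) \<Rightarrow> 'l set \<Rightarrow> ('l \<Rightarrow> 'k) set" where
  "dist_at s\<Lambda> \<mm> = {\<xi> \<in> dual_space s\<Lambda>.
     \<exists>n\<^sub>0. \<forall>n\<ge>n\<^sub>0. \<forall>a\<in>ideal_power \<mm> n. \<xi> a = 0}"

text \<open>
  The sum of the subspaces \<^const>\<open>dist_at\<close> inside the dual space; directness is a property
  of this sum, not a restriction on its elements.
\<close>

definition distributions :: "('k::field \<Rightarrow> 'l::idom \<Rightarrow> 'l) \<Rightarrow> ('l \<Rightarrow> 'k) set" where
  "distributions s\<Lambda> = {(\<lambda>a. \<Sum>\<mm>\<in>J. u \<mm> a) | J u.
     finite J \<and> J \<subseteq> cofinite_maximal_ideals s\<Lambda> \<and> (\<forall>\<mm>\<in>J. u \<mm> \<in> dist_at s\<Lambda> \<mm>)}"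

end

theory Submission
  imports Defs "HOL-Library.Function_Algebras"
begin

text \<open>
  A functional \<open>\<xi>\<close> on \<open>\<Lambda>\<close> is a distribution iff its translates \<open>a\<xi> = \<xi>(a \<cdot> _)\<close> span a
  finite-dimensional space. For \<open>X = \<Sum>\<^sub>i f\<^sub>i x\<^sub>i\<close> in the Galois order, the commutation rule
  \<open>x a = (x\<^sub>(\<^sub>1\<^sub>) \<triangleright> a) x\<^sub>(\<^sub>2\<^sub>)\<close> puts \<open>\<Lambda>X\<Lambda>\<close> inside the left \<open>\<Lambda>\<close>-module generated by the finitely many
  \<open>f\<^sub>i x\<^sub>i\<^sub>(\<^sub>2\<^sub>)\<close>, so it is finitely generated because \<open>\<Lambda>\<close> is noetherian. Writing \<open>X a = \<Sum>\<^sub>j \<lambda>\<^sub>j X a\<^sub>j\<close>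
  shows that the translates of \<open>\<xi> \<circ> X\<close> again span a finite-dimensional space. For the unique simple
  quotient, \<open>Dist(\<Lambda>, \<mm>\<^sub>\<lambda>)\<close> has socle \<open>k\<lambda>\<close>: a submodule with a nonzero \<open>\<mm>\<^sub>\<lambda>\<close>-weight
  space contains \<open>\<lambda>\<close>, and so the sum of all proper submodules of \<open>F\<lambda>\<close> is proper.
\<close>

section \<open>Noetherian rings and ideal powers\<close>

text \<open>The support of \<open>\<xi> \<circ> X\<close> cannot be read off from the support of
  \<xi>, since X is in general not an automorphism; hence a criterion for distributions that
  mentions no maximal ideal. The coefficients of X lie in the fraction field, so the
  \<open>f\<^sub>i x\<^sub>i\<^sub>(\<^sub>2\<^sub>)\<close> need not preserve \<Lambda> and \<xi>
  cannot be composed with them. Noetherianity moves the generators into \<Lambda>X\<Lambda>, all of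
  whose members map \<Lambda> to itself. The argument is carried out among maps from \<Lambda> to
  its fraction field, so that only the action of X is involved. The ground field is arbitrary and
  the residue fields may be proper extensions of it; the way back from finite-dimensional translates
  to a sum of local distributions is therefore a noetherian induction on the annihilator of \<xi>
  that lifts no idempotents and uses no eigenvalues. In (iii), rationality of the point makes every
  functional killed by its maximal ideal a multiple of \<lambda>.\<close>

lemma module_mult: "Modules.module ((*) :: 'a::comm_ring_1 \<Rightarrow> 'a \<Rightarrow> 'a)"
  by unfold_locales (auto simp: algebra_simps)

text \<open>With the ring acting on itself by multiplication, ideals are subspaces, so
  \<open>span\<close> and its induction rules serve for ideal generation.\<close>

lemma ideal_type_iff:
  "ideal I (ring_of_type_algebra :: 'a::comm_ring_1 ring) \<longleftrightarrow> module.subspace (*) I"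
proof
  assume "ideal I (ring_of_type_algebra :: 'a ring)"
  then interpret ideal I "ring_of_type_algebra :: 'a ring" .
  show "module.subspace (*) I"
    using additive_subgroup.zero_closed[OF is_additive_subgroup]
      additive_subgroup.a_closed[OF is_additive_subgroup] I_l_closed
    by (auto simp: module.subspace_def[OF module_mult] ring_of_type_algebra_def)
next
  let ?R = "ring_of_type_algebra :: 'a ring"
  assume I: "module.subspace (*) I"
  interpret R: ring ?R ..
  have inv: "inv\<^bsub>add_monoid ?R\<^esub> x = - x" for x
    using R.add.inv_equality[of "- x" x] unfolding a_inv_def by (simp add: ring_of_type_algebra_def)
  have neg: "- x \<in> I" if "x \<in> I" for x
    using module.subspace_neg[OF module_mult I that] .
  have "subgroup I (add_monoid ?R)"
    using I neg inv
    by (intro subgroup.intro) (auto simp: module.subspace_def[OF module_mult] ring_of_type_algebra_def)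
  moreover have "x * a \<in> I" "a * x \<in> I" if "a \<in> I" for a x
    using module.subspace_scale[OF module_mult I that, of x] by (simp_all add: mult.commute)
  ultimately show "ideal I ?R"
    by (intro idealI R.ring_axioms) (auto simp: ring_of_type_algebra_def)
qed

lemma genideal_type_eq:
  "genideal (ring_of_type_algebra :: 'a::comm_ring_1 ring) A = module.span (*) A"
  unfolding genideal_def ideal_type_iff module.span_def[OF module_mult] hull_def by simp

lemma noetherian_type_fg:
  assumes "noetherian_ring (ring_of_type_algebra :: 'a::comm_ring_1 ring)"
    and "module.subspace (*) (I :: 'a set)"
  obtains A where "finite A" "I = module.span (*) A"
  using noetherian_ring.finetely_gen[OF assms(1)] assms(2)
  unfolding ideal_type_iff genideal_type_eq by blast

text \<open>In a noetherian ring a nonempty chain of ideals contains its own union, so the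
  hypothesis of Zorn's lemma holds for any family of ideals. Every noetherian induction below starts
  here.\<close>

lemma noetherian_maximal_ideal_in:
  assumes "noetherian_ring (ring_of_type_algebra :: 'a::comm_ring_1 ring)"
    and "\<A> \<noteq> {}" and "\<And>I. I \<in> \<A> \<Longrightarrow> module.subspace (*) (I :: 'a set)"
  shows "\<exists>I\<in>\<A>. \<forall>J\<in>\<A>. I \<subseteq> J \<longrightarrow> J = I"
proof -
  have "\<Union>C \<in> \<A>" if "C \<noteq> {}" "subset.chain \<A> C" for C
  proof -
    have "subset.chain {I. ideal I (ring_of_type_algebra :: 'a ring)} C"
      using that assms(3) by (auto simp: subset.chain_def ideal_type_iff)
    then have "\<Union>C \<in> C"
      using noetherian_ring.ideal_chain_is_trivial[OF assms(1) that(1)] by blast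
    then show ?thesis using that by (auto simp: subset.chain_def)
  qed
  then show ?thesis using subset_Zorn_nonempty[OF assms(2)] by blast
qed

text \<open>Induction on the generators, as in Hilbert's basis theorem: an ideal of leading
  coefficients handles the new generator, the induction hypothesis the rest. That the finite set can
  be taken inside \<open>M\<close> is what the application relies on.\<close>

lemma (in Modules.module) noetherian_submodule_fg:
  fixes E M
  assumes noeth: "noetherian_ring (ring_of_type_algebra :: 'a ring)"
  shows "finite E \<Longrightarrow> subspace M \<Longrightarrow> M \<subseteq> span E \<Longrightarrow> \<exists>A. finite A \<and> A \<subseteq> M \<and> M \<subseteq> span A"
proof (induction E arbitrary: M rule: finite_induct)
  case empty
  then show ?case by (intro exI[of _ "{}"]) auto
next
  case (insert e E)
  interpret ring: Modules.module "(*) :: 'a \<Rightarrow> 'a \<Rightarrow> 'a" by (rule module_mult)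
  note ring.scale_scale [simp del] \<comment> \<open>\<open>a * (b * x) = a * b * x\<close>, which loops with associativity\<close>
  \<comment> \<open>The coefficients at \<open>e\<close> that occur in elements of \<open>M\<close>,
    modulo the span of the other generators.\<close>
  define I where "I = {r. \<exists>m\<in>M. m - r *s e \<in> span E}"
  have "ring.subspace I"
  proof (rule ring.subspaceI)
    show "0 \<in> I" using subspace_0[OF insert.prems(1)] span_zero by (auto simp: I_def intro!: bexI[of _ 0])
  next
    fix r r' assume "r \<in> I" "r' \<in> I"
    then obtain m m' where m: "m \<in> M" "m - r *s e \<in> span E" "m' \<in> M" "m' - r' *s e \<in> span E"
      by (auto simp: I_def)
    have "(m + m') - (r + r') *s e = (m - r *s e) + (m' - r' *s e)" by (simp add: algebra_simps)
    then have "(m + m') - (r + r') *s e \<in> span E" using m span_add by metis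
    then show "r + r' \<in> I" using subspace_add[OF insert.prems(1) m(1,3)] by (auto simp: I_def)
  next
    fix c r assume "r \<in> I"
    then obtain m where m: "m \<in> M" "m - r *s e \<in> span E" by (auto simp: I_def)
    have "c *s m - (c * r) *s e = c *s (m - r *s e)" by (simp add: algebra_simps)
    then have "c *s m - (c * r) *s e \<in> span E" using m span_scale by metis
    then show "c * r \<in> I" using subspace_scale[OF insert.prems(1) m(1)] by (auto simp: I_def)
  qed
  then obtain R where R: "finite R" "I = ring.span R" by (rule noetherian_type_fg[OF noeth])
  have "\<forall>r\<in>R. \<exists>m\<in>M. m - r *s e \<in> span E" using ring.span_superset[of R] R by (auto simp: I_def)
  then obtain m where m: "\<And>r. r \<in> R \<Longrightarrow> m r \<in> M \<and> m r - r *s e \<in> span E" by metis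
  \<comment> \<open>Lifting a coefficient back to \<open>M\<close> using only the chosen
    \<open>m r\<close>; subtracting the lift from an element of \<open>M\<close> leaves
    \<open>M \<inter> span E\<close>.\<close>
  have lift: "\<exists>w\<in>span (m ` R). w \<in> M \<and> w - k *s e \<in> span E" if "k \<in> ring.span R" for k
    using that
  proof (induction rule: ring.span_induct_alt)
    case base
    then show ?case using subspace_0[OF insert.prems(1)] span_zero by (auto intro!: bexI[of _ 0])
  next
    case (step c r y)
    then obtain w where w: "w \<in> span (m ` R)" "w \<in> M" "w - y *s e \<in> span E" by auto
    have "c *s m r + w - (c * r + y) *s e = c *s (m r - r *s e) + (w - y *s e)"
      by (simp add: algebra_simps)
    moreover have "\<dots> \<in> span E" using w m step by (intro span_add span_scale) auto
    ultimately have "c *s m r + w - (c * r + y) *s e \<in> span E" by (simp only:)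
    moreover have "c *s m r + w \<in> span (m ` R)"
      using w step by (intro span_add span_scale) (auto intro: span_base)
    moreover have "c *s m r + w \<in> M"
      using w m step by (intro subspace_add subspace_scale insert.prems) auto
    ultimately show ?case by blast
  qed
  have "\<exists>A. finite A \<and> A \<subseteq> M \<inter> span E \<and> M \<inter> span E \<subseteq> span A"
    using insert.prems by (intro insert.IH) (auto intro: subspace_inter)
  then obtain A where A: "finite A" "A \<subseteq> M" "M \<inter> span E \<subseteq> span A" by blast
  have "M \<subseteq> span (m ` R \<union> A)"
  proof
    fix x assume x: "x \<in> M"
    then obtain k where k: "x - k *s e \<in> span E"
      using insert.prems(2) span_breakdown_eq[of x e E] by blast
    then have "k \<in> ring.span R" using x R by (auto simp: I_def)
    from lift[OF this] obtain w where w: "w \<in> span (m ` R)" "w \<in> M" "w - k *s e \<in> span E" by blast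
    have "x - w = (x - k *s e) - (w - k *s e)" by simp
    then have "x - w \<in> span E" using k w span_diff by metis
    then have "x - w \<in> span A" using A x w subspace_diff[OF insert.prems(1)] by blast
    then have "w + (x - w) \<in> span (m ` R \<union> A)"
      using w span_mono[of "m ` R" "m ` R \<union> A"] span_mono[of A "m ` R \<union> A"] by (intro span_add) auto
    then show "x \<in> span (m ` R \<union> A)" by simp
  qed
  then show ?case using A R m by (intro exI[of _ "m ` R \<union> A"]) auto
qed

section \<open>Powers of an ideal\<close>

lemma ideal_power_0 [simp]: "ideal_power \<mm> 0 = UNIV"
  by (simp add: ideal_power_def ideals_set_def ring_of_type_algebra_def)

lemma ideal_power_Suc:
  "ideal_power \<mm> (Suc n) = ideal_prod ring_of_type_algebra (ideal_power \<mm> n) \<mm>"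
  by (simp add: ideal_power_def ideals_set_def)

lemma ideal_power_SucI: "x \<in> ideal_power \<mm> n \<Longrightarrow> y \<in> \<mm> \<Longrightarrow> x * y \<in> ideal_power \<mm> (Suc n)"
  using ideal_prod.prod[of x _ y \<mm> ring_of_type_algebra]
  by (simp add: ideal_power_Suc ring_of_type_algebra_def)

lemma ideal_power_Suc_subset:
  assumes "module.subspace (*) I" and "\<And>x y. x \<in> ideal_power \<mm> n \<Longrightarrow> y \<in> \<mm> \<Longrightarrow> x * y \<in> I"
  shows "ideal_power \<mm> (Suc n) \<subseteq> I"
proof
  fix z assume "z \<in> ideal_power \<mm> (Suc n)"
  then show "z \<in> I" unfolding ideal_power_Suc
    by (induction rule: ideal_prod.induct)
      (use assms module.subspace_add[OF module_mult assms(1)] in \<open>auto simp: ring_of_type_algebra_def\<close>)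
qed

lemma subspace_ideal_power:
  assumes "module.subspace (*) \<mm>"
  shows "module.subspace (*) (ideal_power \<mm> n)"
proof (induction n)
  case 0
  show ?case by (simp add: module.subspace_UNIV[OF module_mult])
next
  case (Suc n)
  have "ring (ring_of_type_algebra :: 'a ring)" ..
  then have "ideal (ideal_power \<mm> (Suc n)) (ring_of_type_algebra :: 'a ring)"
    unfolding ideal_power_Suc using Suc assms
    by (intro ring.ideal_prod_is_ideal) (auto simp: ideal_type_iff)
  then show ?case by (simp add: ideal_type_iff)
qed

lemma ideal_power_antimono:
  assumes "module.subspace (*) \<mm>" "n \<le> k"
  shows "ideal_power \<mm> k \<subseteq> ideal_power \<mm> n"
  using assms(2)
proof (induction rule: dec_induct)
  case (step k)
  have "ideal_power \<mm> (Suc k) \<subseteq> ideal_power \<mm> k"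
    using module.subspace_scale[OF module_mult subspace_ideal_power[OF assms(1)]]
    by (intro ideal_power_Suc_subset subspace_ideal_power assms(1)) (simp add: mult.commute)
  then show ?case using step by blast
qed simp

lemma power_in_ideal_power: "x \<in> \<mm> \<Longrightarrow> x ^ n \<in> ideal_power \<mm> n"
  by (induction n) (simp_all add: ideal_power_SucI mult.commute[of x])

section \<open>Maximal ideals, their separation, and nilpotence modulo an ideal\<close>

lemma one_in_ideal_imp_UNIV: "module.subspace (*) (I :: 'a::comm_ring_1 set) \<Longrightarrow> 1 \<in> I \<Longrightarrow> I = UNIV"
  using module.subspace_scale[OF module_mult, of I 1] by auto

text \<open>The right-hand side says that the residue ring is a field, without forming it. This is
  the shape in which the radical of an annihilator and the kernel of a character are recognised as
  maximal.\<close>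

lemma maximalideal_type_iff:
  "maximalideal \<mm> (ring_of_type_algebra :: 'a::comm_ring_1 ring) \<longleftrightarrow>
     module.subspace (*) \<mm> \<and> 1 \<notin> \<mm> \<and> (\<forall>b. b \<notin> \<mm> \<longrightarrow> (\<exists>c. b * c - 1 \<in> \<mm>))"
proof safe
  assume "maximalideal \<mm> (ring_of_type_algebra :: 'a ring)"
  then interpret maximalideal \<mm> "ring_of_type_algebra :: 'a ring" .
  interpret ring: Modules.module "(*) :: 'a \<Rightarrow> 'a \<Rightarrow> 'a" by (rule module_mult)
  note ring.scale_scale [simp del]
  show sub: "module.subspace (*) \<mm>" using is_ideal by (simp add: ideal_type_iff)
  show "1 \<in> \<mm> \<Longrightarrow> False"
    using one_in_ideal_imp_UNIV[OF sub] I_notcarr by (simp add: ring_of_type_algebra_def)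
  fix b assume b: "b \<notin> \<mm>"
  let ?K = "ring.span (insert b \<mm>)"
  have "ideal ?K ring_of_type_algebra" by (simp add: ideal_type_iff)
  moreover have "\<mm> \<subseteq> ?K" "b \<in> ?K" by (auto intro: ring.span_base)
  ultimately have "?K = UNIV"
    using I_maximal[of ?K] b by (auto simp: ring_of_type_algebra_def)
  then obtain k where "1 - k * b \<in> \<mm>"
    using ring.span_breakdown_eq[of 1 b \<mm>] ring.span_minimal[OF subset_refl sub] by auto
  then have "- (1 - k * b) \<in> \<mm>" by (rule ring.subspace_neg[OF sub])
  then show "\<exists>c. b * c - 1 \<in> \<mm>" by (intro exI[of _ k]) (simp add: mult.commute)
next
  assume sub: "module.subspace (*) \<mm>" and one: "1 \<notin> \<mm>" and inv: "\<forall>b. b \<notin> \<mm> \<longrightarrow> (\<exists>c. b * c - 1 \<in> \<mm>)"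
  interpret ring: Modules.module "(*) :: 'a \<Rightarrow> 'a \<Rightarrow> 'a" by (rule module_mult)
  note ring.scale_scale [simp del]
  show "maximalideal \<mm> (ring_of_type_algebra :: 'a ring)"
  proof (intro maximalidealI)
    fix K assume K: "ideal K (ring_of_type_algebra :: 'a ring)" "\<mm> \<subseteq> K"
    then have subK: "ring.subspace K" by (simp add: ideal_type_iff)
    have "K = UNIV" if b: "b \<in> K" "b \<notin> \<mm>" for b
    proof -
      obtain c where c: "b * c - 1 \<in> \<mm>" using inv b by blast
      have "c * b - (b * c - 1) \<in> K"
        by (rule ring.subspace_diff[OF subK ring.subspace_scale[OF subK b(1)]]) (use c K in blast)
      then show ?thesis using one_in_ideal_imp_UNIV[OF subK] by (simp add: mult.commute)
    qed
    then show "K = \<mm> \<or> K = carrier (ring_of_type_algebra :: 'a ring)"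
      using K(2) by (auto simp: ring_of_type_algebra_def)
  qed (use sub in \<open>simp add: ideal_type_iff\<close>, use one in \<open>auto simp: ring_of_type_algebra_def\<close>)
qed

lemma maximalideal_subspace:
  "maximalideal \<mm> (ring_of_type_algebra :: 'a::comm_ring_1 ring) \<Longrightarrow> module.subspace (*) \<mm>"
  by (simp add: maximalideal_type_iff)

text \<open>An element of \<nn> outside \<mm> can be scaled to an \<open>x\<close> in \<nn>
  congruent to 1 modulo \<mm>; two polynomial substitutions then raise both conditions to the
  \<open>N\<close>-th power.\<close>

lemma maximal_ideals_separate:
  fixes \<mm> :: "'a::idom set"
  assumes "maximalideal \<mm> ring_of_type_algebra" "maximalideal \<nn> ring_of_type_algebra" "\<mm> \<noteq> \<nn>"
  obtains e where "1 - e \<in> ideal_power \<mm> N" "e \<in> ideal_power \<nn> N"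
proof -
  interpret ring: Modules.module "(*) :: 'a \<Rightarrow> 'a \<Rightarrow> 'a" by (rule module_mult)
  note ring.scale_scale [simp del]
  have subm: "ring.subspace \<mm>" and subn: "ring.subspace \<nn>"
    using assms by (auto simp: maximalideal_type_iff)
  have "\<not> \<nn> \<subseteq> \<mm>"
  proof
    assume sub: "\<nn> \<subseteq> \<mm>"
    then have "\<mm> = \<nn> \<or> \<mm> = carrier (ring_of_type_algebra :: 'a ring)"
      using maximalideal.I_maximal[OF assms(2) maximalideal.axioms(1)[OF assms(1)] sub]
      by (auto simp: ring_of_type_algebra_def)
    then show False
      using assms(3) assms(1)[unfolded maximalideal_type_iff] by (auto simp: ring_of_type_algebra_def)
  qed
  then obtain b where b: "b \<in> \<nn>" "b \<notin> \<mm>" by blast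
  then obtain c where c: "b * c - 1 \<in> \<mm>" using assms(1) by (auto simp: maximalideal_type_iff)
  define x where "x = b * c"
  have x: "x \<in> \<nn>" "x - 1 \<in> \<mm>"
    using b c ring.subspace_scale[OF subn, of b c] by (auto simp: x_def mult.commute)
  have dvd: "y - z dvd y ^ N - z ^ N" for y z :: 'a
    by (metis power_diff_sumr2 dvd_triv_left)
  define y where "y = x ^ N"
  have y: "y \<in> ideal_power \<nn> N" using power_in_ideal_power[OF x(1)] by (simp add: y_def)
  have "x - 1 dvd y - 1" using dvd[of x 1] by (simp add: y_def)
  then obtain q where "y - 1 = q * (x - 1)" by (metis dvdE mult.commute)
  then have "y - 1 \<in> \<mm>" using ring.subspace_scale[OF subm x(2), of q] by simp
  then have "- (y - 1) \<in> \<mm>" by (rule ring.subspace_neg[OF subm])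
  then have y1: "1 - y \<in> \<mm>" by simp
  \<comment> \<open>By construction \<open>1 - e\<close> is an \<open>N\<close>-th power of an
    element of \<mm>, and \<open>e\<close> is a multiple of \<open>1 - (1 - y) = y\<close>.\<close>
  define e where "e = 1 - (1 - y) ^ N"
  have "1 - (1 - y) dvd 1 ^ N - (1 - y) ^ N" by (rule dvd)
  then obtain q where "e = q * y" by (auto simp: e_def dvd_def mult.commute)
  then have "e \<in> ideal_power \<nn> N" using ring.subspace_scale[OF subspace_ideal_power[OF subn] y] by simp
  moreover have "1 - e \<in> ideal_power \<mm> N" using power_in_ideal_power[OF y1] by (simp add: e_def)
  ultimately show thesis by (rule that[rotated])
qed

text \<open>The product of the pairwise separators works. This is the part of the Chinese remainder
  theorem that lets an element of \<Lambda> project onto one weight.\<close>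

lemma maximal_ideals_separate_finite:
  fixes \<mm> :: "'a::idom set"
  assumes "maximalideal \<mm> ring_of_type_algebra" and "finite J"
    and "\<And>\<nn>. \<nn> \<in> J \<Longrightarrow> maximalideal \<nn> ring_of_type_algebra" "\<mm> \<notin> J"
  obtains e where "1 - e \<in> ideal_power \<mm> N" "\<And>\<nn>. \<nn> \<in> J \<Longrightarrow> e \<in> ideal_power \<nn> N"
proof -
  interpret ring: Modules.module "(*) :: 'a \<Rightarrow> 'a \<Rightarrow> 'a" by (rule module_mult)
  note ring.scale_scale [simp del]
  have sub: "ring.subspace (ideal_power \<nn> N)" if "maximalideal \<nn> ring_of_type_algebra" for \<nn> :: "'a set"
    using that by (intro subspace_ideal_power) (simp add: maximalideal_type_iff)
  have "\<exists>e. 1 - e \<in> ideal_power \<mm> N \<and> (\<forall>\<nn>\<in>J. e \<in> ideal_power \<nn> N)"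
    using assms(2-)
  proof (induction J rule: finite_induct)
    case empty
    then show ?case using ring.subspace_0[OF sub[OF assms(1)]] by (intro exI[of _ 1]) simp
  next
    case (insert \<nn> J)
    then obtain e where e: "1 - e \<in> ideal_power \<mm> N" "\<And>\<nn>. \<nn> \<in> J \<Longrightarrow> e \<in> ideal_power \<nn> N" by auto
    have "maximalideal \<nn> ring_of_type_algebra" "\<mm> \<noteq> \<nn>" using insert by auto
    then obtain f where f: "1 - f \<in> ideal_power \<mm> N" "f \<in> ideal_power \<nn> N"
      using maximal_ideals_separate[OF assms(1)] by blast
    have "1 - e * f = (1 - e) + e * (1 - f)" by (simp add: algebra_simps)
    then have "1 - e * f \<in> ideal_power \<mm> N"
      using e(1) f(1) sub[OF assms(1)] by (metis ring.subspace_add ring.subspace_scale)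
    moreover have "e * f \<in> ideal_power \<nn> N"
      using f(2) ring.subspace_scale[OF sub[of \<nn>]] insert.prems by blast
    moreover have "e * f \<in> ideal_power \<nn>' N" if "\<nn>' \<in> J" for \<nn>'
      using ring.subspace_scale[OF sub[of \<nn>'] e(2)[OF that], of f] that insert.prems
      by (simp add: mult.commute)
    ultimately show ?case by (intro exI[of _ "e * f"]) auto
  qed
  then show thesis using that by blast
qed

text \<open>A nil ideal of a noetherian ring is nilpotent, here modulo \<open>J\<close>. Among the
  ideals containing \<open>J\<close> but no power of \<mm>, a maximal \<open>I\<close> is compared
  with the colon ideals \<open>(I : a)\<close> for \<open>a\<close> in \<mm>, which avoids
  multinomial expansions.\<close>

lemma ideal_power_subset_if_nil:
  fixes \<mm> :: "'a::idom set"
  assumes noeth: "noetherian_ring (ring_of_type_algebra :: 'a ring)"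
    and \<mm>: "module.subspace (*) \<mm>" and J: "module.subspace (*) J"
    and nil: "\<And>b. b \<in> \<mm> \<Longrightarrow> \<exists>n. b ^ n \<in> J"
  shows "\<exists>N. ideal_power \<mm> N \<subseteq> J"
proof (rule ccontr)
  assume neg: "\<nexists>N. ideal_power \<mm> N \<subseteq> J"
  interpret ring: Modules.module "(*) :: 'a \<Rightarrow> 'a \<Rightarrow> 'a" by (rule module_mult)
  note ring.scale_scale [simp del]
  define \<A> where "\<A> = {I. ring.subspace I \<and> J \<subseteq> I \<and> (\<nexists>N. ideal_power \<mm> N \<subseteq> I)}"
  have "J \<in> \<A>" using neg J by (simp add: \<A>_def)
  then have "\<A> \<noteq> {}" by blast
  moreover have "ring.subspace I" if "I \<in> \<A>" for I using that by (simp add: \<A>_def)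
  ultimately have "\<exists>I\<in>\<A>. \<forall>K\<in>\<A>. I \<subseteq> K \<longrightarrow> K = I"
    by (rule noetherian_maximal_ideal_in[OF noeth])
  then obtain I where "I \<in> \<A>" and max: "\<And>K. K \<in> \<A> \<Longrightarrow> I \<subseteq> K \<Longrightarrow> K = I"
    by blast
  then have sub: "ring.subspace I" and I: "J \<subseteq> I" "\<And>N. \<not> ideal_power \<mm> N \<subseteq> I"
    by (auto simp: \<A>_def)
  have quot: "ring.subspace {x. x * a \<in> I}" for a
  proof (rule ring.subspaceI)
    show "c * x \<in> {x. x * a \<in> I}" if "x \<in> {x. x * a \<in> I}" for c x
      using that ring.subspace_scale[OF sub, of "x * a" c] by (simp only: mem_Collect_eq mult.assoc)
    show "x + y \<in> {x. x * a \<in> I}" if "x \<in> {x. x * a \<in> I}" "y \<in> {x. x * a \<in> I}" for x y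
      using that ring.subspace_add[OF sub, of "x * a" "y * a"]
      by (simp only: mem_Collect_eq distrib_right)
    show "0 \<in> {x. x * a \<in> I}" using ring.subspace_0[OF sub] by simp
  qed
  \<comment> \<open>If \<open>(I : a)\<close> contained no power of \<mm> either, maximality would
    give \<open>(I : a) = I\<close>. Then \<open>a\<close> cancels modulo \<open>I\<close>, and
    \<open>a ^ n \<in> I\<close> descends to \<open>1 \<in> I\<close>.\<close>
  have loc: "\<exists>N. ideal_power \<mm> N \<subseteq> {x. x * a \<in> I}" if a: "a \<in> \<mm>" for a
  proof (rule ccontr)
    assume "\<nexists>N. ideal_power \<mm> N \<subseteq> {x. x * a \<in> I}"
    moreover have le: "I \<subseteq> {x. x * a \<in> I}"
      using ring.subspace_scale[OF sub, of _ a] by (auto simp: mult.commute)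
    ultimately have "{x. x * a \<in> I} \<in> \<A>" using quot I(1) unfolding \<A>_def by blast
    from max[OF this le] have eq: "x \<in> I" if "x * a \<in> I" for x using that by blast
    have "1 \<in> I" if "a ^ n \<in> I" for n using that
    proof (induction n)
      case (Suc n)
      then show ?case using eq[of "a ^ n"] by (simp add: mult.commute)
    qed simp
    moreover obtain n where "a ^ n \<in> I" using nil[OF a] I(1) by blast
    ultimately have "I = UNIV" using one_in_ideal_imp_UNIV[OF sub] by blast
    then show False using I(2) by blast
  qed
  obtain A where A: "finite A" "\<mm> = ring.span A" using noetherian_type_fg[OF noeth \<mm>] .
  have "\<forall>a\<in>A. \<exists>N. ideal_power \<mm> N \<subseteq> {x. x * a \<in> I}"
    using loc ring.span_superset A by blast
  then obtain N where N: "\<And>a. a \<in> A \<Longrightarrow> ideal_power \<mm> (N a) \<subseteq> {x. x * a \<in> I}" by metis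
  \<comment> \<open>One exponent for all generators of \<mm>; the 0 keeps \<open>Max\<close>
    meaningful when there are none.\<close>
  define n where "n = Max (insert 0 (N ` A))"
  have n: "N a \<le> n" if "a \<in> A" for a using that A by (auto simp: n_def)
  have "ideal_power \<mm> (Suc n) \<subseteq> I"
  proof (rule ideal_power_Suc_subset[OF sub])
    fix x y assume x: "x \<in> ideal_power \<mm> n" and "y \<in> \<mm>"
    from this(2)[unfolded A] show "x * y \<in> I"
    proof (induction rule: ring.span_induct_alt)
      case (step c a y)
      have "x * a \<in> I" using N[OF step(1)] ideal_power_antimono[OF \<mm> n[OF step(1)]] x by blast
      then have "c * (x * a) + x * y \<in> I"
        using step by (intro ring.subspace_add[OF sub ring.subspace_scale[OF sub]])
      then show ?case by (simp add: algebra_simps)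
    qed (simp add: ring.subspace_0[OF sub])
  qed
  then show False using I(2) by blast
qed

section \<open>Distributions\<close>

definition translate :: "('a::times \<Rightarrow> 'b) \<Rightarrow> 'a \<Rightarrow> 'a \<Rightarrow> 'b" where
  "translate \<xi> a = (\<lambda>b. \<xi> (a * b))"

lemma translate_apply: "translate \<xi> a b = \<xi> (a * b)"
  by (simp add: translate_def)

lemma translate_translate: "translate (translate \<xi> a) b = translate \<xi> (a * b)"
  for \<xi> :: "'a::semigroup_mult \<Rightarrow> 'b"
  by (simp add: translate_def mult.assoc)

lemma translate_1 [simp]: "translate \<xi> 1 = \<xi>" for \<xi> :: "'a::monoid_mult \<Rightarrow> 'b"
  by (simp add: translate_def)

lemma translate_eq_0D: "translate \<xi> a = 0 \<Longrightarrow> \<xi> a = 0"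
  for \<xi> :: "'a::monoid_mult \<Rightarrow> 'b::zero"
  by (drule fun_cong[of _ _ 1]) (simp add: translate_def)

lemma dual_space_iff:
  assumes "vector_space s"
  shows "\<xi> \<in> dual_space s \<longleftrightarrow> (\<forall>a b. \<xi> (a + b) = \<xi> a + \<xi> b) \<and> (\<forall>c a. \<xi> (s c a) = c * \<xi> a)"
proof -
  have "vector_space ((*) :: 'a \<Rightarrow> 'a \<Rightarrow> 'a)"
    by unfold_locales (auto simp: algebra_simps)
  then show ?thesis using assms
    by (auto simp: dual_space_def Vector_Spaces.linear_def module_hom_def module_hom_axioms_def
        vector_space_def Modules.module_def)
qed

locale noetherian_algebra = k_algebra s
  for s :: "'k::field \<Rightarrow> 'a::idom \<Rightarrow> 'a" +
  assumes noetherian: "noetherian_ring (ring_of_type_algebra :: 'a ring)"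
begin

sublocale ring: Modules.module "(*) :: 'a \<Rightarrow> 'a \<Rightarrow> 'a"
  by (rule module_mult)

declare ring.scale_scale [simp del]

sublocale func: vector_space "\<lambda>(c::'k) (f::'a \<Rightarrow> 'k) a. c * f a"
  by unfold_locales (auto simp: algebra_simps fun_eq_iff)

lemma dual_iff:
  "\<xi> \<in> dual_space s \<longleftrightarrow> (\<forall>a b. \<xi> (a + b) = \<xi> a + \<xi> b) \<and> (\<forall>c a. \<xi> (s c a) = c * \<xi> a)"
  by (rule dual_space_iff) unfold_locales

lemma dual_0: "0 \<in> dual_space s"
  and dual_add: "\<xi> \<in> dual_space s \<Longrightarrow> \<eta> \<in> dual_space s \<Longrightarrow> \<xi> + \<eta> \<in> dual_space s"
  and dual_translate: "\<xi> \<in> dual_space s \<Longrightarrow> translate \<xi> a \<in> dual_space s"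
  by (auto simp: dual_iff translate_def algebra_simps scale_mult_right[symmetric])

lemma dual_zero_eq: "\<xi> \<in> dual_space s \<Longrightarrow> \<xi> 0 = 0"
  using dual_iff[of \<xi>] by (metis add_cancel_right_right)

lemma dual_diff: "\<xi> \<in> dual_space s \<Longrightarrow> \<xi> (a - b) = \<xi> a - \<xi> b"
  using dual_iff[of \<xi>] by (metis add_diff_cancel diff_add_cancel)

lemma translate_add:
  "\<xi> \<in> dual_space s \<Longrightarrow> translate \<xi> (a + b) = translate \<xi> a + translate \<xi> b"
  by (simp add: dual_iff translate_def fun_eq_iff distrib_right)

lemma translate_diff:
  "\<xi> \<in> dual_space s \<Longrightarrow> translate \<xi> (a - b) = translate \<xi> a - translate \<xi> b"
  by (simp add: dual_diff translate_def fun_eq_iff left_diff_distrib)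

lemma translate_0: "\<xi> \<in> dual_space s \<Longrightarrow> translate \<xi> 0 = 0"
  by (simp add: dual_zero_eq translate_def fun_eq_iff)

lemma translate_scale:
  "\<xi> \<in> dual_space s \<Longrightarrow> translate \<xi> (s c a) = (\<lambda>b. c * translate \<xi> a b)"
  by (simp add: dual_iff translate_def fun_eq_iff scale_mult_left[symmetric])

text \<open>\<open>E\<close> may consist of arbitrary functions, not only translates or linear
  functionals; spanning sets can thus be enlarged and united freely.\<close>

definition finite_translates :: "('a \<Rightarrow> 'k) \<Rightarrow> bool" where
  "finite_translates \<xi> \<longleftrightarrow> (\<exists>E. finite E \<and> range (translate \<xi>) \<subseteq> func.span E)"

lemma finite_translates_0: "finite_translates 0"
  unfolding finite_translates_def
  by (intro exI[of _ "{}"]) (auto simp: translate_def fun_eq_iff)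

lemma finite_translates_translate: "finite_translates \<xi> \<Longrightarrow> finite_translates (translate \<xi> a)"
  unfolding finite_translates_def translate_translate by blast

lemma finite_translates_add:
  assumes "finite_translates \<xi>" "finite_translates \<eta>"
  shows "finite_translates (\<xi> + \<eta>)"
proof -
  obtain E E' where E: "finite E" "range (translate \<xi>) \<subseteq> func.span E"
      "finite E'" "range (translate \<eta>) \<subseteq> func.span E'"
    using assms by (auto simp: finite_translates_def)
  have "translate (\<xi> + \<eta>) a \<in> func.span (E \<union> E')" for a
  proof -
    have "translate (\<xi> + \<eta>) a = translate \<xi> a + translate \<eta> a" by (simp add: translate_def fun_eq_iff)
    moreover have "\<dots> \<in> func.span (E \<union> E')"
      using E func.span_mono[of E "E \<union> E'"] func.span_mono[of E' "E \<union> E'"]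
      by (intro func.span_add) auto
    ultimately show ?thesis by (simp only:)
  qed
  then show ?thesis using E unfolding finite_translates_def by (intro exI[of _ "E \<union> E'"]) auto
qed

section \<open>Distributions and their translates\<close>

lemma dist_at_add:
  assumes "\<xi> \<in> dist_at s \<mm>" "\<eta> \<in> dist_at s \<mm>"
  shows "\<xi> + \<eta> \<in> dist_at s \<mm>"
proof -
  obtain n n' where n: "\<And>k a. n \<le> k \<Longrightarrow> a \<in> ideal_power \<mm> k \<Longrightarrow> \<xi> a = 0"
    "\<And>k a. n' \<le> k \<Longrightarrow> a \<in> ideal_power \<mm> k \<Longrightarrow> \<eta> a = 0"
    using assms unfolding dist_at_def by blast
  then show ?thesis using assms dual_add[of \<xi> \<eta>] unfolding dist_at_def
    by (auto intro!: exI[of _ "max n n'"])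
qed

lemma distributions_iff:
  "\<xi> \<in> distributions s \<longleftrightarrow> (\<exists>J u. finite J \<and> J \<subseteq> cofinite_maximal_ideals s \<and>
     (\<forall>\<mm>\<in>J. u \<mm> \<in> dist_at s \<mm>) \<and> \<xi> = (\<Sum>\<mm>\<in>J. u \<mm>))"
proof -
  have "(\<lambda>a. \<Sum>\<mm>\<in>J. u \<mm> a) = (\<Sum>\<mm>\<in>J. u \<mm>)" for J and u :: "'a set \<Rightarrow> 'a \<Rightarrow> 'k"
    by (induction J rule: infinite_finite_induct) (auto simp: fun_eq_iff)
  then show ?thesis unfolding distributions_def by auto
qed

lemma dist_at_subset_distributions:
  "\<mm> \<in> cofinite_maximal_ideals s \<Longrightarrow> \<xi> \<in> dist_at s \<mm> \<Longrightarrow> \<xi> \<in> distributions s"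
  unfolding distributions_iff by (intro exI[of _ "{\<mm>}"] exI[of _ "\<lambda>_. \<xi>"]) simp

lemma distributions_0: "0 \<in> distributions s"
  unfolding distributions_iff by (intro exI[of _ "{}"]) simp

lemma distributions_add:
  assumes "\<xi> \<in> distributions s" "\<eta> \<in> distributions s"
  shows "\<xi> + \<eta> \<in> distributions s"
proof -
  obtain J u where J: "finite J" "J \<subseteq> cofinite_maximal_ideals s" "\<forall>\<mm>\<in>J. u \<mm> \<in> dist_at s \<mm>"
      "\<xi> = (\<Sum>\<mm>\<in>J. u \<mm>)"
    using assms(1) by (auto simp: distributions_iff)
  obtain J' u' where J': "finite J'" "J' \<subseteq> cofinite_maximal_ideals s" "\<forall>\<mm>\<in>J'. u' \<mm> \<in> dist_at s \<mm>"
      "\<eta> = (\<Sum>\<mm>\<in>J'. u' \<mm>)"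
    using assms(2) by (auto simp: distributions_iff)
  define v where "v = (\<lambda>\<mm>. (if \<mm> \<in> J then u \<mm> else 0) + (if \<mm> \<in> J' then u' \<mm> else 0))"
  have "(\<Sum>\<mm>\<in>J \<union> J'. v \<mm>) = \<xi> + \<eta>"
    using J(1) J'(1) by (simp add: v_def sum.distrib J(4) J'(4) sum.If_cases Int_absorb1)
  moreover have "\<forall>\<mm>\<in>J \<union> J'. v \<mm> \<in> dist_at s \<mm>"
    using J(3) J'(3) by (auto simp: v_def intro: dist_at_add)
  ultimately show ?thesis
    unfolding distributions_iff using J J' by (intro exI[of _ "J \<union> J'"] exI[of _ v]) auto
qed

lemma distributions_subset_dual: "distributions s \<subseteq> dual_space s"
proof
  fix \<xi> assume "\<xi> \<in> distributions s"
  then obtain J u where J: "finite J" "J \<subseteq> cofinite_maximal_ideals s" "\<forall>\<mm>\<in>J. u \<mm> \<in> dist_at s \<mm>"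
      "\<xi> = (\<Sum>\<mm>\<in>J. u \<mm>)"
    by (auto simp: distributions_iff)
  from J(1,3) show "\<xi> \<in> dual_space s" unfolding J(4)
    by (induction J rule: finite_induct) (simp_all add: dual_0 dual_add dist_at_def)
qed

lemma cofinite_maximal_subspace: "\<mm> \<in> cofinite_maximal_ideals s \<Longrightarrow> ring.subspace \<mm>"
  by (simp add: cofinite_maximal_ideals_def maximalideal_type_iff)

lemma translate_in_span:
  assumes "\<xi> \<in> dual_space s" "b \<in> span B"
  shows "translate \<xi> b \<in> func.span (translate \<xi> ` B)"
  using assms(2)
proof (induction rule: span_induct_alt)
  case base
  show ?case unfolding translate_0[OF assms(1)] by (rule func.span_zero)
next
  case (step c b y)
  then show ?case unfolding translate_add[OF assms(1)] translate_scale[OF assms(1)]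
    by (intro func.span_add func.span_scale) (auto intro: func.span_base)
qed

text \<open>\<Lambda> is a finite-dimensional space plus \<mm>, and \<mm> is finitely generated. So
  the translates of \<xi> are spanned by finitely many of them together with all translates of
  \<open>a\<xi>\<close> for generators \<open>a\<close> of \<mm>, and \<open>a\<xi>\<close> vanishes
  on one power of \<mm> fewer.\<close>

lemma dist_at_finite_translates:
  assumes \<mm>: "\<mm> \<in> cofinite_maximal_ideals s" and "\<xi> \<in> dist_at s \<mm>"
  shows "finite_translates \<xi>"
proof -
  have sub: "ring.subspace \<mm>" using cofinite_maximal_subspace[OF \<mm>] .
  obtain A where A: "finite A" "\<mm> = ring.span A" using noetherian_type_fg[OF noetherian sub] .
  obtain B where B: "finite B" "\<And>a. \<exists>b\<in>span B. a - b \<in> \<mm>"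
    using \<mm> by (auto simp: cofinite_maximal_ideals_def)
  \<comment> \<open>Stated for every functional vanishing on \<open>ideal_power \<mm> n\<close>,
    because the induction passes to translates. At exponent 0 the ideal power is all of \<Lambda>,
    so \<xi> is zero.\<close>
  have "finite_translates \<xi>" if "\<xi> \<in> dual_space s" "\<forall>a\<in>ideal_power \<mm> n. \<xi> a = 0" for n \<xi>
    using that
  proof (induction n arbitrary: \<xi>)
    case 0
    then have "\<xi> = 0" by (simp add: fun_eq_iff)
    then show ?case using finite_translates_0 by blast
  next
    case (Suc n)
    have "finite_translates (translate \<xi> a)" if "a \<in> A" for a
    proof (rule Suc.IH[OF dual_translate[OF Suc.prems(1)]])
      have "a \<in> \<mm>" using that A(2) ring.span_base by blast
      then show "\<forall>b\<in>ideal_power \<mm> n. translate \<xi> a b = 0"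
        using ideal_power_SucI[of _ \<mm> n a] Suc.prems(2)
        by (auto simp: translate_apply mult.commute)
    qed
    then have "\<forall>a\<in>A. \<exists>E. finite E \<and> range (translate (translate \<xi> a)) \<subseteq> func.span E"
      by (simp add: finite_translates_def)
    then obtain E where E: "\<And>a. a \<in> A \<Longrightarrow> finite (E a)"
        "\<And>a. a \<in> A \<Longrightarrow> range (translate (translate \<xi> a)) \<subseteq> func.span (E a)"
      by metis
    have 1: "translate \<xi> z \<in> func.span (\<Union>(E ` A))" if "z \<in> ring.span A" for z
      using that
    proof (induction rule: ring.span_induct_alt)
      case base
      show ?case unfolding translate_0[OF Suc.prems(1)] by (rule func.span_zero)
    next
      case (step c a y)
      have "translate \<xi> (c * a) = translate (translate \<xi> a) c"
        by (simp add: translate_translate mult.commute)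
      also have "\<dots> \<in> func.span (E a)" using E(2)[OF step(1)] by blast
      also have "\<dots> \<subseteq> func.span (\<Union>(E ` A))" using step(1) by (intro func.span_mono) auto
      finally show ?case using step unfolding translate_add[OF Suc.prems(1)]
        by (intro func.span_add) auto
    qed
    let ?E = "translate \<xi> ` B \<union> \<Union>(E ` A)"
    have "translate \<xi> a \<in> func.span ?E" for a
    proof -
      obtain b where b: "b \<in> span B" "a - b \<in> \<mm>" using B(2) by blast
      have "translate \<xi> (b + (a - b)) \<in> func.span ?E"
        unfolding translate_add[OF Suc.prems(1)]
        using translate_in_span[OF Suc.prems(1) b(1)] 1[of "a - b"] b(2) A(2)
          func.span_mono[of "translate \<xi> ` B" ?E] func.span_mono[of "\<Union>(E ` A)" ?E]
        by (intro func.span_add) auto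
      then show ?thesis by simp
    qed
    moreover have "finite ?E" using A B E by auto
    ultimately show ?case unfolding finite_translates_def by blast
  qed
  then show ?thesis using assms(2) unfolding dist_at_def by blast
qed

lemma distributions_finite_translates:
  assumes "\<xi> \<in> distributions s"
  shows "finite_translates \<xi>"
proof -
  obtain J u where J: "finite J" "J \<subseteq> cofinite_maximal_ideals s" "\<forall>\<mm>\<in>J. u \<mm> \<in> dist_at s \<mm>"
      "\<xi> = (\<Sum>\<mm>\<in>J. u \<mm>)"
    using assms by (auto simp: distributions_iff)
  from J(1-3) show ?thesis unfolding J(4)
    by (induction J rule: finite_induct)
      (auto intro: finite_translates_0 finite_translates_add dist_at_finite_translates)
qed

text \<open>For linear \<xi> this is the largest ideal contained in the kernel of \<xi>, and
  \<Lambda> modulo it is isomorphic to the space of translates.\<close>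

definition annihilator :: "('a \<Rightarrow> 'k) \<Rightarrow> 'a set" where
  "annihilator \<xi> = {a. translate \<xi> a = 0}"

lemma annihilator_subspace: "\<xi> \<in> dual_space s \<Longrightarrow> ring.subspace (annihilator \<xi>)"
  unfolding annihilator_def
proof (rule ring.subspaceI)
  show "c * x \<in> {a. translate \<xi> a = 0}" if "x \<in> {a. translate \<xi> a = 0}" for c x
    using that translate_translate[of \<xi> x c]
    by (simp add: mult.commute) (simp add: translate_def fun_eq_iff)
qed (simp_all add: translate_add translate_0)

lemma annihilator_translate: "a \<in> annihilator (translate \<xi> b) \<longleftrightarrow> b * a \<in> annihilator \<xi>"
  by (simp add: annihilator_def translate_translate)

text \<open>The map \<open>a \<mapsto> a\<xi>\<close> embeds \<Lambda> modulo the annihilator into a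
  finite-dimensional space; preimages of a basis of its image span the quotient.\<close>

lemma annihilator_cofinite:
  assumes "\<xi> \<in> dual_space s" "finite_translates \<xi>"
  shows "\<exists>B. finite B \<and> (\<forall>a. \<exists>b\<in>span B. a - b \<in> annihilator \<xi>)"
proof -
  obtain E where E: "finite E" "range (translate \<xi>) \<subseteq> func.span E"
    using assms(2) by (auto simp: finite_translates_def)
  \<comment> \<open>The basis is chosen among the translates themselves, since the members of
    \<open>E\<close> need not have preimages.\<close>
  obtain C where C: "C \<subseteq> range (translate \<xi>)" "func.independent C" "range (translate \<xi>) \<subseteq> func.span C"
    using func.maximal_independent_subset[of "range (translate \<xi>)"] by blast
  have "finite C" using func.independent_span_bound[OF E(1) C(2)] C(1) E(2) by blast
  then obtain B where B: "finite B" "C = translate \<xi> ` B"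
    using C(1) by (meson finite_subset_image)
  have lift: "\<exists>b\<in>span B. f = translate \<xi> b" if "f \<in> func.span (translate \<xi> ` B)" for f
    using that
  proof (induction rule: func.span_induct_alt)
    case base
    show ?case using translate_0[OF assms(1)] span_zero by metis
  next
    case (step c x y)
    then obtain b b' where b: "b \<in> B" "x = translate \<xi> b" "b' \<in> span B" "y = translate \<xi> b'" by auto
    have eq: "(\<lambda>a. c * x a) + y = translate \<xi> (s c b + b')"
      by (simp add: translate_add[OF assms(1)] translate_scale[OF assms(1)] b)
    show ?case unfolding eq
      using b by (intro bexI[of _ "s c b + b'"] span_add span_scale) (auto intro: span_base)
  qed
  have "\<exists>b\<in>span B. a - b \<in> annihilator \<xi>" for a
  proof -
    have "translate \<xi> a \<in> func.span (translate \<xi> ` B)" using C(3) B by auto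
    then obtain b where "b \<in> span B" "translate \<xi> a = translate \<xi> b" using lift by blast
    then show ?thesis by (intro bexI[of _ b]) (simp_all add: annihilator_def translate_diff[OF assms(1)])
  qed
  then show ?thesis using B(1) by blast
qed

text \<open>The spaces \<open>V n\<close> of translates of \<xi> by multiples of
  \<open>b ^ n\<close> decrease inside a finite-dimensional space, so they cannot shrink forever.
  Where they stop shrinking, \<open>b ^ n\<close> is a multiple of \<open>b ^ Suc n\<close> modulo
  the annihilator.\<close>

lemma power_stabilizes:
  assumes "\<xi> \<in> dual_space s" "finite_translates \<xi>"
  shows "\<exists>n d. b ^ n - b ^ Suc n * d \<in> annihilator \<xi>"
proof (rule ccontr)
  assume neg: "\<nexists>n d. b ^ n - b ^ Suc n * d \<in> annihilator \<xi>"
  obtain E where E: "finite E" "range (translate \<xi>) \<subseteq> func.span E"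
    using assms(2) by (auto simp: finite_translates_def)
  define V where "V n = range (\<lambda>d. translate \<xi> (b ^ n * d))" for n
  have V: "func.subspace (V n)" for n
  proof (rule func.subspaceI)
    show "0 \<in> V n" using translate_0[OF assms(1)] by (auto simp: V_def intro!: image_eqI[of _ _ 0])
  next
    fix x y assume "x \<in> V n" "y \<in> V n"
    then obtain d d' where "x = translate \<xi> (b ^ n * d)" "y = translate \<xi> (b ^ n * d')" by (auto simp: V_def)
    then have "x + y = translate \<xi> (b ^ n * (d + d'))"
      by (simp add: distrib_left translate_add[OF assms(1)])
    then show "x + y \<in> V n" by (auto simp: V_def)
  next
    fix c x assume "x \<in> V n"
    then obtain d where "x = translate \<xi> (b ^ n * d)" by (auto simp: V_def)
    then have "(\<lambda>a. c * x a) = translate \<xi> (b ^ n * s c d)"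
      using translate_scale[OF assms(1), of c "b ^ n * d"] by (simp add: scale_mult_right)
    then show "(\<lambda>a. c * x a) \<in> V n" by (auto simp: V_def)
  qed
  have inV: "translate \<xi> (b ^ i) \<in> V n" if "n \<le> i" for i n
    using that by (auto simp: V_def le_iff_add power_add)
  have notin: "translate \<xi> (b ^ n) \<notin> V (Suc n)" for n
    using neg translate_diff[OF assms(1)] by (auto simp: V_def annihilator_def)
  \<comment> \<open>Vectors are added at the low end: all later ones lie in
    \<open>V (Suc k)\<close>, which misses the translate by \<open>b ^ k\<close>. Hence the starting
    index \<open>k\<close> must vary in the induction.\<close>
  have "func.independent ((\<lambda>i. translate \<xi> (b ^ i)) ` {k..<k + n}) \<and>
      card ((\<lambda>i. translate \<xi> (b ^ i)) ` {k..<k + n}) = n" for n k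
  proof (induction n arbitrary: k)
    case 0
    show ?case using func.independent_empty by simp
  next
    case (Suc n)
    let ?B = "(\<lambda>i. translate \<xi> (b ^ i)) ` {Suc k..<Suc k + n}"
    have "?B \<subseteq> V (Suc k)" using inV by auto
    then have "func.span ?B \<subseteq> V (Suc k)" by (rule func.span_minimal[OF _ V])
    then have "translate \<xi> (b ^ k) \<notin> func.span ?B" using notin by blast
    moreover have "{k..<k + Suc n} = insert k {Suc k..<Suc k + n}" by auto
    ultimately show ?case using Suc.IH[of "Suc k"] func.span_base[of _ ?B]
      by (auto simp: func.independent_insert card_insert_if)
  qed
  from this[of 0 "Suc (card E)"] show False
    using func.independent_span_bound[OF E(1), of "(\<lambda>i. translate \<xi> (b ^ i)) ` {0..<0 + Suc (card E)}"] E(2)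
    by auto
qed

text \<open>
  Otherwise pick a counterexample \<open>\<xi>\<close> with maximal annihilator \<open>J\<close>. Every element of \<open>\<Lambda>\<close> is
  nilpotent or invertible modulo \<open>J\<close>, as an idempotent \<open>e\<close> modulo \<open>J\<close> splits
  \<open>\<xi>\<close> into the two distributions \<open>e\<xi>\<close> and \<open>(1 - e)\<xi>\<close>; hence \<open>J\<close> contains a power of its radical,
  which is maximal.
\<close>

theorem finite_translates_distribution:
  assumes "\<xi> \<in> dual_space s" "finite_translates \<xi>"
  shows "\<xi> \<in> distributions s"
proof (rule ccontr)
  assume "\<xi> \<notin> distributions s"
  define bad where
    "bad = {\<eta>. \<eta> \<in> dual_space s \<and> finite_translates \<eta> \<and> \<eta> \<notin> distributions s}"
  have "\<xi> \<in> bad" using assms \<open>\<xi> \<notin> distributions s\<close> by (simp add: bad_def)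
  then have "annihilator ` bad \<noteq> {}" by blast
  moreover have "ring.subspace I" if "I \<in> annihilator ` bad" for I
    using that annihilator_subspace by (auto simp: bad_def)
  ultimately have "\<exists>I\<in>annihilator ` bad. \<forall>K\<in>annihilator ` bad. I \<subseteq> K \<longrightarrow> K = I"
    by (rule noetherian_maximal_ideal_in[OF noetherian])
  then obtain I where I: "I \<in> annihilator ` bad"
    and max: "\<And>K. K \<in> annihilator ` bad \<Longrightarrow> I \<subseteq> K \<Longrightarrow> K = I"
    by blast
  from I obtain \<eta> where \<eta>: "\<eta> \<in> dual_space s" "finite_translates \<eta>" "\<eta> \<notin> distributions s"
    and I_def: "I = annihilator \<eta>" by (auto simp: bad_def)
  have sub: "ring.subspace I" unfolding I_def by (rule annihilator_subspace[OF \<eta>(1)])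
  \<comment> \<open>The annihilator of the translate by \<open>e\<close> is the colon ideal
    \<open>(I : e)\<close>. It contains \<open>I\<close> and also \<open>f\<close>, so maximality of
    \<open>I\<close> rules out a counterexample.\<close>
  have split: "translate \<eta> e \<in> distributions s" if e: "e * f \<in> I" "f \<notin> I" for e f
  proof (rule ccontr)
    assume "translate \<eta> e \<notin> distributions s"
    then have "translate \<eta> e \<in> bad"
      using \<eta> dual_translate finite_translates_translate by (simp add: bad_def)
    moreover have "I \<subseteq> annihilator (translate \<eta> e)"
      using ring.subspace_scale[OF sub] by (auto simp: annihilator_translate I_def[symmetric])
    ultimately have "annihilator (translate \<eta> e) = I" using max by blast
    then show False using e annihilator_translate[of f \<eta> e] I_def by blast
  qed
  have local: "(\<exists>n. b ^ n \<in> I) \<or> (\<exists>c. b * c - 1 \<in> I)" for b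
  proof -
    obtain m d where "b ^ m - b ^ Suc m * d \<in> I" using power_stabilizes[OF \<eta>(1,2)] I_def by blast
    \<comment> \<open>Multiplying by \<open>b\<close> makes the exponent positive, so that a factor
      \<open>b\<close> can be split off \<open>e\<close> below.\<close>
    from ring.subspace_scale[OF sub this, of b] obtain n where
      n: "b ^ n - b ^ Suc n * d \<in> I" "n = Suc m" by (auto simp: algebra_simps)
    have step: "b ^ n - b ^ (n + k) * d ^ k \<in> I" for k
    proof (induction k)
      case 0
      show ?case using ring.subspace_0[OF sub] by simp
    next
      case (Suc k)
      have "b ^ n - b ^ (n + Suc k) * d ^ Suc k =
          (b ^ n - b ^ (n + k) * d ^ k) + b ^ k * d ^ k * (b ^ n - b ^ Suc n * d)"
        by (simp add: algebra_simps power_add)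
      moreover have "\<dots> \<in> I"
        by (rule ring.subspace_add[OF sub Suc ring.subspace_scale[OF sub n(1)]])
      ultimately show ?case by (simp only:)
    qed
    \<comment> \<open>Modulo \<open>I\<close> this is an idempotent: 0 if \<open>b\<close> is
      nilpotent, 1 if \<open>b\<close> is invertible, and otherwise one that splits \<eta>.\<close>
    define e where "e = b ^ n * d ^ n"
    have e1: "b ^ n - b ^ n * e \<in> I" using step[of n] by (simp add: e_def power_add mult.assoc)
    from ring.subspace_scale[OF sub this, of "d ^ n"] have e2: "e * (1 - e) \<in> I"
      by (simp add: e_def algebra_simps)
    consider "e \<in> I" | "1 - e \<in> I" | "e \<notin> I" "1 - e \<notin> I" by blast
    then show ?thesis
    proof cases
      case 1
      have "(b ^ n - b ^ n * e) + b ^ n * e \<in> I"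
        by (rule ring.subspace_add[OF sub e1 ring.subspace_scale[OF sub 1]])
      then show ?thesis by auto
    next
      case 2
      then have "- (1 - e) \<in> I" by (rule ring.subspace_neg[OF sub])
      then have "b * (b ^ m * d ^ n) - 1 \<in> I" by (simp add: e_def n(2) mult.assoc)
      then show ?thesis by blast
    next
      case 3
      have "translate \<eta> e + translate \<eta> (1 - e) \<in> distributions s"
        using 3 e2 by (intro distributions_add split[of e "1 - e"] split[of "1 - e" e]) (simp_all add: mult.commute)
      then show ?thesis using \<eta>(3) translate_add[OF \<eta>(1), of e "1 - e", symmetric] by simp
    qed
  qed
  define \<mm> where "\<mm> = {b. \<exists>n. b ^ n \<in> I}"
  have I\<mm>: "I \<subseteq> \<mm>" by (auto simp: \<mm>_def intro: exI[of _ 1])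
  have mono: "a ^ k \<in> I" if "a ^ n \<in> I" "n \<le> k" for a k n
    using that ring.subspace_scale[OF sub that(1), of "a ^ (k - n)"] by (simp add: power_add[symmetric])
  have "1 \<notin> \<mm>"
  proof
    assume "1 \<in> \<mm>"
    then have "\<eta> = 0" by (auto simp: \<mm>_def I_def annihilator_def)
    then show False using \<eta>(3) distributions_0 by simp
  qed
  moreover have sub\<mm>: "ring.subspace \<mm>"
  proof (rule ring.subspaceI)
    show "0 \<in> \<mm>" using I\<mm> ring.subspace_0[OF sub] by blast
  next
    fix x y assume "x \<in> \<mm>" "y \<in> \<mm>"
    then obtain p q where pq: "x ^ p \<in> I" "y ^ q \<in> I" by (auto simp: \<mm>_def)
    \<comment> \<open>In each binomial term either the exponent of \<open>x\<close> is at least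
      \<open>p\<close> or that of \<open>y\<close> is at least \<open>q\<close>.\<close>
    have "of_nat (p + q choose k) * x ^ k * y ^ (p + q - k) \<in> I" for k
    proof (cases "p \<le> k")
      case True
      show ?thesis
        using ring.subspace_scale[OF sub mono[OF pq(1) True], of "of_nat (p + q choose k) * y ^ (p + q - k)"]
        by (simp add: mult_ac)
    next
      case False
      then have "q \<le> p + q - k" by simp
      then show ?thesis
        using ring.subspace_scale[OF sub mono[OF pq(2)], of _ "of_nat (p + q choose k) * x ^ k"] by blast
    qed
    then have "(x + y) ^ (p + q) \<in> I" unfolding binomial_ring by (intro ring.subspace_sum sub)
    then show "x + y \<in> \<mm>" by (auto simp: \<mm>_def)
  next
    fix c x assume "x \<in> \<mm>"
    then obtain p where "x ^ p \<in> I" by (auto simp: \<mm>_def)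
    then have "(c * x) ^ p \<in> I" using ring.subspace_scale[OF sub] by (simp add: power_mult_distrib)
    then show "c * x \<in> \<mm>" by (auto simp: \<mm>_def)
  qed
  moreover have "\<exists>c. b * c - 1 \<in> \<mm>" if "b \<notin> \<mm>" for b
    using local[of b] that I\<mm> unfolding \<mm>_def by blast
  ultimately have "maximalideal \<mm> ring_of_type_algebra" by (simp add: maximalideal_type_iff)
  moreover obtain B where "finite B" "\<forall>a. \<exists>b\<in>span B. a - b \<in> I"
    using annihilator_cofinite[OF \<eta>(1,2)] unfolding I_def by blast
  then have "\<exists>B. finite B \<and> (\<forall>a. \<exists>b\<in>span B. a - b \<in> \<mm>)"
    using I\<mm> by (intro exI[of _ B]) blast
  ultimately have cof: "\<mm> \<in> cofinite_maximal_ideals s"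
    unfolding cofinite_maximal_ideals_def mem_Collect_eq by (rule conjI)
  have "\<exists>n. b ^ n \<in> I" if "b \<in> \<mm>" for b using that by (simp add: \<mm>_def)
  then obtain N where N: "ideal_power \<mm> N \<subseteq> I"
    using ideal_power_subset_if_nil[OF noetherian sub\<mm> sub] by blast
  have "\<eta> a = 0" if "N \<le> n" "a \<in> ideal_power \<mm> n" for a n
  proof -
    have "a \<in> I" using that(2) N ideal_power_antimono[OF sub\<mm> that(1)] by blast
    then have "translate \<eta> a = 0" by (simp only: I_def annihilator_def mem_Collect_eq)
    then show ?thesis by (rule translate_eq_0D)
  qed
  then have "\<eta> \<in> dist_at s \<mm>" using \<eta>(1) by (auto simp: dist_at_def)
  then show False using \<eta>(3) dist_at_subset_distributions[OF cof] by blast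
qed

text \<open>The socle of the distributions supported at a rational point is one-dimensional.\<close>

lemma translate_eq_character:
  assumes \<chi>: "algebra_hom s (*) \<chi>" and \<mm>: "\<mm> = {a. \<chi> a = 0}"
    and \<eta>: "\<eta> \<in> dist_at s \<mm>" "\<eta> \<noteq> 0"
  obtains a where "translate \<eta> a = \<chi>"
proof -
  have \<chi>': "\<chi> \<in> dual_space s" "\<chi> 1 = 1" "\<And>a b. \<chi> (a * b) = \<chi> a * \<chi> b"
    using \<chi> by (auto simp: algebra_hom_def dual_space_def)
  have dual: "\<eta> \<in> dual_space s" using \<eta>(1) by (simp add: dist_at_def)
  let ?P = "\<lambda>n. \<forall>a\<in>ideal_power \<mm> n. translate \<eta> a = 0"
  have subm: "ring.subspace \<mm>" unfolding \<mm>
    using \<chi>' dual_zero_eq[OF \<chi>'(1)] by (intro ring.subspaceI) (auto simp: dual_iff)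
  obtain n0 where n0: "\<forall>a\<in>ideal_power \<mm> n0. \<eta> a = 0" using \<eta>(1) unfolding dist_at_def by blast
  have "?P n0"
  proof
    fix a assume a: "a \<in> ideal_power \<mm> n0"
    have "\<eta> (a * b) = 0" for b
      using n0 ring.subspace_scale[OF subspace_ideal_power[OF subm] a, of b] by (simp add: mult.commute)
    then show "translate \<eta> a = 0" by (simp add: translate_def fun_eq_iff)
  qed
  \<comment> \<open>With \<open>n\<close> least such that \<open>ideal_power \<mm> n\<close> kills
    \<eta>, some \<open>b\<close> one power lower does not; then \<zeta>, the translate of \<eta> by
    \<open>b\<close>, is nonzero and killed by \<mm>.\<close>
  then obtain n where n: "?P n" and least: "\<And>k. k < n \<Longrightarrow> \<not> ?P k"
    using exists_least_iff[of ?P] by blast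
  have "n \<noteq> 0"
  proof
    assume "n = 0"
    then have "translate \<eta> 1 = 0" using n by (simp only: ideal_power_0 ball_UNIV)
    then show False using \<eta>(2) by simp
  qed
  then obtain k where k: "n = Suc k" using not0_implies_Suc by blast
  then have "\<not> ?P k" using least by simp
  then obtain b where b: "b \<in> ideal_power \<mm> k" "translate \<eta> b \<noteq> 0" by blast
  define \<zeta> where "\<zeta> = translate \<eta> b"
  have \<zeta>: "\<zeta> \<in> dual_space s" unfolding \<zeta>_def by (rule dual_translate[OF dual])
  have "\<zeta> y = 0" if "y \<in> \<mm>" for y
  proof -
    have "translate \<eta> (b * y) = 0" using n k ideal_power_SucI[OF b(1) that] by simp
    then have "\<eta> (b * y) = 0" by (rule translate_eq_0D)
    then show ?thesis by (simp add: \<zeta>_def translate_def)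
  qed
  \<comment> \<open>\<Lambda> is the sum of the scalars and \<mm>, so a functional vanishing on
    \<mm> is determined by its value at 1. This is where rationality of the point enters.\<close>
  moreover have "a - s (\<chi> a) 1 \<in> \<mm>" for a
    using \<chi>' by (simp add: \<mm> dual_diff[OF \<chi>'(1)] dual_iff)
  ultimately have "\<zeta> (a - s (\<chi> a) 1) = 0" for a by blast
  moreover have "\<zeta> (a - s (\<chi> a) 1) = \<zeta> a - \<chi> a * \<zeta> 1" for a
    using \<zeta> dual_iff[of \<zeta>] dual_diff[OF \<zeta>] by metis
  ultimately have eq: "\<zeta> a = \<chi> a * \<zeta> 1" for a by (metis eq_iff_diff_eq_0)
  have \<zeta>1: "\<zeta> 1 \<noteq> 0"
  proof
    assume "\<zeta> 1 = 0"
    then have "\<zeta> a = 0" for a using eq[of a] by simp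
    then have "\<zeta> = 0" by (intro ext) simp
    then show False using b(2) by (simp add: \<zeta>_def)
  qed
  have "translate \<eta> (s (1 / \<zeta> 1) b) a = \<chi> a" for a
    using \<zeta>1 eq[of a] by (simp add: translate_scale[OF dual] \<zeta>_def[symmetric])
  then have "translate \<eta> (s (1 / \<zeta> 1) b) = \<chi>" by (rule ext)
  then show thesis by (rule that)
qed

text \<open>Each \<open>a\<close> differs from the scalar \<open>\<chi> a\<close> by an element of
  the kernel, so the kernel has codimension one; an element outside it is inverted modulo it by a
  scalar.\<close>

lemma character_cofinite:
  assumes \<chi>: "algebra_hom s (*) \<chi>" and \<mm>: "\<mm> = {a. \<chi> a = 0}"
  shows "\<mm> \<in> cofinite_maximal_ideals s" "\<chi> \<in> dist_at s \<mm>" "\<chi> \<noteq> 0"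
proof -
  have \<chi>': "\<chi> \<in> dual_space s" "\<chi> 1 = 1" "\<And>a b. \<chi> (a * b) = \<chi> a * \<chi> b"
    using \<chi> by (auto simp: algebra_hom_def dual_space_def)
  have sub: "ring.subspace \<mm>" unfolding \<mm>
    using \<chi>' dual_zero_eq[OF \<chi>'(1)] by (intro ring.subspaceI) (auto simp: dual_iff)
  have inv: "\<exists>c. b * c - 1 \<in> \<mm>" if "b \<notin> \<mm>" for b
    using that \<chi>' by (intro exI[of _ "s (1 / \<chi> b) 1"]) (simp add: \<mm> dual_diff[OF \<chi>'(1)] dual_iff)
  have "\<exists>b\<in>span {1}. a - b \<in> \<mm>" for a
    using \<chi>' by (intro bexI[of _ "s (\<chi> a) 1"] span_scale span_base)
      (auto simp: \<mm> dual_diff[OF \<chi>'(1)] dual_iff)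
  moreover have "maximalideal \<mm> ring_of_type_algebra"
    unfolding maximalideal_type_iff using sub inv \<chi>'(2) by (simp add: \<mm>)
  ultimately show "\<mm> \<in> cofinite_maximal_ideals s"
    unfolding cofinite_maximal_ideals_def by (auto intro: exI[of _ "{1}"])
  have "ideal_power \<mm> (Suc 0) \<subseteq> \<mm>"
    using ring.subspace_scale[OF sub] by (intro ideal_power_Suc_subset sub)
  then have "ideal_power \<mm> n \<subseteq> \<mm>" if "1 \<le> n" for n
    using ideal_power_antimono[OF sub that] by simp
  then show "\<chi> \<in> dist_at s \<mm>" using \<chi>'(1) by (auto simp: dist_at_def \<mm>)
  show "\<chi> \<noteq> 0" using \<chi>'(2) by auto
qed

text \<open>
  Here \<open>\<Lambda>T\<Lambda>\<close> is a noetherian left \<open>\<Lambda>\<close>-module, so every \<open>T \<circ> a\<close> is a \<open>\<Lambda>\<close>-combination of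
  finitely many maps and \<open>a(\<xi> \<circ> T)\<close> is a combination of their composites with translates of \<open>\<xi>\<close>.
\<close>

lemma finite_translates_comp:
  assumes \<xi>: "\<xi> \<in> dual_space s" "finite_translates \<xi>"
    and "finite E" and E: "\<And>a. (\<lambda>b. to_fract (T (a * b))) \<in> module.span (\<lambda>r f b. to_fract r * f b) E"
  shows "finite_translates (\<lambda>a. \<xi> (T a))"
proof -
  interpret fm: Modules.module "\<lambda>(r::'a) (f::'a \<Rightarrow> 'a fract) b. to_fract r * f b"
    by unfold_locales (simp_all add: distrib_left distrib_right mult.assoc fun_eq_iff)
  note fm.scale_scale [simp del]
  \<comment> \<open>The module \<Lambda>T\<Lambda>, realised as maps into the fraction field, where
    the possibly non-integral generators \<open>E\<close> also live.\<close>
  let ?M = "fm.span (range (\<lambda>a b. to_fract (T (a * b))))"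
  have M: "?M \<subseteq> fm.span E"
    by (rule fm.span_minimal[OF _ fm.subspace_span]) (use E in blast)
  then obtain A where A: "finite A" "A \<subseteq> ?M" "?M \<subseteq> fm.span A"
    using fm.noetherian_submodule_fg[OF noetherian assms(3) fm.subspace_span M] by blast
  \<comment> \<open>The generators \<open>A\<close> were found inside \<open>?M\<close>, hence take
    values in \<Lambda>, which is not known for those in \<open>E\<close>.\<close>
  have int: "range f \<subseteq> range to_fract" if "f \<in> ?M" for f
    using that
  proof (induction rule: fm.span_induct_alt)
    case base
    show ?case by (auto intro!: image_eqI[of _ _ 0])
  next
    case (step c x y)
    then obtain a where a: "x = (\<lambda>b. to_fract (T (a * b)))" by auto
    have "\<exists>z. to_fract c * x b + y b = to_fract z" for b
    proof -
      obtain z where "y b = to_fract z" using step(2) by auto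
      then show ?thesis by (intro exI[of _ "c * T (a * b) + z"]) (simp add: a)
    qed
    then show ?case by auto
  qed
  \<comment> \<open>A left inverse of the embedding. Its arbitrary values off \<Lambda> never
    matter, because it is only evaluated on values of maps shown to be integral.\<close>
  define r where "r = inv_into UNIV (to_fract :: 'a \<Rightarrow> 'a fract)"
  have r [simp]: "r (to_fract x) = x" for x
    unfolding r_def by (simp add: inv_into_f_f inj_def)
  obtain D where D: "finite D" "range (translate \<xi>) \<subseteq> func.span D"
    using \<xi>(2) by (auto simp: finite_translates_def)
  let ?G = "\<Union>m\<in>A. (\<lambda>\<eta> b. \<eta> (r (m b))) ` D"
  \<comment> \<open>The functional \<open>b \<mapsto> \<xi> (c * m b)\<close> is the composite of
    the translate of \<xi> by \<open>c\<close> with \<open>m\<close>, and all such translates lie in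
    the span of the finite set \<open>D\<close>.\<close>
  have comp: "(\<lambda>b. \<xi> (c * r (m b))) \<in> func.span ?G" if "m \<in> A" for m c
  proof -
    have "(\<lambda>b. \<eta> (r (m b))) \<in> func.span ?G" if "\<eta> \<in> func.span D" for \<eta>
      using that
    proof (induction rule: func.span_induct_alt)
      case base
      show ?case using func.span_zero by (simp add: zero_fun_def)
    next
      case (step k x y)
      have "(\<lambda>b. k * (\<lambda>b. x (r (m b))) b) + (\<lambda>b. y (r (m b))) \<in> func.span ?G"
        using step \<open>m \<in> A\<close> by (intro func.span_add func.span_scale) (auto intro: func.span_base)
      then show ?case by (simp add: plus_fun_def)
    qed
    from this[of "translate \<xi> c"] D(2) show ?thesis by (simp add: translate_apply image_subset_iff)
  qed
  have span: "range f \<subseteq> range to_fract \<and> (\<lambda>b. \<xi> (r (f b))) \<in> func.span ?G" if "f \<in> fm.span A" for f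
    using that
  proof (induction rule: fm.span_induct_alt)
    case base
    have "r 0 = 0" using r[of 0] by simp
    then show ?case using func.span_zero dual_zero_eq[OF \<xi>(1)]
      by (auto simp: zero_fun_def intro!: image_eqI[of _ _ 0])
  next
    case (step c m f)
    have *: "\<exists>x y. m b = to_fract x \<and> f b = to_fract y" for b
      using int[of m] A(2) step by blast
    have rr: "r (to_fract c * m b + f b) = c * r (m b) + r (f b)" for b
    proof -
      obtain x y where "m b = to_fract x" "f b = to_fract y" using * by blast
      then show ?thesis using r[of "c * x + y"] by simp
    qed
    have "\<exists>z. to_fract c * m b + f b = to_fract z" for b
    proof -
      obtain x y where "m b = to_fract x" "f b = to_fract y" using * by blast
      then show ?thesis by (intro exI[of _ "c * x + y"]) simp
    qed
    moreover have "(\<lambda>b. \<xi> (r (to_fract c * m b + f b))) = (\<lambda>b. \<xi> (c * r (m b))) + (\<lambda>b. \<xi> (r (f b)))"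
      using \<xi>(1) by (simp add: rr dual_iff fun_eq_iff)
    then have "(\<lambda>b. \<xi> (r (to_fract c * m b + f b))) \<in> func.span ?G"
      using func.span_add[OF comp[OF step(1)] conjunct2[OF step(2)]] by simp
    ultimately show ?case by auto
  qed
  have "translate (\<lambda>a. \<xi> (T a)) a \<in> func.span ?G" for a
  proof -
    have "(\<lambda>b. to_fract (T (a * b))) \<in> fm.span A" using A(3) by (auto intro: fm.span_base)
    from conjunct2[OF span[OF this]] show ?thesis by (simp add: translate_def)
  qed
  moreover have "finite ?G" using A D by auto
  ultimately show ?thesis unfolding finite_translates_def by blast
qed

end

section \<open>The action of the smash product\<close>

lemma vector_space_free_scale: "vector_space (free_scale :: 'k::field \<Rightarrow> ('a \<Rightarrow>\<^sub>0 'k) \<Rightarrow> _)"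
  by unfold_locales
    (simp_all add: free_scale_def poly_mapping_eq_iff fun_eq_iff map.rep_eq lookup_add when_def
      distrib_right flip: distrib_left)

text \<open>The universal property of the tensor product: \<beta> extends linearly to a map \<Phi>
  on the free vector space, and bilinearity says that \<Phi> vanishes on the four families of
  relations.\<close>

lemma tensor_eq_sum_list:
  fixes sV :: "'k::field \<Rightarrow> 'v::ab_group_add \<Rightarrow> 'v" and sW :: "'k \<Rightarrow> 'w::ab_group_add \<Rightarrow> 'w"
    and sU :: "'k \<Rightarrow> 'u::ab_group_add \<Rightarrow> 'u"
  assumes "vector_space sU" and "tensor_eq sV sW ts us"
    and addl: "\<And>v v' w. \<beta> (v + v') w = \<beta> v w + \<beta> v' w"
    and addr: "\<And>v w w'. \<beta> v (w + w') = \<beta> v w + \<beta> v w'"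
    and scalel: "\<And>c v w. \<beta> (sV c v) w = sU c (\<beta> v w)"
    and scaler: "\<And>c v w. \<beta> v (sW c w) = sU c (\<beta> v w)"
  shows "(\<Sum>(v, w)\<leftarrow>ts. \<beta> v w) = (\<Sum>(v, w)\<leftarrow>us. \<beta> v w)"
proof -
  interpret U: vector_space sU by fact
  interpret free: vector_space "free_scale :: 'k \<Rightarrow> ('v \<times> 'w \<Rightarrow>\<^sub>0 'k) \<Rightarrow> _"
    by (rule vector_space_free_scale)
  define \<Phi> where "\<Phi> p = (\<Sum>t\<in>Poly_Mapping.keys p. sU (Poly_Mapping.lookup p t) (case_prod \<beta> t))" for p :: "'v \<times> 'w \<Rightarrow>\<^sub>0 'k"
  \<comment> \<open>Summing over any finite set containing the support gives two elements a common
    index set.\<close>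
  have \<Phi>: "\<Phi> p = (\<Sum>t\<in>K. sU (Poly_Mapping.lookup p t) (case_prod \<beta> t))" if "finite K" "Poly_Mapping.keys p \<subseteq> K" for p K
    unfolding \<Phi>_def using that by (intro sum.mono_neutral_left) (auto simp: in_keys_iff)
  have \<Phi>_add: "\<Phi> (p + q) = \<Phi> p + \<Phi> q" for p q
  proof -
    let ?K = "Poly_Mapping.keys p \<union> Poly_Mapping.keys q"
    have "\<Phi> (p + q) = (\<Sum>t\<in>?K. sU (Poly_Mapping.lookup (p + q) t) (case_prod \<beta> t))"
      by (intro \<Phi>) (auto simp: in_keys_iff lookup_add)
    also have "\<dots> = \<Phi> p + \<Phi> q"
      by (simp add: \<Phi>[of ?K p] \<Phi>[of ?K q] lookup_add U.scale_left_distrib sum.distrib)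
    finally show ?thesis .
  qed
  have \<Phi>_0: "\<Phi> 0 = 0" by (simp add: \<Phi>_def)
  have \<Phi>_diff: "\<Phi> (p - q) = \<Phi> p - \<Phi> q" for p q
    using \<Phi>_add[of "p - q" q] by simp
  have \<Phi>_scale: "\<Phi> (free_scale c p) = sU c (\<Phi> p)" for c p
  proof -
    have "\<Phi> (free_scale c p) = (\<Sum>t\<in>Poly_Mapping.keys p. sU (Poly_Mapping.lookup (free_scale c p) t) (case_prod \<beta> t))"
      by (intro \<Phi>) (auto simp: in_keys_iff free_scale_def map.rep_eq)
    also have "\<dots> = sU c (\<Phi> p)"
      unfolding \<Phi>_def U.scale_sum_right
      by (intro sum.cong) (auto simp: free_scale_def map.rep_eq in_keys_iff when_def)
    finally show ?thesis .
  qed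
  have \<Phi>_single: "\<Phi> (Poly_Mapping.single t c) = sU c (case_prod \<beta> t)" for t c
    by (simp add: \<Phi>_def lookup_single)
  have formal: "\<Phi> (formal_sum xs) = (\<Sum>(v, w)\<leftarrow>xs. \<beta> v w)" for xs
    by (induction xs) (auto simp: formal_sum_def \<Phi>_0 \<Phi>_add \<Phi>_single)
  have "free.subspace {p. \<Phi> p = 0}"
    by (rule free.subspaceI) (auto simp: \<Phi>_0 \<Phi>_add \<Phi>_scale)
  moreover have "tensor_relations sV sW \<subseteq> {p. \<Phi> p = 0}"
    by (auto simp: tensor_relations_def \<Phi>_diff \<Phi>_single addl addr scalel scaler)
  ultimately have "free.span (tensor_relations sV sW) \<subseteq> {p. \<Phi> p = 0}"
    by (intro free.span_minimal)
  then show ?thesis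
    using assms(2) by (auto simp: tensor_eq_def \<Phi>_diff formal)
qed

lemma additive_sum_list:
  fixes f :: "'a::monoid_add \<Rightarrow> 'b::group_add"
  assumes "\<And>x y. f (x + y) = f x + f y"
  shows "f (\<Sum>x\<leftarrow>xs. g x) = (\<Sum>x\<leftarrow>xs. f (g x))"
proof -
  have "f 0 = 0" using assms[of 0 0] by (metis add.right_neutral add_left_imp_eq)
  then show ?thesis by (induction xs) (simp_all add: assms)
qed

context smash_product
begin

lemma act_add: "act x (a + b) = act x a + act x b"
  and act_add_left: "act (x + y) a = act x a + act y a"
  and act_scale: "act x (sA c a) = sA c (act x a)"
  and act_scale_left: "act (sH c x) a = sA c (act x a)"
  using act_linear[of x] act_linear_left[of a]
  by (auto simp: Vector_Spaces.linear_def module_hom_def module_hom_axioms_def)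

lemma emb_A_add: "\<iota>A (a + b) = \<iota>A a + \<iota>A b"
  and emb_A_mult: "\<iota>A (a * b) = \<iota>A a * \<iota>A b"
  and emb_A_one: "\<iota>A 1 = 1"
  and emb_H_mult: "\<iota>H (x * y) = \<iota>H x * \<iota>H y"
  and emb_H_one: "\<iota>H 1 = 1"
  using emb_A(1) emb_H(1)
  by (auto simp: algebra_hom_def Vector_Spaces.linear_def module_hom_def module_hom_axioms_def)

lemma emb_A_neg: "\<iota>A (- a) = - \<iota>A a"
  using emb_A_add[of a "- a"] emb_A_add[of 0 0] by (simp add: eq_neg_iff_add_eq_0 add.commute)

text \<open>This makes the action of the smash product well defined: \<open>a * act x g\<close> is
  bilinear in \<open>a\<close> and \<open>x\<close>, so it depends only on the tensor, and
  \<open>smash_tensor\<close> recovers the tensor from the element.\<close>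

lemma smash_sum_eq_0:
  assumes "(\<Sum>(a, x)\<leftarrow>ts. \<iota>A a * \<iota>H x) = 0"
  shows "(\<Sum>(a, x)\<leftarrow>ts. a * act x g) = 0"
proof -
  have "(\<Sum>(a, x)\<leftarrow>ts. a * act x g) = (\<Sum>(a, x)\<leftarrow>[]. a * act x g)"
    by (rule tensor_eq_sum_list[OF A.vector_space_axioms smash_tensor[OF assms]])
      (simp_all add: distrib_left distrib_right act_add_left act_scale_left
        A.scale_mult_left[symmetric] A.scale_mult_right[symmetric])
  then show ?thesis by simp
qed

lemma smash_sum_cong:
  assumes "(\<Sum>(a, x)\<leftarrow>ts. \<iota>A a * \<iota>H x) = (\<Sum>(a, x)\<leftarrow>us. \<iota>A a * \<iota>H x)"
  shows "(\<Sum>(a, x)\<leftarrow>ts. a * act x g) = (\<Sum>(a, x)\<leftarrow>us. a * act x g)"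
proof -
  let ?neg = "map (\<lambda>(a, x). (- a, x)) us"
  have 1: "(\<Sum>(a, x)\<leftarrow>?neg. \<iota>A a * \<iota>H x) = - (\<Sum>(a, x)\<leftarrow>us. \<iota>A a * \<iota>H x)"
    by (induction us) (auto simp: emb_A_neg)
  have 2: "(\<Sum>(a, x)\<leftarrow>?neg. a * act x g) = - (\<Sum>(a, x)\<leftarrow>us. a * act x g)"
    by (induction us) auto
  have "(\<Sum>(a, x)\<leftarrow>ts @ ?neg. \<iota>A a * \<iota>H x) = 0"
    using assms 1 by simp
  from smash_sum_eq_0[OF this, of g] 2 show ?thesis by simp
qed

text \<open>The operator of \<open>Z\<close>, computed from an arbitrarily chosen expression of
  \<open>Z\<close> as a sum of products. \<open>smash_sum_cong\<close> removes the dependence on the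
  choice.\<close>

definition smash_act :: "'s \<Rightarrow> 'a \<Rightarrow> 'a" where
  "smash_act Z g = (\<Sum>(a, x)\<leftarrow>(SOME ts. Z = (\<Sum>(a, x)\<leftarrow>ts. \<iota>A a * \<iota>H x)). a * act x g)"

lemma smash_act_sum: "smash_act (\<Sum>(a, x)\<leftarrow>ts. \<iota>A a * \<iota>H x) g = (\<Sum>(a, x)\<leftarrow>ts. a * act x g)"
  unfolding smash_act_def
  by (rule smash_sum_cong[OF
        someI[of "\<lambda>us. (\<Sum>(a, x)\<leftarrow>ts. \<iota>A a * \<iota>H x) = (\<Sum>(a, x)\<leftarrow>us. \<iota>A a * \<iota>H x)", OF refl,
          symmetric]])

lemma smash_act_sum_list:
  "smash_act (\<Sum>i\<leftarrow>is. \<iota>A (f i) * \<iota>H (h i)) g = (\<Sum>i\<leftarrow>is. f i * act (h i) g)"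
  using smash_act_sum[of "map (\<lambda>i. (f i, h i)) is" g] by (simp add: comp_def)

lemma smash_act_add: "smash_act (Z + Y) g = smash_act Z g + smash_act Y g"
proof -
  obtain ts us where "Z = (\<Sum>(a, x)\<leftarrow>ts. \<iota>A a * \<iota>H x)" "Y = (\<Sum>(a, x)\<leftarrow>us. \<iota>A a * \<iota>H x)"
    using smash_span by metis
  then show ?thesis
    using smash_act_sum[of "ts @ us" g] by (simp add: smash_act_sum)
qed

lemma smash_act_generator: "smash_act (\<iota>A a * \<iota>H x) g = a * act x g"
  using smash_act_sum[of "[(a, x)]"] by simp

lemma smash_act_add_right: "smash_act Z (f + g) = smash_act Z f + smash_act Z g"
  and smash_act_scale_right: "smash_act Z (sA c g) = sA c (smash_act Z g)"
proof -
  obtain ts where Z: "Z = (\<Sum>(a, x)\<leftarrow>ts. \<iota>A a * \<iota>H x)"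
    using smash_span by metis
  show "smash_act Z (f + g) = smash_act Z f + smash_act Z g"
    unfolding Z smash_act_sum by (induction ts) (auto simp: act_add algebra_simps)
  show "smash_act Z (sA c g) = sA c (smash_act Z g)"
    unfolding Z smash_act_sum
    by (induction ts) (auto simp: act_scale A.scale_mult_right[symmetric] A.scale_right_distrib)
qed

text \<open>Both the commutation rule and the product rule \<open>act_mult\<close> expand along the
  same chosen list \<open>\<Delta> x\<close>, so the two sides agree term by term.\<close>

lemma smash_act_mult_generator:
  "smash_act (\<iota>A a * \<iota>H x * (\<iota>A b * \<iota>H y)) g = a * act x (b * act y g)"
proof -
  have "\<iota>A a * \<iota>H x * (\<iota>A b * \<iota>H y) = \<iota>A a * (\<iota>H x * \<iota>A b) * \<iota>H y"
    by (simp add: mult.assoc)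
  also have "\<dots> = (\<Sum>(p, q)\<leftarrow>\<Delta> x. \<iota>A (a * act p b) * \<iota>H (q * y))"
    unfolding smash_commute sum_list_const_mult[symmetric] sum_list_mult_const[symmetric]
    by (simp add: case_prod_unfold emb_A_mult emb_H_mult mult.assoc)
  finally have "smash_act (\<iota>A a * \<iota>H x * (\<iota>A b * \<iota>H y)) g =
      (\<Sum>(p, q)\<leftarrow>\<Delta> x. a * act p b * act (q * y) g)"
    by (simp add: smash_act_sum_list case_prod_unfold)
  also have "\<dots> = a * act x (b * act y g)"
    by (simp add: act_mult act_mult_left sum_list_const_mult[symmetric] case_prod_unfold mult.assoc)
  finally show ?thesis .
qed

lemma smash_act_mult: "smash_act (Z * Y) g = smash_act Z (smash_act Y g)"
proof -
  obtain ts us where Z: "Z = (\<Sum>(a, x)\<leftarrow>ts. \<iota>A a * \<iota>H x)" and Y: "Y = (\<Sum>(b, y)\<leftarrow>us. \<iota>A b * \<iota>H y)"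
    using smash_span by metis
  have gen: "smash_act (\<iota>A a * \<iota>H x * Y) g = a * act x (smash_act Y g)" for a x
  proof -
    have "smash_act (\<iota>A a * \<iota>H x * Y) g =
        (\<Sum>u\<leftarrow>us. smash_act (\<iota>A a * \<iota>H x * (case u of (b, y) \<Rightarrow> \<iota>A b * \<iota>H y)) g)"
      unfolding Y
      by (rule additive_sum_list[of "\<lambda>Y. smash_act (\<iota>A a * \<iota>H x * Y) g"])
        (simp add: distrib_left smash_act_add)
    also have "\<dots> = (\<Sum>u\<leftarrow>us. a * act x (case u of (b, y) \<Rightarrow> b * act y g))"
      by (simp add: case_prod_unfold smash_act_mult_generator)
    also have "\<dots> = a * act x (\<Sum>u\<leftarrow>us. (case u of (b, y) \<Rightarrow> b * act y g))"
      by (rule additive_sum_list[of "\<lambda>h. a * act x h", symmetric]) (simp add: distrib_left act_add)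
    also have "\<dots> = a * act x (smash_act Y g)" by (simp add: Y smash_act_sum)
    finally show ?thesis .
  qed
  have "smash_act (Z * Y) g = (\<Sum>t\<leftarrow>ts. smash_act ((case t of (a, x) \<Rightarrow> \<iota>A a * \<iota>H x) * Y) g)"
    unfolding Z
    by (rule additive_sum_list[of "\<lambda>Z. smash_act (Z * Y) g"]) (simp add: distrib_right smash_act_add)
  also have "\<dots> = smash_act Z (smash_act Y g)"
    by (simp add: Z smash_act_sum_list gen case_prod_unfold)
  finally show ?thesis .
qed

end

lemma sum_list_apply: "(\<Sum>x\<leftarrow>xs. h x) b = (\<Sum>x\<leftarrow>xs. h x b)"
  by (induction xs) auto

lemma (in Modules.module) span_sum_list: "(\<And>x. x \<in> set xs \<Longrightarrow> f x \<in> span S) \<Longrightarrow> (\<Sum>x\<leftarrow>xs. f x) \<in> span S"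
  by (induction xs) (auto intro: span_zero span_add)

context hopf_galois_setting
begin

lemma smash_act_emb: "smash_act (\<iota>L f) g = f * g"
  using smash_act_generator[of f 1 g] by (simp add: emb_H_one act_one_left)

text \<open>Replaces the definite description by an explicit formula. Uniqueness holds because
  additivity, multiplicativity and the values on the two embedded algebras fix the operator on every
  sum of products, and \<open>smash_span\<close> says these are all elements.\<close>

lemma smash_hat_eq: "smash_hat s\<Lambda> actL \<iota>L \<iota>H = smash_act"
  unfolding smash_hat_def
proof (rule the_equality, intro conjI allI)
  show "Vector_Spaces.linear (fract_scale s\<Lambda>) (fract_scale s\<Lambda>) (smash_act Z)" for Z
    unfolding Vector_Spaces.linear_def module_hom_def module_hom_axioms_def
    using A.vector_space_axioms A.module_axioms
    by (auto simp: smash_act_add_right smash_act_scale_right)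
  show "smash_act (Z + Y) g = smash_act Z g + smash_act Y g" for Z Y g by (rule smash_act_add)
  show "smash_act (Z * Y) g = smash_act Z (smash_act Y g)" for Z Y g by (rule smash_act_mult)
  show "smash_act (\<iota>L f) g = f * g" for f g by (rule smash_act_emb)
  show "smash_act (\<iota>H x) g = actL x g" for x g
    using smash_act_generator[of 1 x g] by (simp add: emb_A_one)
next
  fix \<rho> assume \<rho>: "(\<forall>Z. Vector_Spaces.linear (fract_scale s\<Lambda>) (fract_scale s\<Lambda>) (\<rho> Z)) \<and>
     (\<forall>Z Y g. \<rho> (Z + Y) g = \<rho> Z g + \<rho> Y g) \<and>
     (\<forall>Z Y g. \<rho> (Z * Y) g = \<rho> Z (\<rho> Y g)) \<and>
     (\<forall>f g. \<rho> (\<iota>L f) g = f * g) \<and>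
     (\<forall>x g. \<rho> (\<iota>H x) g = actL x g)"
  have "\<rho> Z g = smash_act Z g" for Z g
  proof -
    obtain ts where Z: "Z = (\<Sum>(a, x)\<leftarrow>ts. \<iota>L a * \<iota>H x)"
      using smash_span by metis
    have "\<rho> (\<Sum>(a, x)\<leftarrow>ts. \<iota>L a * \<iota>H x) g = (\<Sum>t\<leftarrow>ts. \<rho> (case t of (a, x) \<Rightarrow> \<iota>L a * \<iota>H x) g)"
      by (rule additive_sum_list[of "\<lambda>Z. \<rho> Z g"]) (use \<rho> in blast)
    then show ?thesis using \<rho> 
      by (simp add: Z smash_act_sum_list smash_act_generator case_prod_unfold)
  qed
  then show "\<rho> = smash_act" by (simp add: fun_eq_iff)
qed

text \<open>Applied to a product \<open>a * b\<close>, a term \<open>f x\<close> of \<open>Z\<close>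
  gives the sum of \<open>(y \<triangleright> a) f (z \<triangleright> b)\<close> over the pairs
  \<open>(y, z)\<close> in \<open>\<Delta> x\<close>. Only the first factor depends on
  \<open>a\<close>, and it lies in \<Lambda> by \<open>act_extends\<close>; the other factors give
  the finite set.\<close>

lemma smash_act_translates:
  obtains E where "finite E"
    "\<And>a. (\<lambda>b. smash_act Z (to_fract (a * b))) \<in> module.span (\<lambda>r f b. to_fract r * f b) E"
proof -
  interpret fm: Modules.module "\<lambda>(r::'l) (f::'l \<Rightarrow> 'l fract) b. to_fract r * f b"
    by unfold_locales (simp_all add: distrib_left distrib_right mult.assoc fun_eq_iff)
  obtain ts where Z: "Z = (\<Sum>(f, x)\<leftarrow>ts. \<iota>L f * \<iota>H x)"
    using smash_span by metis
  define E where "E = (\<Union>t\<in>set ts. (\<lambda>yz b. fst t * actL (snd yz) (to_fract b)) ` set (\<Delta> (snd t)))"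
  have "(\<lambda>b. smash_act Z (to_fract (a * b))) \<in> fm.span E" for a
  proof -
    have inner: "(\<Sum>yz\<leftarrow>\<Delta> (snd t).
        (\<lambda>b. to_fract (act (fst yz) a) * (fst t * actL (snd yz) (to_fract b)))) \<in> fm.span E"
      if "t \<in> set ts" for t
    proof (rule fm.span_sum_list)
      fix yz assume "yz \<in> set (\<Delta> (snd t))"
      then have "(\<lambda>b. fst t * actL (snd yz) (to_fract b)) \<in> E"
        using that unfolding E_def by blast
      then show "(\<lambda>b. to_fract (act (fst yz) a) * (fst t * actL (snd yz) (to_fract b))) \<in> fm.span E"
        by (intro fm.span_scale[OF fm.span_base])
    qed
    have "(\<lambda>b. smash_act Z (to_fract (a * b))) = (\<Sum>t\<leftarrow>ts. \<Sum>yz\<leftarrow>\<Delta> (snd t).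
        (\<lambda>b. to_fract (act (fst yz) a) * (fst t * actL (snd yz) (to_fract b))))"
    proof
      fix b
      have "smash_act Z (to_fract (a * b)) = (\<Sum>t\<leftarrow>ts. \<Sum>yz\<leftarrow>\<Delta> (snd t).
        to_fract (act (fst yz) a) * (fst t * actL (snd yz) (to_fract b)))"
        unfolding Z smash_act_sum
        by (simp add: act_mult act_extends case_prod_unfold sum_list_const_mult[symmetric] mult_ac)
      then show "smash_act Z (to_fract (a * b)) = (\<Sum>t\<leftarrow>ts. \<Sum>yz\<leftarrow>\<Delta> (snd t).
        (\<lambda>b. to_fract (act (fst yz) a) * (fst t * actL (snd yz) (to_fract b)))) b"
        by (simp add: sum_list_apply)
    qed
    also have "\<dots> \<in> fm.span E" by (rule fm.span_sum_list) (use inner in auto)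
    finally show ?thesis .
  qed
  moreover have "finite E" by (auto simp: E_def)
  ultimately show thesis using that by blast
qed

end

section \<open>Modules and weight spaces\<close>

context left_module
begin

lemma smult_zero [simp]: "r \<in> carrier R \<Longrightarrow> r \<odot>\<^bsub>M\<^esub> \<zero>\<^bsub>M\<^esub> = \<zero>\<^bsub>M\<^esub>"
  using smult_r_distr[of r "\<zero>\<^bsub>M\<^esub>" "\<zero>\<^bsub>M\<^esub>"] smult_closed[of r "\<zero>\<^bsub>M\<^esub>"]
  by (simp add: M.add.l_cancel_one')

lemma zero_smult [simp]: "v \<in> carrier M \<Longrightarrow> \<zero>\<^bsub>R\<^esub> \<odot>\<^bsub>M\<^esub> v = \<zero>\<^bsub>M\<^esub>"
  using smult_l_distr[of "\<zero>\<^bsub>R\<^esub>" "\<zero>\<^bsub>R\<^esub>" v] smult_closed[of "\<zero>\<^bsub>R\<^esub>" v]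
  by (simp add: M.add.l_cancel_one')

lemma minus_one_smult:
  assumes "v \<in> carrier M"
  shows "(\<ominus>\<^bsub>R\<^esub> \<one>\<^bsub>R\<^esub>) \<odot>\<^bsub>M\<^esub> v = \<ominus>\<^bsub>M\<^esub> v"
proof -
  have "(\<ominus>\<^bsub>R\<^esub> \<one>\<^bsub>R\<^esub>) \<odot>\<^bsub>M\<^esub> v \<oplus>\<^bsub>M\<^esub> \<one>\<^bsub>R\<^esub> \<odot>\<^bsub>M\<^esub> v = \<zero>\<^bsub>M\<^esub>"
    using assms by (simp add: smult_l_distr[symmetric] R.l_neg)
  then show ?thesis
    using assms smult_closed[of "\<ominus>\<^bsub>R\<^esub> \<one>\<^bsub>R\<^esub>" v] by (simp add: smult_one M.minus_equality)
qed

text \<open>Closure under negation is absent on the right because it follows from multiplication by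
  -1.\<close>

lemma submodule_iff:
  "submodule N R M \<longleftrightarrow> N \<subseteq> carrier M \<and> \<zero>\<^bsub>M\<^esub> \<in> N \<and>
     (\<forall>v\<in>N. \<forall>w\<in>N. v \<oplus>\<^bsub>M\<^esub> w \<in> N) \<and> (\<forall>r\<in>carrier R. \<forall>v\<in>N. r \<odot>\<^bsub>M\<^esub> v \<in> N)"
proof
  assume "submodule N R M"
  then interpret submodule N R M .
  show "N \<subseteq> carrier M \<and> \<zero>\<^bsub>M\<^esub> \<in> N \<and>
     (\<forall>v\<in>N. \<forall>w\<in>N. v \<oplus>\<^bsub>M\<^esub> w \<in> N) \<and> (\<forall>r\<in>carrier R. \<forall>v\<in>N. r \<odot>\<^bsub>M\<^esub> v \<in> N)"
    using subset one_closed m_closed smult_closed by auto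
next
  assume N: "N \<subseteq> carrier M \<and> \<zero>\<^bsub>M\<^esub> \<in> N \<and>
     (\<forall>v\<in>N. \<forall>w\<in>N. v \<oplus>\<^bsub>M\<^esub> w \<in> N) \<and> (\<forall>r\<in>carrier R. \<forall>v\<in>N. r \<odot>\<^bsub>M\<^esub> v \<in> N)"
  have "inv\<^bsub>add_monoid M\<^esub> v \<in> N" if "v \<in> N" for v
  proof -
    have "(\<ominus>\<^bsub>R\<^esub> \<one>\<^bsub>R\<^esub>) \<odot>\<^bsub>M\<^esub> v \<in> N" "v \<in> carrier M" using N that by auto
    then have "\<ominus>\<^bsub>M\<^esub> v \<in> N" by (simp only: minus_one_smult)
    then show ?thesis by (simp add: a_inv_def)
  qed
  then show "submodule N R M"
    using N by (intro submodule.intro subgroup.intro submodule_axioms.intro) auto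
qed

lemma submodule_left_module:
  assumes "submodule N R M"
  shows "left_module R (M\<lparr>carrier := N\<rparr>)"
proof -
  have N: "N \<subseteq> carrier M" "\<zero>\<^bsub>M\<^esub> \<in> N" "\<And>v w. v \<in> N \<Longrightarrow> w \<in> N \<Longrightarrow> v \<oplus>\<^bsub>M\<^esub> w \<in> N"
    "\<And>r v. r \<in> carrier R \<Longrightarrow> v \<in> N \<Longrightarrow> r \<odot>\<^bsub>M\<^esub> v \<in> N"
    using assms by (auto simp: submodule_iff)
  have inv: "\<exists>w\<in>N. w \<oplus>\<^bsub>M\<^esub> v = \<zero>\<^bsub>M\<^esub>" if "v \<in> N" for v
    using N(4)[of "\<ominus>\<^bsub>R\<^esub> \<one>\<^bsub>R\<^esub>" v] N(1) that
    by (intro bexI[of _ "\<ominus>\<^bsub>M\<^esub> v"]) (auto simp: minus_one_smult M.l_neg)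
  have car: "v \<in> carrier M" if "v \<in> N" for v using N(1) that by blast
  have "abelian_group (M\<lparr>carrier := N\<rparr>)"
    by (rule abelian_groupI) (use N(2,3) inv in \<open>auto simp: car M.a_ac\<close>)
  then show ?thesis
    using R.ring_axioms
    by (intro left_module.intro left_module_axioms.intro)
      (simp_all add: car N smult_l_distr smult_r_distr smult_assoc smult_one)
qed

lemma cyclic_submodule:
  assumes "v \<in> carrier M"
  shows "submodule (cyclic_submodule R M v) R M" "v \<in> cyclic_submodule R M v"
proof -
  have "r \<odot>\<^bsub>M\<^esub> v \<oplus>\<^bsub>M\<^esub> s \<odot>\<^bsub>M\<^esub> v \<in> cyclic_submodule R M v"
    if "r \<in> carrier R" "s \<in> carrier R" for r s
    unfolding cyclic_submodule_def smult_l_distr[OF that assms, symmetric] using that by blast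
  moreover have "r \<odot>\<^bsub>M\<^esub> (s \<odot>\<^bsub>M\<^esub> v) \<in> cyclic_submodule R M v"
    if "r \<in> carrier R" "s \<in> carrier R" for r s
    unfolding cyclic_submodule_def smult_assoc[OF that assms, symmetric] using that by blast
  moreover have "\<zero>\<^bsub>M\<^esub> \<in> cyclic_submodule R M v"
    unfolding cyclic_submodule_def using zero_smult[OF assms] R.zero_closed by (metis (mono_tags) mem_Collect_eq)
  moreover have "cyclic_submodule R M v \<subseteq> carrier M"
    using assms smult_closed by (auto simp: cyclic_submodule_def)
  ultimately show "submodule (cyclic_submodule R M v) R M"
    unfolding submodule_iff by (auto simp: cyclic_submodule_def)
  show "v \<in> cyclic_submodule R M v"
    unfolding cyclic_submodule_def using smult_one[OF assms] R.one_closed by (metis (mono_tags) mem_Collect_eq)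
qed

end

section \<open>Quotient modules\<close>

locale submodule_of_left_module = left_module R M + N: submodule N R M
  for R :: "('r, 'c) ring_scheme" and M :: "('r, 'v, 'e) module_scheme" and N
begin

sublocale abelian_subgroup N M
  by (rule abelian_subgroupI2[OF M.a_comm_group N.subgroup_axioms])

abbreviation "Q \<equiv> quotient_module M N"

lemma carrier_quotient: "carrier Q = (\<lambda>v. N +>\<^bsub>M\<^esub> v) ` carrier M"
  by (auto simp: quotient_module_def A_RCOSETS_def')

lemma zero_quotient: "\<zero>\<^bsub>Q\<^esub> = N"
  by (simp add: quotient_module_def)

lemma coset_eq_iff:
  assumes "v \<in> carrier M" "w \<in> carrier M"
  shows "N +>\<^bsub>M\<^esub> v = N +>\<^bsub>M\<^esub> w \<longleftrightarrow> v \<ominus>\<^bsub>M\<^esub> w \<in> N"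
proof -
  have "v \<ominus>\<^bsub>M\<^esub> w \<in> N \<longleftrightarrow> v \<in> N +>\<^bsub>M\<^esub> w"
    using a_rcos_module[OF assms(2,1)] by (simp add: a_minus_def)
  then show ?thesis
    using a_repr_independence'[OF _ assms(2)] a_rcos_self assms
      a_repr_independence[of v N w] N.subgroup_axioms by metis
qed

lemma coset_zero_iff: "v \<in> carrier M \<Longrightarrow> N +>\<^bsub>M\<^esub> v = N \<longleftrightarrow> v \<in> N"
  using coset_eq_iff[of v "\<zero>\<^bsub>M\<^esub>"] M.a_coset_add_zero[of N] N.subset
  by (simp add: a_minus_def M.minus_equality[of "\<zero>\<^bsub>M\<^esub>" "\<zero>\<^bsub>M\<^esub>"])

lemma add_quotient:
  assumes "v \<in> carrier M" "w \<in> carrier M"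
  shows "(N +>\<^bsub>M\<^esub> v) \<oplus>\<^bsub>Q\<^esub> (N +>\<^bsub>M\<^esub> w) = N +>\<^bsub>M\<^esub> (v \<oplus>\<^bsub>M\<^esub> w)"
  using a_rcos_sum[OF assms] by (simp add: quotient_module_def)

text \<open>The union defining the scalar multiple runs over all representatives of a coset; they
  all yield the same coset because \<open>N\<close> is stable under the ring.\<close>

lemma smult_quotient:
  assumes "r \<in> carrier R" "v \<in> carrier M"
  shows "r \<odot>\<^bsub>Q\<^esub> (N +>\<^bsub>M\<^esub> v) = N +>\<^bsub>M\<^esub> (r \<odot>\<^bsub>M\<^esub> v)"
proof -
  have "N +>\<^bsub>M\<^esub> (r \<odot>\<^bsub>M\<^esub> w) = N +>\<^bsub>M\<^esub> (r \<odot>\<^bsub>M\<^esub> v)" if w: "w \<in> N +>\<^bsub>M\<^esub> v" for w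
  proof -
    obtain n where n: "n \<in> N" "w = n \<oplus>\<^bsub>M\<^esub> v" using w by (auto simp: a_r_coset_def')
    then have "n \<in> carrier M" using N.subset by auto
    then have "N +>\<^bsub>M\<^esub> (r \<odot>\<^bsub>M\<^esub> w) = (N +>\<^bsub>M\<^esub> (r \<odot>\<^bsub>M\<^esub> n)) \<oplus>\<^bsub>Q\<^esub> (N +>\<^bsub>M\<^esub> (r \<odot>\<^bsub>M\<^esub> v))"
      using n assms by (simp add: smult_r_distr add_quotient smult_closed)
    also have "N +>\<^bsub>M\<^esub> (r \<odot>\<^bsub>M\<^esub> n) = N +>\<^bsub>M\<^esub> \<zero>\<^bsub>M\<^esub>"
      using n \<open>n \<in> carrier M\<close> assms N.smult_closed[of r n]
      by (simp add: coset_eq_iff smult_closed a_minus_def)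
    also have "\<dots> \<oplus>\<^bsub>Q\<^esub> (N +>\<^bsub>M\<^esub> (r \<odot>\<^bsub>M\<^esub> v)) = N +>\<^bsub>M\<^esub> (r \<odot>\<^bsub>M\<^esub> v)"
      using assms by (simp add: add_quotient smult_closed)
    finally show ?thesis .
  qed
  moreover have "v \<in> N +>\<^bsub>M\<^esub> v" using a_rcos_self assms by blast
  ultimately have "(\<Union>w\<in>N +>\<^bsub>M\<^esub> v. N +>\<^bsub>M\<^esub> (r \<odot>\<^bsub>M\<^esub> w)) = N +>\<^bsub>M\<^esub> (r \<odot>\<^bsub>M\<^esub> v)"
    by (intro UN_constant_eq ballI)
  then show ?thesis by (simp add: quotient_module_def)
qed

lemma quotient_left_module: "left_module R Q"
proof -
  have zero: "\<zero>\<^bsub>Q\<^esub> = N +>\<^bsub>M\<^esub> \<zero>\<^bsub>M\<^esub>"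
    using coset_zero_iff[of "\<zero>\<^bsub>M\<^esub>"] N.one_closed by (simp add: zero_quotient)
  have "abelian_group Q"
  proof (rule abelian_groupI)
    fix A assume "A \<in> carrier Q"
    then obtain v where v: "v \<in> carrier M" "A = N +>\<^bsub>M\<^esub> v" by (auto simp: carrier_quotient)
    then show "\<exists>B\<in>carrier Q. B \<oplus>\<^bsub>Q\<^esub> A = \<zero>\<^bsub>Q\<^esub>"
      by (intro bexI[of _ "N +>\<^bsub>M\<^esub> (\<ominus>\<^bsub>M\<^esub> v)"])
        (auto simp: zero add_quotient M.l_neg carrier_quotient)
  qed (auto simp: zero carrier_quotient add_quotient M.a_ac)
  then show ?thesis
    using R.ring_axioms
    by (intro left_module.intro left_module_axioms.intro)
      (auto simp: carrier_quotient add_quotient smult_quotient smult_closed smult_l_distr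
        smult_r_distr smult_assoc smult_one)
qed

lemma preimage_submodule:
  assumes "submodule P R Q"
  shows "submodule {v \<in> carrier M. N +>\<^bsub>M\<^esub> v \<in> P} R M"
  using assms coset_zero_iff[of "\<zero>\<^bsub>M\<^esub>"] N.one_closed
  unfolding left_module.submodule_iff[OF quotient_left_module] submodule_iff
  by (auto simp: zero_quotient add_quotient[symmetric] smult_quotient[symmetric] smult_closed)

lemma image_submodule:
  assumes "submodule P R M"
  shows "submodule ((\<lambda>v. N +>\<^bsub>M\<^esub> v) ` P) R Q"
proof -
  have P: "P \<subseteq> carrier M" "\<zero>\<^bsub>M\<^esub> \<in> P" "\<And>v w. v \<in> P \<Longrightarrow> w \<in> P \<Longrightarrow> v \<oplus>\<^bsub>M\<^esub> w \<in> P"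
    "\<And>r v. r \<in> carrier R \<Longrightarrow> v \<in> P \<Longrightarrow> r \<odot>\<^bsub>M\<^esub> v \<in> P"
    using assms by (auto simp: submodule_iff)
  have car: "v \<in> carrier M" if "v \<in> P" for v using P(1) that by blast
  have "\<zero>\<^bsub>Q\<^esub> = N +>\<^bsub>M\<^esub> \<zero>\<^bsub>M\<^esub>"
    using coset_zero_iff[of "\<zero>\<^bsub>M\<^esub>"] N.one_closed by (simp add: zero_quotient)
  then show ?thesis
    unfolding left_module.submodule_iff[OF quotient_left_module]
    using P by (auto simp: car carrier_quotient add_quotient smult_quotient)
qed

end

lemma (in left_module) submodule_of_left_module: "submodule N R M \<Longrightarrow> submodule_of_left_module R M N"
  by (simp add: submodule_of_left_module_def left_module_axioms)

text \<open>Serves three kinds of maps: the action of an element of \<Lambda>, the inclusion of a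
  submodule, and the projection to a quotient.\<close>

lemma finsum_hom:
  assumes "abelian_group M" "abelian_group M'" and "finite J" and "u \<in> J \<rightarrow> carrier M"
    and closed: "\<And>v. v \<in> carrier M \<Longrightarrow> h v \<in> carrier M'"
    and add: "\<And>v w. v \<in> carrier M \<Longrightarrow> w \<in> carrier M \<Longrightarrow> h (v \<oplus>\<^bsub>M\<^esub> w) = h v \<oplus>\<^bsub>M'\<^esub> h w"
  shows "h (finsum M u J) = finsum M' (\<lambda>i. h (u i)) J"
proof -
  interpret M: abelian_group M by fact
  interpret M': abelian_group M' by fact
  have "h \<zero>\<^bsub>M\<^esub> = \<zero>\<^bsub>M'\<^esub>"
    using add[of "\<zero>\<^bsub>M\<^esub>" "\<zero>\<^bsub>M\<^esub>"] closed[of "\<zero>\<^bsub>M\<^esub>"] by (simp add: M'.add.l_cancel_one')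
  with assms(3,4) show ?thesis
    by (induction J rule: finite_induct) (auto simp: closed add Pi_iff M.finsum_closed)
qed

text \<open>Weight arguments need only the commuting operators coming from the domain, while the
  acting ring may be noncommutative. The instances are the dual space, the distributions, the cyclic
  submodule and its quotients.\<close>

locale weight_module = left_module R M
  for R :: "('r, 'c) ring_scheme" and M :: "('r, 'v, 'e) module_scheme" +
  fixes emb :: "'a::idom \<Rightarrow> 'r"
  assumes emb_closed [simp]: "emb a \<in> carrier R"
    and emb_add: "emb (a + b) = emb a \<oplus>\<^bsub>R\<^esub> emb b"
    and emb_mult: "emb (a * b) = emb a \<otimes>\<^bsub>R\<^esub> emb b"
    and emb_one: "emb 1 = \<one>\<^bsub>R\<^esub>"
begin

lemma emb_smult_closed [simp]: "v \<in> carrier M \<Longrightarrow> emb a \<odot>\<^bsub>M\<^esub> v \<in> carrier M"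
  by (simp add: smult_closed)

lemma emb_smult_commute:
  "v \<in> carrier M \<Longrightarrow> emb a \<odot>\<^bsub>M\<^esub> (emb b \<odot>\<^bsub>M\<^esub> v) = emb b \<odot>\<^bsub>M\<^esub> (emb a \<odot>\<^bsub>M\<^esub> v)"
  by (simp add: smult_assoc[symmetric] emb_mult[symmetric] mult.commute)

lemma emb_smult_eq_self:
  assumes "v \<in> carrier M" "emb (1 - e) \<odot>\<^bsub>M\<^esub> v = \<zero>\<^bsub>M\<^esub>"
  shows "emb e \<odot>\<^bsub>M\<^esub> v = v"
  using smult_l_distr[of "emb (1 - e)" "emb e" v] assms
  by (simp add: emb_add[symmetric] emb_one smult_one)

lemma weight_spaceD: "v \<in> weight_space emb M \<mm> \<Longrightarrow> v \<in> carrier M"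
  by (simp add: weight_space_def)

lemma weight_space_zero: "\<zero>\<^bsub>M\<^esub> \<in> weight_space emb M \<mm>"
  by (simp add: weight_space_def)

lemma weight_space_add:
  assumes "v \<in> weight_space emb M \<mm>" "w \<in> weight_space emb M \<mm>"
  shows "v \<oplus>\<^bsub>M\<^esub> w \<in> weight_space emb M \<mm>"
proof -
  obtain n n' where n: "\<And>k a. n \<le> k \<Longrightarrow> a \<in> ideal_power \<mm> k \<Longrightarrow> emb a \<odot>\<^bsub>M\<^esub> v = \<zero>\<^bsub>M\<^esub>"
    "\<And>k a. n' \<le> k \<Longrightarrow> a \<in> ideal_power \<mm> k \<Longrightarrow> emb a \<odot>\<^bsub>M\<^esub> w = \<zero>\<^bsub>M\<^esub>"
    using assms unfolding weight_space_def by blast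
  then show ?thesis using assms
    by (auto simp: weight_space_def smult_r_distr intro!: exI[of _ "max n n'"])
qed

lemma weight_space_smult:
  "v \<in> weight_space emb M \<mm> \<Longrightarrow> emb a \<odot>\<^bsub>M\<^esub> v \<in> weight_space emb M \<mm>"
  unfolding weight_space_def by (auto simp: emb_smult_commute[of v _ a]) (metis emb_closed smult_zero)

lemma weight_space_subgroup: "additive_subgroup (weight_space emb M \<mm>) M"
proof -
  have "inv\<^bsub>add_monoid M\<^esub> v \<in> weight_space emb M \<mm>" if v: "v \<in> weight_space emb M \<mm>" for v
  proof -
    have "emb (- 1) \<oplus>\<^bsub>R\<^esub> \<one>\<^bsub>R\<^esub> = emb 0" using emb_add[of "- 1" 1] by (simp add: emb_one)
    moreover have "emb 0 = \<zero>\<^bsub>R\<^esub>"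
      using emb_add[of 0 0] emb_closed[of 0] by (simp add: R.add.l_cancel_one')
    ultimately have "emb (- 1) = \<ominus>\<^bsub>R\<^esub> \<one>\<^bsub>R\<^esub>" by (simp add: R.minus_equality)
    then show ?thesis
      using weight_space_smult[OF v, of "- 1"] minus_one_smult[OF weight_spaceD[OF v]] by (simp add: a_inv_def)
  qed
  then show ?thesis
    by (intro additive_subgroup.intro subgroup.intro)
      (auto simp: weight_space_zero weight_space_add weight_spaceD)
qed

lemma weight_space_finsum:
  "finite J \<Longrightarrow> (\<And>i. i \<in> J \<Longrightarrow> u i \<in> weight_space emb M \<mm>) \<Longrightarrow> finsum M u J \<in> weight_space emb M \<mm>"
proof (induction J rule: finite_induct)
  case (insert i J)
  then have "u j \<in> carrier M" if "j \<in> insert i J" for j using weight_spaceD that by blast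
  then have "finsum M u (insert i J) = u i \<oplus>\<^bsub>M\<^esub> finsum M u J"
    using insert.hyps by (intro M.finsum_insert) auto
  then show ?case using insert by (simp add: weight_space_add)
qed (simp add: weight_space_zero)

lemma weight_vectors_exponent:
  assumes "finite J" "\<And>i. i \<in> J \<Longrightarrow> u i \<in> weight_space emb M (f i)"
  obtains N where "\<And>i a. i \<in> J \<Longrightarrow> a \<in> ideal_power (f i) N \<Longrightarrow> emb a \<odot>\<^bsub>M\<^esub> u i = \<zero>\<^bsub>M\<^esub>"
proof -
  have "\<forall>i\<in>J. \<exists>n. \<forall>k\<ge>n. \<forall>a\<in>ideal_power (f i) k. emb a \<odot>\<^bsub>M\<^esub> u i = \<zero>\<^bsub>M\<^esub>"
    using assms(2) by (simp add: weight_space_def)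
  then obtain n where n: "\<And>i. i \<in> J \<Longrightarrow> \<forall>k\<ge>n i. \<forall>a\<in>ideal_power (f i) k. emb a \<odot>\<^bsub>M\<^esub> u i = \<zero>\<^bsub>M\<^esub>"
    by metis
  have "n i \<le> Max (insert 0 (n ` J))" if "i \<in> J" for i using that assms(1) by simp
  then show thesis using n by (intro that[of "Max (insert 0 (n ` J))"]) blast
qed

lemma finsum_separate:
  assumes "finite J" "\<mm> \<in> J" "u \<in> J \<rightarrow> carrier M"
    and "emb (1 - e) \<odot>\<^bsub>M\<^esub> u \<mm> = \<zero>\<^bsub>M\<^esub>" "\<And>\<nn>. \<nn> \<in> J - {\<mm>} \<Longrightarrow> emb e \<odot>\<^bsub>M\<^esub> u \<nn> = \<zero>\<^bsub>M\<^esub>"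
  shows "emb e \<odot>\<^bsub>M\<^esub> finsum M u J = u \<mm>"
proof -
  have "emb e \<odot>\<^bsub>M\<^esub> finsum M u J = finsum M (\<lambda>\<nn>. emb e \<odot>\<^bsub>M\<^esub> u \<nn>) J"
    using assms(1,3) by (intro finsum_hom[OF M.abelian_group_axioms M.abelian_group_axioms])
      (auto simp: smult_r_distr)
  also have "\<dots> = finsum M (\<lambda>\<nn>. if \<mm> = \<nn> then u \<nn> else \<zero>\<^bsub>M\<^esub>) J"
    using assms emb_smult_eq_self[of "u \<mm>" e] by (intro M.finsum_cong') (auto simp: Pi_iff)
  also have "\<dots> = u \<mm>" using assms by (intro M.finsum_singleton)
  finally show ?thesis .
qed

text \<open>Only existence is demanded, because it passes easily to submodules and quotients;
  uniqueness is automatic for distinct maximal ideals.\<close>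

definition weight_decomposable :: "'a set set \<Rightarrow> 'v \<Rightarrow> bool" where
  "weight_decomposable I v \<longleftrightarrow> (\<exists>J u. finite J \<and> J \<subseteq> I \<and>
     (\<forall>\<mm>\<in>J. u \<mm> \<in> weight_space emb M \<mm>) \<and> v = finsum M u J)"

lemma internal_direct_sum_weight_spaces:
  assumes max: "\<And>\<mm>. \<mm> \<in> I \<Longrightarrow> maximalideal \<mm> ring_of_type_algebra"
    and dec: "\<And>v. v \<in> carrier M \<Longrightarrow> weight_decomposable I v"
  shows "internal_direct_sum M I (weight_space emb M)"
  unfolding internal_direct_sum_def
proof (intro conjI ballI weight_space_subgroup)
  fix v assume "v \<in> carrier M"
  let ?P = "\<lambda>u. (\<forall>\<mm>\<in>I. u \<mm> \<in> weight_space emb M \<mm>) \<and> (\<forall>\<mm>. \<mm> \<notin> I \<longrightarrow> u \<mm> = \<zero>\<^bsub>M\<^esub>) \<and>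
    finite {\<mm>. u \<mm> \<noteq> \<zero>\<^bsub>M\<^esub>} \<and> v = finsum M u {\<mm>. u \<mm> \<noteq> \<zero>\<^bsub>M\<^esub>}"
  obtain J w where J: "finite J" "J \<subseteq> I" "\<forall>\<mm>\<in>J. w \<mm> \<in> weight_space emb M \<mm>" "v = finsum M w J"
    using dec[OF \<open>v \<in> carrier M\<close>] by (auto simp: weight_decomposable_def)
  \<comment> \<open>The direct sum condition wants a family on all of \<open>I\<close> with finite
    support, hence zero outside \<open>J\<close>.\<close>
  define u where "u \<mm> = (if \<mm> \<in> J then w \<mm> else \<zero>\<^bsub>M\<^esub>)" for \<mm>
  have supp: "{\<mm>. u \<mm> \<noteq> \<zero>\<^bsub>M\<^esub>} \<subseteq> J" by (auto simp: u_def)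
  have "finsum M u {\<mm>. u \<mm> \<noteq> \<zero>\<^bsub>M\<^esub>} = finsum M w J"
    using J by (intro M.add.finprod_mono_neutral_cong_left) (auto simp: u_def weight_spaceD)
  then have Pu: "?P u"
    using J supp finite_subset[OF supp] by (auto simp: u_def weight_space_zero)
  have unique: "x = y" if x: "?P x" and y: "?P y" for x y
  proof
    fix \<mm>
    have car: "x \<nn> \<in> carrier M \<and> y \<nn> \<in> carrier M" for \<nn>
      using x y weight_spaceD by (cases "\<nn> \<in> I") auto
    show "x \<mm> = y \<mm>"
    proof (cases "\<mm> \<in> I")
      case True
      \<comment> \<open>One index set for both families. It includes \<mm> even when both components
        there vanish, so that the separating element \<open>e\<close> can be built around \<mm>;
        acting on \<open>v\<close>, it returns the component at \<mm> of either family.\<close>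
      define K where "K = insert \<mm> ({\<mm>. x \<mm> \<noteq> \<zero>\<^bsub>M\<^esub>} \<union> {\<mm>. y \<mm> \<noteq> \<zero>\<^bsub>M\<^esub>})"
      have K: "finite K" "K \<subseteq> I" "\<mm> \<in> K" using x y True by (auto simp: K_def)
      have "finsum M z {\<mm>. z \<mm> \<noteq> \<zero>\<^bsub>M\<^esub>} = finsum M z K"
        if "{\<mm>. z \<mm> \<noteq> \<zero>\<^bsub>M\<^esub>} \<subseteq> K" "\<And>\<nn>. z \<nn> \<in> carrier M" for z
        using that K(1) by (intro M.add.finprod_mono_neutral_cong_left) auto
      from this[of x] this[of y] have fx: "v = finsum M x K" and fy: "v = finsum M y K"
        using x y car by (auto simp: K_def)
      obtain N where N: "\<And>\<nn> a. \<nn> \<in> K \<Longrightarrow> a \<in> ideal_power \<nn> N \<Longrightarrow> emb a \<odot>\<^bsub>M\<^esub> x \<nn> = \<zero>\<^bsub>M\<^esub>"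
        using weight_vectors_exponent[OF K(1), of x "\<lambda>\<nn>. \<nn>"] x K(2) by blast
      obtain N' where N': "\<And>\<nn> a. \<nn> \<in> K \<Longrightarrow> a \<in> ideal_power \<nn> N' \<Longrightarrow> emb a \<odot>\<^bsub>M\<^esub> y \<nn> = \<zero>\<^bsub>M\<^esub>"
        using weight_vectors_exponent[OF K(1), of y "\<lambda>\<nn>. \<nn>"] y K(2) by blast
      obtain e where e: "1 - e \<in> ideal_power \<mm> (max N N')"
          "\<And>\<nn>. \<nn> \<in> K - {\<mm>} \<Longrightarrow> e \<in> ideal_power \<nn> (max N N')"
        using maximal_ideals_separate_finite[of \<mm> "K - {\<mm>}" "max N N'"] max K by blast
      have mono: "ideal_power \<nn> (max N N') \<subseteq> ideal_power \<nn> N \<inter> ideal_power \<nn> N'" if "\<nn> \<in> K" for \<nn>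
        using ideal_power_antimono[OF maximalideal_subspace[OF max]] K(2) that
        by (meson Int_greatest max.cobounded1 max.cobounded2 subsetD)
      have "x \<in> K \<rightarrow> carrier M" "y \<in> K \<rightarrow> carrier M" using car by auto
      moreover have "emb (1 - e) \<odot>\<^bsub>M\<^esub> x \<mm> = \<zero>\<^bsub>M\<^esub>" "emb (1 - e) \<odot>\<^bsub>M\<^esub> y \<mm> = \<zero>\<^bsub>M\<^esub>"
        using e(1) mono[OF K(3)] N[OF K(3)] N'[OF K(3)] by blast+
      moreover have "emb e \<odot>\<^bsub>M\<^esub> x \<nn> = \<zero>\<^bsub>M\<^esub>" "emb e \<odot>\<^bsub>M\<^esub> y \<nn> = \<zero>\<^bsub>M\<^esub>" if "\<nn> \<in> K - {\<mm>}" for \<nn>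
        using e(2)[OF that] mono[of \<nn>] N[of \<nn>] N'[of \<nn>] that by blast+
      ultimately have "emb e \<odot>\<^bsub>M\<^esub> finsum M x K = x \<mm>" "emb e \<odot>\<^bsub>M\<^esub> finsum M y K = y \<mm>"
        by (intro finsum_separate[OF K(1,3)]; simp)+
      then show ?thesis using fx fy by simp
    qed (use x y in simp)
  qed
  show "\<exists>!u. ?P u" by (rule ex1I[of ?P, OF Pu unique[OF _ Pu]])
qed

text \<open>Elements of \<open>\<Lambda>\<close> near 1 at \<open>\<mm>\<close> and near 0 at the other weights act as projections.\<close>

lemma weight_projection:
  assumes max: "\<And>\<nn>. \<nn> \<in> I \<Longrightarrow> maximalideal \<nn> ring_of_type_algebra"
    and "weight_decomposable I v" and \<mm>: "\<mm> \<in> I" "\<chi> \<in> weight_space emb M \<mm>"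
  obtains e where "emb e \<odot>\<^bsub>M\<^esub> v \<in> weight_space emb M \<mm>" "emb e \<odot>\<^bsub>M\<^esub> \<chi> = \<chi>"
proof -
  obtain J u where J: "finite J" "J \<subseteq> I" "\<forall>\<mm>\<in>J. u \<mm> \<in> weight_space emb M \<mm>" "v = finsum M u J"
    using assms(2) by (auto simp: weight_decomposable_def)
  obtain N where N: "\<And>\<nn> a. \<nn> \<in> J \<Longrightarrow> a \<in> ideal_power \<nn> N \<Longrightarrow> emb a \<odot>\<^bsub>M\<^esub> u \<nn> = \<zero>\<^bsub>M\<^esub>"
    using weight_vectors_exponent[OF J(1), of u "\<lambda>\<nn>. \<nn>"] J(3) by blast
  obtain N' where N': "\<And>a. a \<in> ideal_power \<mm> N' \<Longrightarrow> emb a \<odot>\<^bsub>M\<^esub> \<chi> = \<zero>\<^bsub>M\<^esub>"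
    using \<mm>(2) unfolding weight_space_def by blast
  obtain e where e: "1 - e \<in> ideal_power \<mm> (max N N')"
      "\<And>\<nn>. \<nn> \<in> J - {\<mm>} \<Longrightarrow> e \<in> ideal_power \<nn> (max N N')"
    using maximal_ideals_separate_finite[of \<mm> "J - {\<mm>}" "max N N'"] max J \<mm>(1) by blast
  have mono: "ideal_power \<nn> (max N N') \<subseteq> ideal_power \<nn> N \<inter> ideal_power \<nn> N'" if "\<nn> \<in> I" for \<nn>
    using ideal_power_antimono[OF maximalideal_subspace[OF max[OF that]]]
    by (meson Int_greatest max.cobounded1 max.cobounded2)
  have "emb e \<odot>\<^bsub>M\<^esub> v = finsum M (\<lambda>\<nn>. emb e \<odot>\<^bsub>M\<^esub> u \<nn>) J"
    unfolding J(4) using J(1,3) weight_spaceD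
    by (intro finsum_hom[OF M.abelian_group_axioms M.abelian_group_axioms]) (auto simp: smult_r_distr)
  also have "\<dots> \<in> weight_space emb M \<mm>"
  proof (rule weight_space_finsum[OF J(1)])
    fix \<nn> assume \<nn>: "\<nn> \<in> J"
    show "emb e \<odot>\<^bsub>M\<^esub> u \<nn> \<in> weight_space emb M \<mm>"
    proof (cases "\<nn> = \<mm>")
      case True
      then show ?thesis using J(3) \<nn> weight_space_smult by blast
    next
      case False
      then have "emb e \<odot>\<^bsub>M\<^esub> u \<nn> = \<zero>\<^bsub>M\<^esub>" using N[OF \<nn>] e(2) mono J(2) \<nn> by blast
      then show ?thesis using weight_space_zero by simp
    qed
  qed
  finally have "emb e \<odot>\<^bsub>M\<^esub> v \<in> weight_space emb M \<mm>" .
  moreover have "emb e \<odot>\<^bsub>M\<^esub> \<chi> = \<chi>"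
    using e(1) mono[OF \<mm>(1)] N' by (intro emb_smult_eq_self weight_spaceD[OF \<mm>(2)]) blast
  ultimately show thesis by (rule that)
qed

lemma weight_module_submodule: "submodule N R M \<Longrightarrow> weight_module R (M\<lparr>carrier := N\<rparr>) emb"
  by (intro weight_module.intro submodule_left_module weight_module_axioms.intro)
    (simp_all add: emb_add emb_mult emb_one)

lemma weight_space_submodule:
  "N \<subseteq> carrier M \<Longrightarrow> weight_space emb (M\<lparr>carrier := N\<rparr>) \<mm> = weight_space emb M \<mm> \<inter> N"
  by (auto simp: weight_space_def)

text \<open>Each component of \<open>v\<close> is the image of \<open>v\<close> under a separating
  element of the domain, so it already lies in the submodule.\<close>

lemma weight_decomposable_submodule:
  assumes max: "\<And>\<mm>. \<mm> \<in> I \<Longrightarrow> maximalideal \<mm> ring_of_type_algebra"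
    and N: "submodule N R M" and v: "v \<in> N" "weight_decomposable I v"
  shows "weight_module.weight_decomposable (M\<lparr>carrier := N\<rparr>) emb I v"
proof -
  have sub: "N \<subseteq> carrier M" and smult: "\<And>r v. r \<in> carrier R \<Longrightarrow> v \<in> N \<Longrightarrow> r \<odot>\<^bsub>M\<^esub> v \<in> N"
    using N by (auto simp: submodule_iff)
  interpret N: weight_module R "M\<lparr>carrier := N\<rparr>" emb by (rule weight_module_submodule[OF N])
  obtain J u where J: "finite J" "J \<subseteq> I" "\<forall>\<mm>\<in>J. u \<mm> \<in> weight_space emb M \<mm>" "v = finsum M u J"
    using v(2) by (auto simp: weight_decomposable_def)
  obtain n where n: "\<And>\<nn> a. \<nn> \<in> J \<Longrightarrow> a \<in> ideal_power \<nn> n \<Longrightarrow> emb a \<odot>\<^bsub>M\<^esub> u \<nn> = \<zero>\<^bsub>M\<^esub>"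
    using weight_vectors_exponent[OF J(1), of u "\<lambda>\<nn>. \<nn>"] J(3) by blast
  have uN: "u \<mm> \<in> N" if \<mm>: "\<mm> \<in> J" for \<mm>
  proof -
    obtain e where e: "1 - e \<in> ideal_power \<mm> n" "\<And>\<nn>. \<nn> \<in> J - {\<mm>} \<Longrightarrow> e \<in> ideal_power \<nn> n"
      using maximal_ideals_separate_finite[of \<mm> "J - {\<mm>}" n] max J \<mm> by blast
    have "emb e \<odot>\<^bsub>M\<^esub> v = u \<mm>"
      unfolding J(4) using e n J(1,3) \<mm> weight_spaceD by (intro finsum_separate) blast+
    then show ?thesis using smult[OF emb_closed v(1), of e] by simp
  qed
  have "finsum (M\<lparr>carrier := N\<rparr>) u J = finsum M u J"
    using uN sub J(1) N.M.abelian_group_axioms M.abelian_group_axioms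
    by (intro finsum_hom[where h = "\<lambda>v. v"]) auto
  then show ?thesis
    unfolding N.weight_decomposable_def weight_space_submodule[OF sub]
    using J uN by (intro exI[of _ J] exI[of _ u]) simp
qed

lemma weight_module_quotient: "submodule N R M \<Longrightarrow> weight_module R (quotient_module M N) emb"
  by (intro weight_module.intro weight_module_axioms.intro
      submodule_of_left_module.quotient_left_module submodule_of_left_module.intro left_module_axioms)
    (simp_all add: emb_add emb_mult emb_one)

lemma weight_space_quotient:
  assumes "submodule N R M" "v \<in> weight_space emb M \<mm>"
  shows "N +>\<^bsub>M\<^esub> v \<in> weight_space emb (quotient_module M N) \<mm>"
proof -
  interpret N: submodule_of_left_module R M N
    by (rule submodule_of_left_module[OF assms(1)])
  have zero: "N +>\<^bsub>M\<^esub> \<zero>\<^bsub>M\<^esub> = N"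
    using N.coset_zero_iff[of "\<zero>\<^bsub>M\<^esub>"] N.N.one_closed by simp
  obtain n where v: "v \<in> carrier M"
    and n: "\<And>k a. n \<le> k \<Longrightarrow> a \<in> ideal_power \<mm> k \<Longrightarrow> emb a \<odot>\<^bsub>M\<^esub> v = \<zero>\<^bsub>M\<^esub>"
    using assms(2) unfolding weight_space_def by blast
  have "emb a \<odot>\<^bsub>quotient_module M N\<^esub> (N +>\<^bsub>M\<^esub> v) = N" if "n \<le> k" "a \<in> ideal_power \<mm> k" for k a
    using n[OF that] v by (simp add: N.smult_quotient zero)
  then show ?thesis
    using v unfolding weight_space_def by (auto simp: N.carrier_quotient N.zero_quotient)
qed

lemma weight_decomposable_quotient:
  assumes N: "submodule N R M" and v: "weight_decomposable I v"
  shows "weight_module.weight_decomposable (quotient_module M N) emb I (N +>\<^bsub>M\<^esub> v)"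
proof -
  interpret N: submodule_of_left_module R M N
    by (rule submodule_of_left_module[OF N])
  interpret Q: weight_module R "quotient_module M N" emb by (rule weight_module_quotient[OF N])
  obtain J u where J: "finite J" "J \<subseteq> I" "\<forall>\<mm>\<in>J. u \<mm> \<in> weight_space emb M \<mm>" "v = finsum M u J"
    using v by (auto simp: weight_decomposable_def)
  have "N +>\<^bsub>M\<^esub> v = finsum (quotient_module M N) (\<lambda>\<mm>. N +>\<^bsub>M\<^esub> u \<mm>) J"
    unfolding J(4) using J(1,3) weight_spaceD
    by (intro finsum_hom[OF M.abelian_group_axioms Q.M.abelian_group_axioms])
      (auto simp: N.carrier_quotient N.add_quotient)
  then show ?thesis
    unfolding Q.weight_decomposable_def using J weight_space_quotient[OF N]
    by (intro exI[of _ J] exI[of _ "\<lambda>\<mm>. N +>\<^bsub>M\<^esub> u \<mm>"]) auto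
qed

end

text \<open>
  A submodule contains the projections to the weight spaces of its elements. Hence if the sum of two
  proper submodules contained \<open>\<chi>\<close>, then one of them would meet the weight space of \<open>\<mm>\<close>
  and so contain \<open>\<chi>\<close> itself.
\<close>

locale cyclic_weight_module = weight_module R M emb
  for R :: "('r, 'c) ring_scheme" and M :: "('r, 'v, 'e) module_scheme" and emb :: "'a::idom \<Rightarrow> 'r" +
  fixes I :: "'a set set" and \<mm> :: "'a set" and \<chi> :: 'v
  assumes maximal: "\<nn> \<in> I \<Longrightarrow> maximalideal \<nn> ring_of_type_algebra"
    and decomposable: "v \<in> carrier M \<Longrightarrow> weight_decomposable I v"
    and weight: "\<mm> \<in> I" "\<chi> \<in> weight_space emb M \<mm>" "\<chi> \<noteq> \<zero>\<^bsub>M\<^esub>"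
    and generates: "v \<in> carrier M \<Longrightarrow> \<exists>r\<in>carrier R. v = r \<odot>\<^bsub>M\<^esub> \<chi>"
    and socle: "\<eta> \<in> weight_space emb M \<mm> \<Longrightarrow> \<eta> \<noteq> \<zero>\<^bsub>M\<^esub> \<Longrightarrow> \<exists>a. emb a \<odot>\<^bsub>M\<^esub> \<eta> = \<chi>"
begin

text \<open>Since \<chi> generates, these are the vectors whose cyclic submodule is proper, that is,
  the union of all proper submodules. In this form stability under the ring is immediate, and only
  additivity needs weights.\<close>

definition radical :: "'v set" where
  "radical = {v \<in> carrier M. \<forall>r\<in>carrier R. r \<odot>\<^bsub>M\<^esub> v \<noteq> \<chi>}"

lemma \<chi>_carrier [simp]: "\<chi> \<in> carrier M"
  using weight(2) by (rule weight_spaceD)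

lemma radical_smult: "r \<in> carrier R \<Longrightarrow> v \<in> radical \<Longrightarrow> r \<odot>\<^bsub>M\<^esub> v \<in> radical"
  unfolding radical_def by (auto simp: smult_closed) (metis R.m_closed smult_assoc)

lemma radical_add:
  assumes "v \<in> radical" "w \<in> radical"
  shows "v \<oplus>\<^bsub>M\<^esub> w \<noteq> \<chi>"
proof
  assume eq: "v \<oplus>\<^bsub>M\<^esub> w = \<chi>"
  have car: "v \<in> carrier M" "w \<in> carrier M" using assms unfolding radical_def by blast+
  obtain e where e: "emb e \<odot>\<^bsub>M\<^esub> v \<in> weight_space emb M \<mm>" "emb e \<odot>\<^bsub>M\<^esub> \<chi> = \<chi>"
    using weight_projection[OF maximal decomposable[OF car(1)] weight(1,2)] by blast
  obtain f where f: "emb f \<odot>\<^bsub>M\<^esub> w \<in> weight_space emb M \<mm>" "emb f \<odot>\<^bsub>M\<^esub> \<chi> = \<chi>"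
    using weight_projection[OF maximal decomposable[OF car(2)] weight(1,2)] by blast
  \<comment> \<open>Projecting with both \<open>e\<close> and \<open>f\<close> puts both summands
    into the weight space of \<mm>, as the two operators commute, and still fixes \<chi>.\<close>
  let ?v = "emb f \<odot>\<^bsub>M\<^esub> (emb e \<odot>\<^bsub>M\<^esub> v)" and ?w = "emb f \<odot>\<^bsub>M\<^esub> (emb e \<odot>\<^bsub>M\<^esub> w)"
  have "\<chi> = emb f \<odot>\<^bsub>M\<^esub> (emb e \<odot>\<^bsub>M\<^esub> (v \<oplus>\<^bsub>M\<^esub> w))" using e f eq by simp
  then have sum: "\<chi> = ?v \<oplus>\<^bsub>M\<^esub> ?w" using car by (simp add: smult_r_distr)
  have zero: "x = \<zero>\<^bsub>M\<^esub>" if "x \<in> weight_space emb M \<mm>" "x \<in> radical" for x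
    using socle[OF that(1)] that(2) emb_closed by (auto simp: radical_def)
  have "?v = \<zero>\<^bsub>M\<^esub>"
    using weight_space_smult[OF e(1)] assms(1) by (intro zero radical_smult) auto
  moreover have "?w = \<zero>\<^bsub>M\<^esub>"
    using weight_space_smult[OF f(1), of e] assms(2) emb_smult_commute[OF car(2), of e f]
    by (intro zero radical_smult) auto
  ultimately show False using sum weight(3) by simp
qed

lemma radical_submodule: "submodule radical R M"
proof -
  have "\<zero>\<^bsub>M\<^esub> \<in> radical" using weight(3) by (auto simp: radical_def)
  moreover have "v \<oplus>\<^bsub>M\<^esub> w \<in> radical" if "v \<in> radical" "w \<in> radical" for v w
  proof -
    have "r \<odot>\<^bsub>M\<^esub> v \<oplus>\<^bsub>M\<^esub> r \<odot>\<^bsub>M\<^esub> w \<noteq> \<chi>" if "r \<in> carrier R" for r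
      using that \<open>v \<in> radical\<close> \<open>w \<in> radical\<close> by (intro radical_add radical_smult)
    then show ?thesis using that by (auto simp: radical_def smult_r_distr)
  qed
  ultimately show ?thesis
    unfolding submodule_iff using radical_smult by (auto simp: radical_def)
qed

lemma generator_notin_radical: "\<chi> \<notin> radical"
  unfolding radical_def using smult_one[of \<chi>] R.one_closed by auto

lemma submodule_subset_radical:
  assumes "submodule N R M" "\<chi> \<notin> N"
  shows "N \<subseteq> radical"
  using assms unfolding submodule_iff radical_def by blast

lemma submodule_eq_carrier:
  assumes "submodule N R M" "\<chi> \<in> N"
  shows "N = carrier M"
  using assms generates unfolding submodule_iff by blast

text \<open>The preimage of a submodule of the quotient either contains the generator \<chi>, and is
  everything, or lies in \<open>radical\<close>.\<close>

lemma simple_quotient_radical: "simple_module R (quotient_module M radical)"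
proof -
  interpret N: submodule_of_left_module R M radical
    by (rule submodule_of_left_module[OF radical_submodule])
  have "radical +>\<^bsub>M\<^esub> \<chi> \<noteq> radical" using N.coset_zero_iff[of \<chi>] generator_notin_radical by simp
  then have "carrier N.Q \<noteq> {\<zero>\<^bsub>N.Q\<^esub>}" by (auto simp: N.carrier_quotient N.zero_quotient)
  moreover have "P = {\<zero>\<^bsub>N.Q\<^esub>} \<or> P = carrier N.Q" if P: "submodule P R N.Q" for P
  proof -
    let ?P = "{v \<in> carrier M. radical +>\<^bsub>M\<^esub> v \<in> P}"
    have sub: "submodule ?P R M" by (rule N.preimage_submodule[OF P])
    have P': "P \<subseteq> carrier N.Q" "\<zero>\<^bsub>N.Q\<^esub> \<in> P"
      using P by (auto simp: left_module.submodule_iff[OF N.quotient_left_module])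
    show ?thesis
    proof (cases "\<chi> \<in> ?P")
      case True
      then have "?P = carrier M" by (rule submodule_eq_carrier[OF sub])
      then have "carrier N.Q \<subseteq> P" by (auto simp: N.carrier_quotient)
      then show ?thesis using P'(1) by blast
    next
      case False
      then have "?P \<subseteq> radical" by (rule submodule_subset_radical[OF sub])
      have "x = \<zero>\<^bsub>N.Q\<^esub>" if x: "x \<in> P" for x
      proof -
        obtain v where "v \<in> carrier M" "x = radical +>\<^bsub>M\<^esub> v"
          using x P'(1) unfolding N.carrier_quotient by blast
        then show ?thesis
          using \<open>?P \<subseteq> radical\<close> x N.coset_zero_iff[of v] by (auto simp: N.zero_quotient)
      qed
      then show ?thesis using P'(2) by blast
    qed
  qed
  ultimately show ?thesis using N.quotient_left_module by (simp add: simple_module_def)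
qed

text \<open>\<open>N\<close> lies in \<open>radical\<close>, whose image in the simple quotient is a
  submodule. If that image is proper it is zero, which gives the reverse inclusion.\<close>

lemma simple_quotient_eq_radical:
  assumes N: "submodule N R M" and simple: "simple_module R (quotient_module M N)"
  shows "N = radical"
proof -
  interpret N: submodule_of_left_module R M N
    by (rule submodule_of_left_module[OF N])
  have "\<chi> \<notin> N"
  proof
    assume "\<chi> \<in> N"
    then have "N = carrier M" by (rule submodule_eq_carrier[OF N])
    then have "N +>\<^bsub>M\<^esub> v = N" if "v \<in> carrier M" for v
      using N.coset_zero_iff[OF that] that by blast
    then have "carrier N.Q = {\<zero>\<^bsub>N.Q\<^esub>}"
      unfolding N.carrier_quotient N.zero_quotient using M.zero_closed by blast
    then show False using simple by (simp add: simple_module_def)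
  qed
  then have le: "N \<subseteq> radical" by (rule submodule_subset_radical[OF N])
  let ?P = "(\<lambda>v. N +>\<^bsub>M\<^esub> v) ` radical"
  have "?P \<noteq> carrier N.Q"
  proof
    assume "?P = carrier N.Q"
    then have "N +>\<^bsub>M\<^esub> \<chi> \<in> ?P" by (auto simp: N.carrier_quotient)
    then obtain v where v: "v \<in> radical" "N +>\<^bsub>M\<^esub> \<chi> = N +>\<^bsub>M\<^esub> v" by blast
    then have "v \<in> carrier M" "\<chi> \<ominus>\<^bsub>M\<^esub> v \<in> radical"
      using le N.coset_eq_iff[of \<chi> v] by (auto simp: radical_def)
    \<comment> \<open>Otherwise \<chi> would be the sum of \<open>v\<close> and
      \<open>\<chi> - v\<close>, both in \<open>radical\<close>.\<close>
    then show False
      using radical_add[OF v(1), of "\<chi> \<ominus>\<^bsub>M\<^esub> v"]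
      by (simp add: M.minus_eq M.a_lcomm[of v \<chi>] M.r_neg)
  qed
  then have "?P = {N}"
    using simple N.image_submodule[OF radical_submodule] by (auto simp: simple_module_def N.zero_quotient)
  then have "N +>\<^bsub>M\<^esub> v = N" if "v \<in> radical" for v using that by blast
  then have "radical \<subseteq> N"
    using N.coset_zero_iff unfolding radical_def by blast
  then show ?thesis using le by blast
qed

lemma unique_simple_quotient: "\<exists>!N. submodule N R M \<and> simple_module R (quotient_module M N)"
  using radical_submodule simple_quotient_radical simple_quotient_eq_radical by (intro ex1I) auto

lemma simple_quotient_weight_space:
  assumes N: "submodule N R M" and simple: "simple_module R (quotient_module M N)"
  shows "weight_space emb (quotient_module M N) \<mm> \<noteq> {\<zero>\<^bsub>quotient_module M N\<^esub>}"
proof -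
  interpret N: submodule_of_left_module R M N
    by (rule submodule_of_left_module[OF N])
  have "N +>\<^bsub>M\<^esub> \<chi> \<noteq> N"
    using N.coset_zero_iff[of \<chi>] simple_quotient_eq_radical[OF assms] generator_notin_radical by simp
  then show ?thesis using weight_space_quotient[OF N weight(2)] by (auto simp: N.zero_quotient)
qed

end

section \<open>Distributions as a module over the opposite of a Galois order\<close>

lemma (in weight_module) harish_chandraI:
  assumes "\<And>v. v \<in> carrier M \<Longrightarrow> weight_decomposable (cofinite_maximal_ideals s) v"
  shows "harish_chandra s emb R M"
  unfolding harish_chandra_def
  using internal_direct_sum_weight_spaces[OF _ assms] left_module_axioms
  by (simp add: cofinite_maximal_ideals_def)

lemma opposite_algebra_simps [simp]:
  "carrier (opposite_algebra F) = F"
  "\<zero>\<^bsub>opposite_algebra F\<^esub> = 0"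
  "\<one>\<^bsub>opposite_algebra F\<^esub> = 1"
  "Z \<oplus>\<^bsub>opposite_algebra F\<^esub> Y = Z + Y"
  "Z \<otimes>\<^bsub>opposite_algebra F\<^esub> Y = Y * Z"
  by (simp_all add: opposite_algebra_def ring_of_type_algebra_def)

lemma (in k_algebra) ring_opposite_algebra:
  assumes "subalgebra scale F"
  shows "ring (opposite_algebra F)"
proof (rule ringI)
  have F: "subspace F" "1 \<in> F" "\<And>x y. x \<in> F \<Longrightarrow> y \<in> F \<Longrightarrow> x * y \<in> F"
    using assms by (auto simp: subalgebra_def)
  show "abelian_group (opposite_algebra F)"
  proof (rule abelian_groupI)
    fix x assume "x \<in> carrier (opposite_algebra F)"
    then show "\<exists>y\<in>carrier (opposite_algebra F). y \<oplus>\<^bsub>opposite_algebra F\<^esub> x = \<zero>\<^bsub>opposite_algebra F\<^esub>"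
      using subspace_neg[OF F(1), of x] by (intro bexI[of _ "- x"]) auto
  qed (use subspace_0[OF F(1)] subspace_add[OF F(1)] in \<open>auto simp: ac_simps\<close>)
  show "Group.monoid (opposite_algebra F)"
    by (rule monoidI) (use F in \<open>auto simp: mult.assoc\<close>)
qed (auto simp: algebra_simps)

locale galois_order_setting =
  hopf_galois_setting sH \<Delta> \<epsilon> S H s\<Lambda> act actL sS \<iota>L \<iota>H
  for sH :: "'k::field \<Rightarrow> 'h::ring_1 \<Rightarrow> 'h" and \<Delta> \<epsilon> S
    and H :: "'h set"
    and s\<Lambda> :: "'k \<Rightarrow> 'l::idom \<Rightarrow> 'l" and act
    and actL :: "'h \<Rightarrow> 'l fract \<Rightarrow> 'l fract"
    and sS :: "'k \<Rightarrow> 's::ring_1 \<Rightarrow> 's" and \<iota>L \<iota>H +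
  fixes F :: "'s set"
  assumes galois_order: "galois_order actL H s\<Lambda> sS \<iota>L \<iota>H F"
begin

sublocale dist: noetherian_algebra s\<Lambda>
  by (intro noetherian_algebra.intro noetherian_algebra_axioms.intro \<Lambda>.A.k_algebra_axioms noetherian)

abbreviation "emb \<equiv> \<lambda>a. \<iota>L (to_fract a)"
abbreviation "Fop \<equiv> opposite_algebra F"
abbreviation "Dual \<equiv> dual_module s\<Lambda> actL \<iota>L \<iota>H"
abbreviation "Dist \<equiv> Dual\<lparr>carrier := distributions s\<Lambda>\<rparr>"

lemma subalgebra_F: "subalgebra sS F"
  and emb_in_F: "emb a \<in> F"
  and hat_stable: "Z \<in> F \<Longrightarrow> smash_act Z ` range to_fract \<subseteq> range to_fract"
  using galois_order by (auto simp: galois_order_def smash_hat_eq)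

lemma F_closed: "1 \<in> F" "Z \<in> F \<Longrightarrow> Y \<in> F \<Longrightarrow> Z + Y \<in> F" "Z \<in> F \<Longrightarrow> Y \<in> F \<Longrightarrow> Z * Y \<in> F"
  using subalgebra_F smash.subspace_add by (auto simp: subalgebra_def)

text \<open>Names the operator on \<Lambda> hidden in the scalar multiplication of
  \<open>dual_module\<close>; for elements of \<open>F\<close> the description denotes, since they
  preserve \<Lambda>.\<close>

definition order_act :: "'s \<Rightarrow> 'l \<Rightarrow> 'l" where
  "order_act Z a = (THE b. to_fract b = smash_hat s\<Lambda> actL \<iota>L \<iota>H Z (to_fract a))"

lemma to_fract_order_act:
  assumes "Z \<in> F"
  shows "to_fract (order_act Z a) = smash_act Z (to_fract a)"
proof -
  obtain b where "to_fract b = smash_act Z (to_fract a)"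
    using hat_stable[OF assms] by (metis image_subset_iff rangeE rangeI)
  then show ?thesis unfolding order_act_def smash_hat_eq by (rule theI) (metis to_fract_eq_iff \<open>to_fract b = _\<close>)
qed

lemma order_act_eqI: "Z \<in> F \<Longrightarrow> smash_act Z (to_fract a) = to_fract b \<Longrightarrow> order_act Z a = b"
  using to_fract_order_act[of Z a] by simp

lemma fract_scale_to_fract: "fract_scale s\<Lambda> c (to_fract a) = to_fract (s\<Lambda> c a)"
  using \<Lambda>.A.scale_mult_left[of c 1 a] by (simp add: fract_scale_def)

lemma order_act_add: "Z \<in> F \<Longrightarrow> order_act Z (a + b) = order_act Z a + order_act Z b"
  by (rule order_act_eqI) (simp_all add: smash_act_add_right to_fract_order_act)

lemma order_act_scale: "Z \<in> F \<Longrightarrow> order_act Z (s\<Lambda> c a) = s\<Lambda> c (order_act Z a)"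
  by (rule order_act_eqI)
    (simp_all add: fract_scale_to_fract[symmetric] smash_act_scale_right to_fract_order_act)

lemma order_act_add_left:
  "Z \<in> F \<Longrightarrow> Y \<in> F \<Longrightarrow> order_act (Z + Y) a = order_act Z a + order_act Y a"
  by (rule order_act_eqI) (simp_all add: F_closed smash_act_add to_fract_order_act)

lemma order_act_mult:
  "Z \<in> F \<Longrightarrow> Y \<in> F \<Longrightarrow> order_act (Z * Y) a = order_act Z (order_act Y a)"
  by (rule order_act_eqI) (simp_all add: F_closed smash_act_mult to_fract_order_act)

lemma order_act_emb: "order_act (emb a) b = a * b"
  by (rule order_act_eqI) (simp_all add: emb_in_F smash_act_emb)

lemma order_act_one: "order_act 1 b = b"
  using order_act_emb[of 1 b] by (simp add: emb_A_one)

lemma Dual_simps [simp]: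
  "carrier Dual = dual_space s\<Lambda>"
  "\<zero>\<^bsub>Dual\<^esub> = 0"
  "\<xi> \<oplus>\<^bsub>Dual\<^esub> \<eta> = \<xi> + \<eta>"
  "Z \<odot>\<^bsub>Dual\<^esub> \<xi> = (\<lambda>a. \<xi> (order_act Z a))"
  by (simp_all add: dual_module_def order_act_def fun_eq_iff)

lemma dual_order_act:
  "Z \<in> F \<Longrightarrow> \<xi> \<in> dual_space s\<Lambda> \<Longrightarrow> (\<lambda>a. \<xi> (order_act Z a)) \<in> dual_space s\<Lambda>"
  by (simp add: dist.dual_iff order_act_add order_act_scale)

text \<open>Precomposition reverses products, which the reversed multiplication of
  \<open>Fop\<close> compensates.\<close>

lemma left_module_Dual: "left_module Fop Dual"
proof -
  have "abelian_group Dual"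
  proof (rule abelian_groupI)
    fix \<xi> assume "\<xi> \<in> carrier Dual"
    then have "- \<xi> \<in> dual_space s\<Lambda>" by (simp add: dist.dual_iff)
    then show "\<exists>\<eta>\<in>carrier Dual. \<eta> \<oplus>\<^bsub>Dual\<^esub> \<xi> = \<zero>\<^bsub>Dual\<^esub>"
      by (intro bexI[of _ "- \<xi>"]) auto
  qed (auto simp: dist.dual_add dist.dual_0 add.assoc add.commute)
  moreover have "\<xi> (a + b) = \<xi> a + \<xi> b" if "\<xi> \<in> dual_space s\<Lambda>" for \<xi> a b
    using that by (simp add: dist.dual_iff)
  moreover have "ring Fop" by (rule smash.ring_opposite_algebra[OF subalgebra_F])
  ultimately show ?thesis
    by (intro left_module.intro left_module_axioms.intro)
      (auto simp: dual_order_act order_act_add_left order_act_mult order_act_one fun_eq_iff)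
qed

sublocale Dual: weight_module Fop Dual emb
  using left_module_Dual
  by (intro weight_module.intro weight_module_axioms.intro)
    (simp_all add: emb_in_F emb_A_add emb_A_mult[symmetric] emb_A_one mult.commute)

lemma emb_smult: "emb a \<odot>\<^bsub>Dual\<^esub> \<xi> = translate \<xi> a"
  by (simp add: order_act_emb translate_def)

text \<open>The maximal ideals supporting the new functional are never computed; they are produced
  by \<open>finite_translates_distribution\<close>.\<close>

lemma distributions_order_act:
  assumes "Z \<in> F" "\<xi> \<in> distributions s\<Lambda>"
  shows "(\<lambda>a. \<xi> (order_act Z a)) \<in> distributions s\<Lambda>"
proof -
  have \<xi>: "\<xi> \<in> dual_space s\<Lambda>" "dist.finite_translates \<xi>"
    using assms(2) dist.distributions_subset_dual dist.distributions_finite_translates by blast+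
  obtain E where "finite E"
      "\<And>a. (\<lambda>b. smash_act Z (to_fract (a * b))) \<in> module.span (\<lambda>r f b. to_fract r * f b) E"
    using smash_act_translates by blast
  then have "dist.finite_translates (\<lambda>a. \<xi> (order_act Z a))"
    by (intro dist.finite_translates_comp[OF \<xi>]) (simp_all only: to_fract_order_act[OF assms(1)])
  then show ?thesis
    by (rule dist.finite_translates_distribution[OF dual_order_act[OF assms(1) \<xi>(1)]])
qed

lemma submodule_distributions: "submodule (distributions s\<Lambda>) Fop Dual"
  unfolding Dual.submodule_iff
  using dist.distributions_subset_dual dist.distributions_0 dist.distributions_add distributions_order_act
  by simp

sublocale Dist: weight_module Fop Dist emb
  by (rule Dual.weight_module_submodule[OF submodule_distributions])

text \<open>A power of \<mm> is an ideal, so \<xi> vanishes on it exactly when every translate of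
  \<xi> by one of its elements is zero.\<close>

lemma weight_space_Dual:
  assumes "module.subspace (*) \<mm>"
  shows "weight_space emb Dual \<mm> = dist_at s\<Lambda> \<mm>"
proof -
  have "(\<forall>a\<in>ideal_power \<mm> n. translate \<xi> a = 0) \<longleftrightarrow> (\<forall>a\<in>ideal_power \<mm> n. \<xi> a = 0)" for \<xi> :: "'l \<Rightarrow> 'k" and n
  proof safe
    fix a assume a: "\<forall>a\<in>ideal_power \<mm> n. \<xi> a = 0" "a \<in> ideal_power \<mm> n"
    have "\<xi> (a * b) = 0" for b
      using a dist.ring.subspace_scale[OF subspace_ideal_power[OF assms] a(2), of b]
      by (simp add: mult.commute)
    then show "translate \<xi> a = 0" by (simp add: translate_def fun_eq_iff)
  qed (blast intro: translate_eq_0D)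
  then show ?thesis
    unfolding weight_space_def dist_at_def emb_smult unfolding Dual_simps by (simp only:)
qed

text \<open>Finite codimension ensures that \<open>dist_at\<close> at \<mm> is contained in the
  distributions, so the intersection with them loses nothing.\<close>

lemma weight_space_Dist:
  assumes "\<mm> \<in> cofinite_maximal_ideals s\<Lambda>"
  shows "weight_space emb Dist \<mm> = dist_at s\<Lambda> \<mm>"
proof -
  have "weight_space emb Dist \<mm> = weight_space emb Dual \<mm> \<inter> distributions s\<Lambda>"
    using dist.distributions_subset_dual by (intro Dual.weight_space_submodule) simp
  then show ?thesis
    using weight_space_Dual[OF dist.cofinite_maximal_subspace[OF assms]]
      dist.dist_at_subset_distributions[OF assms] by blast
qed

lemma finsum_Dual: "finite J \<Longrightarrow> (\<And>i. i \<in> J \<Longrightarrow> u i \<in> dual_space s\<Lambda>) \<Longrightarrow> finsum Dual u J = (\<Sum>i\<in>J. u i)"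
  by (induction J rule: finite_induct) (simp_all add: Pi_iff)

lemma Dist_decomposable:
  assumes "\<xi> \<in> distributions s\<Lambda>"
  shows "Dist.weight_decomposable (cofinite_maximal_ideals s\<Lambda>) \<xi>"
proof (rule Dual.weight_decomposable_submodule[OF _ submodule_distributions assms])
  show "maximalideal \<mm> ring_of_type_algebra" if "\<mm> \<in> cofinite_maximal_ideals s\<Lambda>" for \<mm>
    using that by (simp add: cofinite_maximal_ideals_def)
  obtain J u where J: "finite J" "J \<subseteq> cofinite_maximal_ideals s\<Lambda>"
      "\<forall>\<mm>\<in>J. u \<mm> \<in> dist_at s\<Lambda> \<mm>" "\<xi> = (\<Sum>\<mm>\<in>J. u \<mm>)"
    using assms by (auto simp: dist.distributions_iff)
  have "\<xi> = finsum Dual u J"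
    unfolding J(4) using J(1,3) by (intro finsum_Dual[symmetric]) (auto simp: dist_at_def)
  moreover have "\<forall>\<mm>\<in>J. u \<mm> \<in> weight_space emb Dual \<mm>"
    using J(2,3) weight_space_Dual[OF dist.cofinite_maximal_subspace] by blast
  ultimately show "Dual.weight_decomposable (cofinite_maximal_ideals s\<Lambda>) \<xi>"
    unfolding Dual.weight_decomposable_def using J(1,2) by blast
qed

lemma harish_chandra_Dist: "harish_chandra s\<Lambda> emb Fop Dist"
  by (rule Dist.harish_chandraI) (simp add: Dist_decomposable)

abbreviation "cyclic \<chi> \<equiv> Dist\<lparr>carrier := cyclic_submodule Fop Dist \<chi>\<rparr>"

text \<open>Weight spaces and decompositions are inherited from \<open>Dist\<close>; the socle
  condition is \<open>translate_eq_character\<close>, because \<Lambda> acts on functionals by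
  translation.\<close>

lemma cyclic_weight_module:
  assumes \<chi>: "algebra_hom s\<Lambda> (*) \<chi>" and \<mm>: "\<mm> = {a. \<chi> a = 0}"
  shows "cyclic_weight_module Fop (cyclic \<chi>) emb (cofinite_maximal_ideals s\<Lambda>) \<mm> \<chi>"
proof -
  note cof = dist.character_cofinite[OF assms]
  have \<chi>D: "\<chi> \<in> carrier Dist" using dist.dist_at_subset_distributions[OF cof(1,2)] by simp
  note sub = Dist.cyclic_submodule(1)[OF \<chi>D] and gen = Dist.cyclic_submodule(2)[OF \<chi>D]
  interpret C: weight_module Fop "cyclic \<chi>" emb by (rule Dist.weight_module_submodule[OF sub])
  have car: "cyclic_submodule Fop Dist \<chi> \<subseteq> carrier Dist" using sub by (simp add: Dist.submodule_iff)
  have weight: "weight_space emb (cyclic \<chi>) \<mm> = dist_at s\<Lambda> \<mm> \<inter> cyclic_submodule Fop Dist \<chi>"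
    using Dist.weight_space_submodule[OF car, of \<mm>] weight_space_Dist[OF cof(1)] by simp
  have max: "maximalideal \<nn> ring_of_type_algebra" if "\<nn> \<in> cofinite_maximal_ideals s\<Lambda>" for \<nn>
    using that by (simp add: cofinite_maximal_ideals_def)
  show ?thesis
  proof (intro cyclic_weight_module.intro cyclic_weight_module_axioms.intro C.weight_module_axioms max)
    show "C.weight_decomposable (cofinite_maximal_ideals s\<Lambda>) v" if "v \<in> carrier (cyclic \<chi>)" for v
      using that car Dist_decomposable
      by (intro Dist.weight_decomposable_submodule[OF max sub]) auto
    show "\<mm> \<in> cofinite_maximal_ideals s\<Lambda>" by (rule cof(1))
    show "\<chi> \<in> weight_space emb (cyclic \<chi>) \<mm>" using cof(2) gen weight by simp
    show "\<chi> \<noteq> \<zero>\<^bsub>cyclic \<chi>\<^esub>" using cof(3) by simp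
    show "\<exists>r\<in>carrier Fop. v = r \<odot>\<^bsub>cyclic \<chi>\<^esub> \<chi>" if "v \<in> carrier (cyclic \<chi>)" for v
      using that by (auto simp: cyclic_submodule_def)
    show "\<exists>a. emb a \<odot>\<^bsub>cyclic \<chi>\<^esub> \<eta> = \<chi>"
      if "\<eta> \<in> weight_space emb (cyclic \<chi>) \<mm>" "\<eta> \<noteq> \<zero>\<^bsub>cyclic \<chi>\<^esub>" for \<eta>
    proof -
      have "\<eta> \<in> dist_at s\<Lambda> \<mm>" "\<eta> \<noteq> 0" using that weight by auto
      then obtain a where "translate \<eta> a = \<chi>" using dist.translate_eq_character[OF assms] by blast
      then show ?thesis using emb_smult[of a \<eta>] by auto
    qed
  qed
qed

end

text \<open>Uniqueness of the simple quotient is uniqueness of the submodule \<open>N\<close>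
  itself, not only of the quotient up to isomorphism; the last clause then describes the quotient by
  that \<open>N\<close>.\<close>

theorem theorem4p6:
  fixes sH :: "'k::field \<Rightarrow> 'h::ring_1 \<Rightarrow> 'h"
    and \<Delta> :: "'h \<Rightarrow> ('h \<times> 'h) list" and \<epsilon> :: "'h \<Rightarrow> 'k" and S :: "'h \<Rightarrow> 'h"
    and H :: "'h set"
    and s\<Lambda> :: "'k \<Rightarrow> 'l::idom \<Rightarrow> 'l" and act :: "'h \<Rightarrow> 'l \<Rightarrow> 'l"
    and actL :: "'h \<Rightarrow> 'l fract \<Rightarrow> 'l fract"
    and sS :: "'k \<Rightarrow> 's::ring_1 \<Rightarrow> 's"
    and \<iota>L :: "'l fract \<Rightarrow> 's" and \<iota>H :: "'h \<Rightarrow> 's"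
    and F :: "'s set"
  assumes "hopf_galois_setting sH \<Delta> \<epsilon> S H s\<Lambda> act actL sS \<iota>L \<iota>H"
    and "galois_order actL H s\<Lambda> sS \<iota>L \<iota>H F"
  shows "let Fop = opposite_algebra F;
             emb = (\<lambda>a. \<iota>L (to_fract a));
             Dual = dual_module s\<Lambda> actL \<iota>L \<iota>H;
             Dist = Dual\<lparr>carrier := distributions s\<Lambda>\<rparr>
         in left_module Fop Dual \<and> submodule (distributions s\<Lambda>) Fop Dual \<and>
            harish_chandra s\<Lambda> emb Fop Dist \<and>
            (\<forall>\<chi> \<mm>. algebra_hom s\<Lambda> (*) \<chi> \<and> \<mm> = {a. \<chi> a = 0} \<longrightarrow>
               (let C = Dist\<lparr>carrier := cyclic_submodule Fop Dist \<chi>\<rparr>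
                in \<chi> \<in> distributions s\<Lambda> \<and>
                   (\<exists>!N. submodule N Fop C \<and> simple_module Fop (quotient_module C N)) \<and>
                   (\<forall>N. submodule N Fop C \<and> simple_module Fop (quotient_module C N) \<longrightarrow>
                      (let V = quotient_module C N
                       in simple_module Fop V \<and> harish_chandra s\<Lambda> emb Fop V \<and>
                          weight_space emb V \<mm> \<noteq> {\<zero>\<^bsub>V\<^esub>}))))"
proof -
  interpret hopf_galois_setting sH \<Delta> \<epsilon> S H s\<Lambda> act actL sS \<iota>L \<iota>H by fact
  interpret galois_order_setting sH \<Delta> \<epsilon> S H s\<Lambda> act actL sS \<iota>L \<iota>H F
    by unfold_locales fact
  show ?thesis
    unfolding Let_def
  proof (intro conjI allI impI left_module_Dual submodule_distributions harish_chandra_Dist)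
    fix \<chi> \<mm> assume "algebra_hom s\<Lambda> (*) \<chi> \<and> \<mm> = {a. \<chi> a = 0}"
    then have \<chi>: "algebra_hom s\<Lambda> (*) \<chi>" "\<mm> = {a. \<chi> a = 0}" by blast+
    interpret C: cyclic_weight_module Fop "cyclic \<chi>" emb "cofinite_maximal_ideals s\<Lambda>" \<mm> \<chi>
      by (rule cyclic_weight_module[OF \<chi>])
    show "\<chi> \<in> distributions s\<Lambda>"
      using dist.character_cofinite[OF \<chi>] dist.dist_at_subset_distributions by blast
    show "\<exists>!N. submodule N Fop (cyclic \<chi>) \<and> simple_module Fop (quotient_module (cyclic \<chi>) N)"
      by (rule C.unique_simple_quotient)
    fix N assume "submodule N Fop (cyclic \<chi>) \<and> simple_module Fop (quotient_module (cyclic \<chi>) N)"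
    then have N: "submodule N Fop (cyclic \<chi>)"
      and simple: "simple_module Fop (quotient_module (cyclic \<chi>) N)" by blast+
    show "simple_module Fop (quotient_module (cyclic \<chi>) N)" by (rule simple)
    interpret V: weight_module Fop "quotient_module (cyclic \<chi>) N" emb
      by (rule C.weight_module_quotient[OF N])
    show "harish_chandra s\<Lambda> emb Fop (quotient_module (cyclic \<chi>) N)"
    proof (rule V.harish_chandraI)
      fix v assume "v \<in> carrier (quotient_module (cyclic \<chi>) N)"
      then obtain w where "w \<in> carrier (cyclic \<chi>)" "v = N +>\<^bsub>cyclic \<chi>\<^esub> w"
        unfolding submodule_of_left_module.carrier_quotient[OF C.submodule_of_left_module[OF N]] by blast
      then show "V.weight_decomposable (cofinite_maximal_ideals s\<Lambda>) v"
        using C.weight_decomposable_quotient[OF N C.decomposable] by blast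
    qed
    show "weight_space emb (quotient_module (cyclic \<chi>) N) \<mm> \<noteq>
        {\<zero>\<^bsub>quotient_module (cyclic \<chi>) N\<^esub>}"
      by (rule C.simple_quotient_weight_space[OF N simple])
  qed
qed

end
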